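(* Let $p\in(2,\infty)$, $L>0$, and $P_0,P_1\in\mathbf{R}^2$ with $|P_1-P_0|<L$. If $|P_1-P_0|>\frac{1}{p-1}L$, then there exists an uncountable family $\{\gamma_\delta\}_{\delta}$ of local minimizers of $\mathcal{B}_p$ in $\mathcal{A}_{\mathrm{pin}}(P_0,P_1,L)$ such that $\sup_{\delta}\mathcal{B}_p[\gamma_\delta]=\infty$.
   Context: For $L>0$ let $W^{2,p}_{\mathrm{arc}}(0,L;\mathbf{R}^2):=\{\gamma\in W^{2,p}(0,L;\mathbf{R}^2) : |\gamma'|\equiv 1\}$ (arclength parametrized planar curves of length $L$ in the Sobolev class $W^{2,p}$; recall $W^{2,p}(0,L)\subset C^1([0,L])$). The $p$-bending energy of a planar curve is $\mathcal{B}_p[\gamma]:=\int_\gamma |k|^p\,ds$, where $k$ is the signed curvature and $s$ the arclength parameter (so $\mathcal{B}_p[\gamma]=\int_0^L|\gamma''|^p\,ds$ for $\gamma\in W^{2,p}_{\mathrm{arc}}(0,L;\mathbf{R}^2)$). For $P_0,P_1\in\mathbf{R}^2$ with $|P_1-P_0|<L$, $\mathcal{A}_{\mathrm{pin}}(P_0,P_1,L):=\{\gamma\in W^{2,p}_{\mathrm{arc}}(0,L;\mathbf{R}^2) : \gamma(0)=P_0,\ \gamma(L)=P_1\}$, equipped with the $W^{2,p}$-Sobolev metric. A curve $\gamma\in\mathcal{A}_{\mathrm{pin}}$ is a local minimizer of $\mathcal{B}_p$ in $\mathcal{A}_{\mathrm{pin}}$ if $\mathcal{B}_p[\eta]\ge\mathcal{B}_p[\gamma]$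 for all $\eta\in\mathcal{A}_{\mathrm{pin}}$ in some neighborhood of $\gamma$ (with respect to this metric). *)

theory Defs
  imports "HOL-Analysis.Analysis"
begin

section \<open>The Sobolev space $W^{2,p}(0,L;\mathbf{R}^2)$\<close>

text \<open>Weak derivatives on the open interval \<open>(0,L)\<close> are tested against compactly supported
  functions of class \<open>C\<^sup>1\<close>, the usual convention for Sobolev spaces in dimension one; smooth
  test functions give the same notion.\<close>

definition test_function :: "real \<Rightarrow> (real \<Rightarrow> real) \<Rightarrow> bool" where
  "test_function L \<phi> \<longleftrightarrow> \<phi> C1_differentiable_on UNIV \<and>
     compact (closure {x. \<phi> x \<noteq> 0}) \<and> closure {x. \<phi> x \<noteq> 0} \<subseteq> {0<..<L}"

definition locally_integrable :: "real \<Rightarrow> (real \<Rightarrow> real ^ 2) \<Rightarrow> bool" where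
  "locally_integrable L f \<longleftrightarrow>
     (\<forall>K. compact K \<and> K \<subseteq> {0<..<L} \<longrightarrow> integrable (lebesgue_on K) f)"

definition has_weak_deriv :: "real \<Rightarrow> (real \<Rightarrow> real ^ 2) \<Rightarrow> (real \<Rightarrow> real ^ 2) \<Rightarrow> bool" where
  "has_weak_deriv L f g \<longleftrightarrow> locally_integrable L f \<and> locally_integrable L g \<and>
     (\<forall>\<phi>. test_function L \<phi> \<longrightarrow>
        (LINT x|lebesgue_on {0<..<L}. deriv \<phi> x *\<^sub>R f x) =
        - (LINT x|lebesgue_on {0<..<L}. \<phi> x *\<^sub>R g x))"

text \<open>Weak derivatives are unique up to null subsets of \<open>(0,L)\<close>; this picks one of them. Everything
  below depends only on its almost-everywhere class.\<close>

definition weak_deriv :: "real \<Rightarrow> (real \<Rightarrow> real ^ 2) \<Rightarrow> real \<Rightarrow> real ^ 2" where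
  "weak_deriv L f = (SOME g. has_weak_deriv L f g)"

definition Lp :: "real \<Rightarrow> real \<Rightarrow> (real \<Rightarrow> real ^ 2) set" where
  "Lp p L = {f. f \<in> borel_measurable (lebesgue_on {0<..<L}) \<and>
                integrable (lebesgue_on {0<..<L}) (\<lambda>x. norm (f x) powr p)}"

definition Lp_norm :: "real \<Rightarrow> real \<Rightarrow> (real \<Rightarrow> real ^ 2) \<Rightarrow> real" where
  "Lp_norm p L f = (LINT x|lebesgue_on {0<..<L}. norm (f x) powr p) powr (1 / p)"

text \<open>An element of \<open>W\<^sup>2\<^sup>,\<^sup>p\<close> is represented by its unique continuous representative on \<open>[0,L]\<close>.
  Extensionality (a fixed dummy value outside \<open>[0,L]\<close>) makes equality of Isabelle functions coincide
  with equality of Sobolev functions, so that cardinalities of sets of curves are meaningful.\<close>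

definition W2p :: "real \<Rightarrow> real \<Rightarrow> (real \<Rightarrow> real ^ 2) set" where
  "W2p p L = {f. f \<in> extensional {0..L} \<and> continuous_on {0..L} f \<and> f \<in> Lp p L \<and>
                 (\<exists>g\<in>Lp p L. \<exists>h\<in>Lp p L. has_weak_deriv L f g \<and> has_weak_deriv L g h)}"

definition W2p_norm :: "real \<Rightarrow> real \<Rightarrow> (real \<Rightarrow> real ^ 2) \<Rightarrow> real" where
  "W2p_norm p L f = Lp_norm p L f + Lp_norm p L (weak_deriv L f)
                    + Lp_norm p L (weak_deriv L (weak_deriv L f))"

definition W2p_dist :: "real \<Rightarrow> real \<Rightarrow> (real \<Rightarrow> real ^ 2) \<Rightarrow> (real \<Rightarrow> real ^ 2) \<Rightarrow> real" where
  "W2p_dist p L f g = W2p_norm p L (\<lambda>x. f x - g x)"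

section \<open>Curves, bending energy and local minimizers\<close>

text \<open>As \<open>\<gamma>'\<close> has a continuous representative, \<open>\<bar>\<gamma>'\<bar> = 1\<close> almost everywhere means \<open>\<bar>\<gamma>'\<bar> \<equiv> 1\<close> for the
  classical derivative of \<open>\<gamma>\<close> on \<open>[0,L]\<close>.\<close>

definition W2p_arc :: "real \<Rightarrow> real \<Rightarrow> (real \<Rightarrow> real ^ 2) set" where
  "W2p_arc p L = {\<gamma> \<in> W2p p L. AE s in lebesgue_on {0<..<L}. norm (weak_deriv L \<gamma> s) = 1}"

text \<open>Signed curvature \<open>det (\<gamma>', \<gamma>'')\<close> of an arclength parametrized curve; \<open>\<bar>k\<bar> = \<bar>\<gamma>''\<bar>\<close> since \<open>\<gamma>''\<close>
  is orthogonal to \<open>\<gamma>'\<close>.\<close>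

definition signed_curvature :: "real \<Rightarrow> (real \<Rightarrow> real ^ 2) \<Rightarrow> real \<Rightarrow> real" where
  "signed_curvature L \<gamma> s =
     (let T = weak_deriv L \<gamma> s; A = weak_deriv L (weak_deriv L \<gamma>) s
      in T $ 1 * A $ 2 - T $ 2 * A $ 1)"

definition bending_energy :: "real \<Rightarrow> real \<Rightarrow> (real \<Rightarrow> real ^ 2) \<Rightarrow> real" where
  "bending_energy p L \<gamma> = (LINT s|lebesgue_on {0<..<L}. \<bar>signed_curvature L \<gamma> s\<bar> powr p)"

definition A_pin :: "real \<Rightarrow> real ^ 2 \<Rightarrow> real ^ 2 \<Rightarrow> real \<Rightarrow> (real \<Rightarrow> real ^ 2) set" where
  "A_pin p P0 P1 L = {\<gamma> \<in> W2p_arc p L. \<gamma> 0 = P0 \<and> \<gamma> L = P1}"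

definition local_minimizer :: "real \<Rightarrow> real ^ 2 \<Rightarrow> real ^ 2 \<Rightarrow> real \<Rightarrow> (real \<Rightarrow> real ^ 2) \<Rightarrow> bool" where
  "local_minimizer p P0 P1 L \<gamma> \<longleftrightarrow> \<gamma> \<in> A_pin p P0 P1 L \<and>
     (\<exists>\<epsilon>>0. \<forall>\<eta>\<in>A_pin p P0 P1 L.
        W2p_dist p L \<eta> \<gamma> < \<epsilon> \<longrightarrow> bending_energy p L \<eta> \<ge> bending_energy p L \<gamma>)"

end

(* The minimizers are flat-core curves: a segment of length s0 in the direction of P1 - P0, then n
   identical loops, then another segment in the same direction. In terms of the tangent angle x, a
   loop solves x' = v x with v x = mu * |sin (x / 2)| powr (2 / p). Since p > 2, v is not Lipschitz
   at 0, so a full loop takes finite time and may start and end with a straight segment. The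
   horizontal displacement of a loop is its length divided by p - 1, which determines the total
   length l of the loops; l < L is exactly the assumption on |P1 - P0|. Varying s0 gives
   uncountably many curves, and the energy grows like n powr p.

   For local minimality only the constraint on the displacement in the direction of P1 - P0 is
   needed. Up to a constant fixed by it, the energy is the integral of
   |x'| powr p + (p - 1) * v x powr p, which by Young's inequality dominates the increment of G(x),
   where G' = p * v powr (p - 1), with equality along the flat-core curve. A competitor can only gain
   where its angle does not reach 0 or 2 * pi * n on the end segments, say misses it by m. The gain
   G m is of order m powr (3 - 2 / p), whereas the potential along the whole segment costs order
   v m powr p, that is m powr 2, which dominates because p > 2. *)

theory Submission
  imports Defs
begin

section \<open>Absolutely continuous functions on an interval\<close>

text \<open>\<open>primitive_on a b F f\<close> is absolute continuity with the derivative carried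
  along. Competitors have a curvature merely in L^p, so their angle is only absolutely continuous,
  and comparing energies requires the chain rule for \<open>G\<close> of such an angle. A second
  obstacle is that \<open>weak_deriv\<close> is an arbitrary choice: each curve is first represented
  by a tangent of norm 1 at every point and a version of the second derivative, and its energy is
  read off from these. The metric enters only through uniform closeness of the tangents. It yields
  an angle of the competitor within \<delta> of the flat-core angle on all of [0,L]: a loop cannot
  be unwound, and on the end segments the angle stays near 0 and near 2 pi n. On such a segment the
  two effects to be weighed are tied together by the time that the profile needs to leave 0: it is
  finite and tends to 0 with the angle, so for small \<delta> it is short compared with the
  segment.\<close>

definition primitive_on :: "real \<Rightarrow> real \<Rightarrow> (real \<Rightarrow> 'a::euclidean_space) \<Rightarrow> (real \<Rightarrow> 'a) \<Rightarrow> bool" where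
  "primitive_on a b F f \<longleftrightarrow> f absolutely_integrable_on {a..b} \<and>
     (\<forall>x\<in>{a..b}. F x = F a + integral {a..x} f)"

lemma primitive_on_integrable:
  "primitive_on a b F f \<Longrightarrow> f absolutely_integrable_on {a..b}"
  by (simp add: primitive_on_def)

lemma primitive_on_eq:
  "primitive_on a b F f \<Longrightarrow> x \<in> {a..b} \<Longrightarrow> F x = F a + integral {a..x} f"
  unfolding primitive_on_def by blast

lemma absolutely_integrable_on_Icc_subset:
  fixes f :: "real \<Rightarrow> 'a::euclidean_space"
  assumes "f absolutely_integrable_on {a..b}" "a \<le> c" "d \<le> b"
  shows "f absolutely_integrable_on {c..d}"
  using absolutely_integrable_on_subinterval[OF assms(1)] assms by auto

lemma primitive_on_diff:
  assumes "primitive_on a b F f" "a \<le> x" "x \<le> y" "y \<le> b"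
  shows "F y - F x = integral {x..y} f"
proof -
  have "f integrable_on {a..y}"
    using assms absolutely_integrable_on_Icc_subset[of a b f a y]
    by (auto simp: primitive_on_def absolutely_integrable_on_def)
  then have "integral {a..y} f = integral {a..x} f + integral {x..y} f"
    using Henstock_Kurzweil_Integration.integral_combine[of a x y f] assms by simp
  moreover have "F y - F a = integral {a..y} f" "F x - F a = integral {a..x} f"
    using assms primitive_on_eq[OF assms(1), of x] primitive_on_eq[OF assms(1), of y]
    by (metis add_diff_cancel_left' atLeastAtMost_iff order_trans)+
  ultimately have "(F y - F a) - (F x - F a) = integral {x..y} f" by (simp only: add_diff_cancel_left')
  then show ?thesis by simp
qed

lemma primitive_onI:
  assumes "f absolutely_integrable_on {a..b}"
    and "\<And>x y. a \<le> x \<Longrightarrow> x \<le> y \<Longrightarrow> y \<le> b \<Longrightarrow> F y - F x = integral {x..y} f"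
  shows "primitive_on a b F f"
  unfolding primitive_on_def
proof (intro conjI ballI)
  fix x assume "x \<in> {a..b}"
  then have "F x - F a = integral {a..x} f" using assms(2)[of a x] by simp
  then show "F x = F a + integral {a..x} f" by (metis add.commute diff_add_cancel)
qed (rule assms(1))

lemma primitive_on_subinterval:
  assumes "primitive_on a b F f" "a \<le> c" "d \<le> b"
  shows "primitive_on c d F f"
proof (rule primitive_onI)
  show "f absolutely_integrable_on {c..d}"
    using absolutely_integrable_on_Icc_subset[OF primitive_on_integrable] assms by blast
  fix x y assume "c \<le> x" "x \<le> y" "y \<le> d"
  then show "F y - F x = integral {x..y} f"
    using primitive_on_diff[OF assms(1), of x y] assms(2,3) by (metis order_trans)
qed

lemma primitive_on_continuous:
  assumes "primitive_on a b F f"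
  shows "continuous_on {a..b} F"
proof -
  have "f integrable_on {a..b}"
    using assms by (auto simp: primitive_on_def absolutely_integrable_on_def)
  then have "continuous_on {a..b} (\<lambda>x. F a + integral {a..x} f)"
    by (intro continuous_intros indefinite_integral_continuous_1)
  then show ?thesis
    by (rule continuous_on_eq) (rule primitive_on_eq[OF assms, symmetric])
qed

lemma primitive_on_cong:
  assumes "primitive_on a b F f" "\<And>x. x \<in> {a..b} \<Longrightarrow> F x = F' x" "\<And>x. x \<in> {a..b} \<Longrightarrow> f x = f' x"
  shows "primitive_on a b F' f'"
proof (rule primitive_onI)
  show "f' absolutely_integrable_on {a..b}"
    using absolutely_integrable_spike[OF primitive_on_integrable[OF assms(1)], of "{}" f'] assms(3) by auto
  fix x y assume xy: "a \<le> x" "x \<le> y" "y \<le> b"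
  have "integral {x..y} f' = integral {x..y} f"
    by (rule Henstock_Kurzweil_Integration.integral_cong) (use assms(3) xy in auto)
  then show "F' y - F' x = integral {x..y} f'"
    using primitive_on_diff[OF assms(1) xy] assms(2) xy by auto
qed

lemma primitive_on_add:
  assumes "primitive_on a b F f" "primitive_on a b H h"
  shows "primitive_on a b (\<lambda>x. F x + H x) (\<lambda>x. f x + h x)"
proof (rule primitive_onI)
  show "(\<lambda>x. f x + h x) absolutely_integrable_on {a..b}"
    using assms by (auto simp: primitive_on_def intro: set_integral_add)
  fix x y assume xy: "a \<le> x" "x \<le> y" "y \<le> b"
  have "f integrable_on {x..y}" "h integrable_on {x..y}"
    using assms xy absolutely_integrable_on_Icc_subset[of a b _ x y]
    by (auto simp: primitive_on_def absolutely_integrable_on_def)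
  then show "F y + H y - (F x + H x) = integral {x..y} (\<lambda>x. f x + h x)"
    using primitive_on_diff[OF assms(1) xy] primitive_on_diff[OF assms(2) xy]
    by (simp add: Henstock_Kurzweil_Integration.integral_add algebra_simps)
qed

lemma primitive_on_linear:
  fixes F f :: "real \<Rightarrow> 'a::euclidean_space" and l :: "'a \<Rightarrow> 'b::euclidean_space"
  assumes "primitive_on a b F f" "bounded_linear l"
  shows "primitive_on a b (\<lambda>x. l (F x)) (\<lambda>x. l (f x))"
proof (rule primitive_onI)
  show "(\<lambda>x. l (f x)) absolutely_integrable_on {a..b}"
    using absolutely_integrable_linear[OF _ assms(2), of "{a..b}" f] assms(1)
    by (auto simp: primitive_on_def o_def)
  fix x y assume xy: "a \<le> x" "x \<le> y" "y \<le> b"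
  have i: "f integrable_on {x..y}"
    using assms xy absolutely_integrable_on_Icc_subset[of a b _ x y]
    by (auto simp: primitive_on_def absolutely_integrable_on_def)
  then show "l (F y) - l (F x) = integral {x..y} (\<lambda>x. l (f x))"
    using integral_linear[OF i assms(2)] primitive_on_diff[OF assms(1) xy, symmetric]
    by (simp add: o_def linear_diff[OF bounded_linear.linear[OF assms(2)]])
qed

lemmas primitive_on_minus = primitive_on_linear[OF _ bounded_linear_minus[OF bounded_linear_ident]]
lemmas primitive_on_mult_left = primitive_on_linear[OF _ bounded_linear_mult_right]
lemmas primitive_on_nth = primitive_on_linear[OF _ bounded_linear_vec_nth]

lemma primitive_on_minus_fun:
  assumes "primitive_on a b F f" "primitive_on a b H h"
  shows "primitive_on a b (\<lambda>x. F x - H x) (\<lambda>x. f x - h x)"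
  using primitive_on_add[OF assms(1) primitive_on_minus[OF assms(2)]] by simp

lemma primitive_on_const: "primitive_on a b (\<lambda>x. c) (\<lambda>x. 0)"
  by (simp add: primitive_on_def)

lemma primitive_on_vec_lambda:
  fixes F f :: "2 \<Rightarrow> real \<Rightarrow> real"
  assumes "\<And>i. primitive_on a b (F i) (f i)"
  shows "primitive_on a b (\<lambda>x. (\<chi> i. F i x) :: real^2) (\<lambda>x. \<chi> i. f i x)"
proof -
  have bl: "bounded_linear (\<lambda>r. r *\<^sub>R axis i (1::real) :: real^2)" for i
    by (rule bounded_linear_scaleR_left)
  have e: "(\<chi> i. f i) = f 1 *\<^sub>R axis 1 1 + f 2 *\<^sub>R (axis 2 1 :: real^2)" for f :: "2 \<Rightarrow> real"
    by (simp add: vec_eq_iff forall_2 axis_def)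
  show ?thesis unfolding e
    by (intro primitive_on_add primitive_on_linear[OF assms bl])
qed

text \<open>The finite exceptional set \<open>S\<close> serves the flat-core angle, whose derivative
  is computed only away from the joints of the loops.\<close>

lemma primitive_on_has_vector_derivative:
  fixes F f :: "real \<Rightarrow> 'a::euclidean_space"
  assumes "finite S" "continuous_on {a..b} F" "continuous_on {a..b} f"
    and "\<And>x. x \<in> {a<..<b} - S \<Longrightarrow> (F has_vector_derivative f x) (at x)"
  shows "primitive_on a b F f"
proof (rule primitive_onI)
  show "f absolutely_integrable_on {a..b}"
    using assms(3) by (rule absolutely_integrable_continuous_real)
  fix x y assume xy: "a \<le> x" "x \<le> y" "y \<le> b"
  have "(f has_integral (F y - F x)) {x..y}"
    using assms xy
    by (intro fundamental_theorem_of_calculus_interior_strong[OF \<open>finite S\<close>])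
       (auto elim!: continuous_on_subset)
  then show "F y - F x = integral {x..y} f" by (simp add: integral_unique)
qed

text \<open>The bound \<open>e * integral {u..v} g\<close> is additive over adjacent intervals, so
  bisection carries it from small intervals to all of \<open>{a..b}\<close>; then \<open>e\<close>
  tends to 0. Weighting with the integral of \<open>g\<close> instead of the length
  \<open>v - u\<close> is what admits an unbounded derivative in the chain rule.\<close>

lemma eq_endpoints_if_locally_small_increments:
  fixes H g :: "real \<Rightarrow> real"
  assumes "a \<le> b" and g: "g integrable_on {a..b}"
    and loc: "\<And>e x. 0 < e \<Longrightarrow> a \<le> x \<Longrightarrow> x \<le> b \<Longrightarrow>
      \<exists>d>0. \<forall>u v. a \<le> u \<and> u \<le> x \<and> x \<le> v \<and> v \<le> b \<and> v - u < d \<longrightarrow> \<bar>H v - H u\<bar> \<le> e * integral {u..v} g"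
  shows "H b = H a"
proof -
  define I where "I = integral {a..b} g"
  have *: "\<bar>H b - H a\<bar> \<le> e * I" if "e > 0" for e
  proof -
    have "a \<le> a \<and> b \<le> b \<longrightarrow> \<bar>H b - H a\<bar> \<le> e * integral {a..b} g"
    proof (rule Bolzano[where P = "\<lambda>u v. a \<le> u \<and> v \<le> b \<longrightarrow> \<bar>H v - H u\<bar> \<le> e * integral {u..v} g"])
      fix u w v assume A: "a \<le> u \<and> w \<le> b \<longrightarrow> \<bar>H w - H u\<bar> \<le> e * integral {u..w} g"
        "a \<le> w \<and> v \<le> b \<longrightarrow> \<bar>H v - H w\<bar> \<le> e * integral {w..v} g" "u \<le> w" "w \<le> v"
      show "a \<le> u \<and> v \<le> b \<longrightarrow> \<bar>H v - H u\<bar> \<le> e * integral {u..v} g"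
      proof (intro impI)
        assume B: "a \<le> u \<and> v \<le> b"
        have "g integrable_on {u..v}" using g B by (auto elim: integrable_subinterval_real)
        then have "integral {u..v} g = integral {u..w} g + integral {w..v} g"
          using Henstock_Kurzweil_Integration.integral_combine[of u w v g] A by simp
        then show "\<bar>H v - H u\<bar> \<le> e * integral {u..v} g" using A B by (auto simp: algebra_simps)
      qed
    qed (use assms(1) loc[OF that] in blast)+
    then show ?thesis by (simp add: I_def)
  qed
  have "\<bar>H b - H a\<bar> \<le> 0"
  proof (rule field_le_epsilon)
    fix e :: real assume "e > 0"
    have "\<bar>H b - H a\<bar> \<le> e / (\<bar>I\<bar> + 1) * I" by (rule *) (use \<open>e > 0\<close> in simp)
    also have "\<dots> \<le> e" using \<open>e > 0\<close> by (auto simp: divide_simps split: abs_split)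
    finally show "\<bar>H b - H a\<bar> \<le> 0 + e" by simp
  qed
  then show ?thesis by simp
qed

lemma absolutely_integrable_continuous_mult:
  fixes f g :: "real \<Rightarrow> real"
  assumes "continuous_on {a..b} f" "g absolutely_integrable_on {a..b}"
  shows "(\<lambda>x. f x * g x) absolutely_integrable_on {a..b}"
proof (rule absolutely_integrable_bounded_measurable_product_real)
  show "f \<in> borel_measurable (lebesgue_on {a..b})"
    using assms(1) by (rule continuous_imp_measurable_on_sets_lebesgue) auto
  show "bounded (f ` {a..b})"
    using assms(1) by (intro compact_imp_bounded compact_continuous_image) auto
qed (use assms in auto)

text \<open>Locally, the mean value theorem for \<open>G\<close> and the intermediate value theorem
  for \<open>F\<close> turn the increment of \<open>G (F x)\<close> into \<open>G' (F w)\<close>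
  times the integral of \<open>f\<close>; uniform continuity of \<open>G' (F x)\<close> keeps the
  error below \<open>e\<close> times the integral of \<open>\<bar>f\<bar>\<close>. \<open>F\<close>
  is never differentiated pointwise.\<close>

lemma primitive_on_chain:
  fixes F f :: "real \<Rightarrow> real"
  assumes F: "primitive_on a b F f"
    and G: "\<And>y. y \<in> F ` {a..b} \<Longrightarrow> (G has_real_derivative G' y) (at y)"
    and G': "continuous_on (F ` {a..b}) G'"
  shows "primitive_on a b (\<lambda>x. G (F x)) (\<lambda>x. G' (F x) * f x)"
proof -
  have cF: "continuous_on {a..b} F" by (rule primitive_on_continuous[OF F])
  have cg: "continuous_on {a..b} (\<lambda>x. G' (F x))"
    using continuous_on_compose[OF cF G'] by (simp add: o_def)
  have ai: "f absolutely_integrable_on {a..b}" by (rule primitive_on_integrable[OF F])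
  have aig: "(\<lambda>x. G' (F x) * f x) absolutely_integrable_on {a..b}"
    by (rule absolutely_integrable_continuous_mult[OF cg ai])
  have uc: "uniformly_continuous_on {a..b} (\<lambda>x. G' (F x))"
    by (rule compact_uniformly_continuous[OF cg]) auto
  show ?thesis
  proof (rule primitive_onI[OF aig])
    fix x y assume xy: "a \<le> x" "x \<le> y" "y \<le> b"
    \<comment> \<open>\<open>H\<close> is the defect of the claimed formula; it turns out to be
      constant.\<close>
    define H where "H u = G (F u) - integral {a..u} (\<lambda>x. G' (F x) * f x)" for u
    have Hd: "H v - H u = G (F v) - G (F u) - integral {u..v} (\<lambda>x. G' (F x) * f x)"
      if "a \<le> u" "u \<le> v" "v \<le> b" for u v
    proof -
      have "(\<lambda>x. G' (F x) * f x) integrable_on {a..v}"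
        using absolutely_integrable_on_Icc_subset[OF aig] that by (auto simp: absolutely_integrable_on_def)
      from Henstock_Kurzweil_Integration.integral_combine[OF that(1,2) this]
      show ?thesis by (simp add: H_def)
    qed
    have "H y = H x"
    proof (rule eq_endpoints_if_locally_small_increments[OF xy(2)])
      show "(\<lambda>x. \<bar>f x\<bar>) integrable_on {x..y}"
        using absolutely_integrable_on_Icc_subset[OF ai] xy by (auto simp: absolutely_integrable_on_def)
      fix e z :: real assume e: "e > 0" and z: "x \<le> z" "z \<le> y"
      from uc e obtain d where d: "d > 0"
        "\<And>u v. u \<in> {a..b} \<Longrightarrow> v \<in> {a..b} \<Longrightarrow> dist v u < d \<Longrightarrow> dist (G' (F v)) (G' (F u)) < e"
        unfolding uniformly_continuous_on_def by meson
      have "\<bar>H v - H u\<bar> \<le> e * integral {u..v} (\<lambda>x. \<bar>f x\<bar>)" if uv: "x \<le> u" "u \<le> z" "z \<le> v" "v \<le> y" "v - u < d" for u v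
      proof -
        have uv': "a \<le> u" "u \<le> v" "v \<le> b" using uv xy by auto
        have cFuv: "continuous_on {u..v} F" using cF by (rule continuous_on_subset) (use uv' in auto)
        have aiuv: "f absolutely_integrable_on {u..v}"
          using ai uv' by (auto intro: absolutely_integrable_on_Icc_subset)
        \<comment> \<open>\<open>G\<close> is known to be differentiable only on the range of
          \<open>F\<close>. The fact \<open>seg\<close> places every value between
          \<open>F u\<close> and \<open>F v\<close> in that range, and it also pulls the mean value
          point back to some \<open>w\<close>.\<close>
        have "\<exists>w\<in>{u..v}. G (F v) - G (F u) = G' (F w) * (F v - F u)"
        proof -
          have seg: "\<exists>w\<in>{u..v}. F w = c" if "min (F u) (F v) \<le> c" "c \<le> max (F u) (F v)" for c
            using IVT'[of F u c v] IVT2'[of F v c u] cFuv uv' that by fastforce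
          consider "F u = F v" | "F u < F v" | "F v < F u" by linarith
          then show ?thesis
          proof cases
            case 1 then show ?thesis using uv' by auto
          next
            case 2
            have "(G has_real_derivative G' c) (at c)" if "F u \<le> c" "c \<le> F v" for c
              using seg[of c] that G uv' by force
            from MVT2[OF 2 this] obtain c where c: "F u < c" "c < F v" "G (F v) - G (F u) = (F v - F u) * G' c"
              by auto
            with seg[of c] show ?thesis by (auto simp: mult.commute)
          next
            case 3
            have "(G has_real_derivative G' c) (at c)" if "F v \<le> c" "c \<le> F u" for c
              using seg[of c] that G uv' by force
            from MVT2[OF 3 this] obtain c where c: "F v < c" "c < F u" "G (F u) - G (F v) = (F u - F v) * G' c"
              by auto
            from seg[of c] c obtain w where "w \<in> {u..v}" "F w = c" by auto
            then show ?thesis using c by (intro bexI[of _ w]) (auto simp: algebra_simps)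
          qed
        qed
        then obtain w where w: "w \<in> {u..v}" "G (F v) - G (F u) = G' (F w) * (F v - F u)" by blast
        have i1: "f integrable_on {u..v}" "(\<lambda>x. \<bar>f x\<bar>) integrable_on {u..v}"
          using aiuv by (auto simp: absolutely_integrable_on_def)
        have i2: "(\<lambda>x. G' (F x) * f x) integrable_on {u..v}"
          using absolutely_integrable_on_Icc_subset[OF aig] uv' by (auto simp: absolutely_integrable_on_def)
        have "H v - H u = G' (F w) * integral {u..v} f - integral {u..v} (\<lambda>x. G' (F x) * f x)"
          using Hd[OF uv'] w primitive_on_diff[OF F uv'] by simp
        also have "\<dots> = integral {u..v} (\<lambda>x. G' (F w) * f x - G' (F x) * f x)"
          using i1 i2 by (subst Henstock_Kurzweil_Integration.integral_diff) (auto intro: integrable_on_mult_right)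
        finally have eq: "H v - H u = integral {u..v} (\<lambda>x. G' (F w) * f x - G' (F x) * f x)" .
        have "norm (integral {u..v} (\<lambda>x. G' (F w) * f x - G' (F x) * f x)) \<le> integral {u..v} (\<lambda>x. e * \<bar>f x\<bar>)"
        proof (rule integral_norm_bound_integral)
          show "(\<lambda>x. G' (F w) * f x - G' (F x) * f x) integrable_on {u..v}"
            using i1 i2 by (intro integrable_diff) (auto intro: integrable_on_mult_right)
          show "(\<lambda>x. e * \<bar>f x\<bar>) integrable_on {u..v}" using i1 by (auto intro: integrable_on_mult_right)
          fix x' assume x': "x' \<in> {u..v}"
          have "dist (G' (F w)) (G' (F x')) < e"
            by (rule d(2)) (use x' w uv' uv in \<open>auto simp: dist_real_def\<close>)
          then have "\<bar>G' (F w) - G' (F x')\<bar> * \<bar>f x'\<bar> \<le> e * \<bar>f x'\<bar>"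
            by (intro mult_right_mono) (auto simp: dist_real_def)
          then show "norm (G' (F w) * f x' - G' (F x') * f x') \<le> e * \<bar>f x'\<bar>"
            by (simp add: left_diff_distrib[symmetric] abs_mult)
        qed
        then show ?thesis by (simp add: eq)
      qed
      then show "\<exists>d>0. \<forall>u v. x \<le> u \<and> u \<le> z \<and> z \<le> v \<and> v \<le> y \<and> v - u < d \<longrightarrow>
          \<bar>H v - H u\<bar> \<le> e * integral {u..v} (\<lambda>x. \<bar>f x\<bar>)"
        using d(1) by blast
    qed
    then show "G (F y) - G (F x) = integral {x..y} (\<lambda>x. G' (F x) * f x)"
      using Hd[OF xy] by simp
  qed
qed

text \<open>Polarization: the product is half of
  \<open>(F x + H x)\<^sup>2 - (F x)\<^sup>2 - (H x)\<^sup>2\<close>, and squares are covered by the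
  chain rule.\<close>

lemma primitive_on_mult:
  fixes F f H h :: "real \<Rightarrow> real"
  assumes F: "primitive_on a b F f" and H: "primitive_on a b H h"
  shows "primitive_on a b (\<lambda>x. F x * H x) (\<lambda>x. f x * H x + F x * h x)"
proof -
  have sq: "primitive_on a b (\<lambda>x. (K x)\<^sup>2) (\<lambda>x. 2 * K x * k x)" if "primitive_on a b K k" for K k :: "real \<Rightarrow> real"
    by (rule primitive_on_chain[OF that]) (auto intro!: derivative_eq_intros continuous_intros)
  have "primitive_on a b (\<lambda>x. (1/2) * ((F x + H x)\<^sup>2 - (F x)\<^sup>2 - (H x)\<^sup>2))
     (\<lambda>x. (1/2) * (2 * (F x + H x) * (f x + h x) - 2 * F x * f x - 2 * H x * h x))"
    by (intro primitive_on_mult_left primitive_on_minus_fun primitive_on_add sq assms)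
  then show ?thesis
    by (rule primitive_on_cong) (auto simp: power2_eq_square algebra_simps)
qed

section \<open>Weak derivatives in one dimension\<close>

lemma integrable_lebesgue_on_iff:
  fixes f :: "'a::euclidean_space \<Rightarrow> 'b::euclidean_space"
  assumes "S \<in> sets lebesgue"
  shows "integrable (lebesgue_on S) f \<longleftrightarrow> f absolutely_integrable_on S"
  using assms by (simp add: integrable_restrict_space set_integrable_def)

lemma absolutely_integrable_continuous_scaleR:
  fixes f :: "real \<Rightarrow> real" and g :: "real \<Rightarrow> 'a::euclidean_space"
  assumes "continuous_on {a..b} f" "g absolutely_integrable_on {a..b}"
  shows "(\<lambda>x. f x *\<^sub>R g x) absolutely_integrable_on {a..b}"
proof (rule absolutely_integrable_bounded_measurable_product[where h = "(*\<^sub>R)"])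
  show "bilinear ((*\<^sub>R) :: real \<Rightarrow> 'a \<Rightarrow> 'a)"
    by (simp add: bilinear_conv_bounded_bilinear bounded_bilinear_scaleR)
  show "f \<in> borel_measurable (lebesgue_on {a..b})"
    using assms(1) by (rule continuous_imp_measurable_on_sets_lebesgue) auto
  show "bounded (f ` {a..b})"
    using assms(1) by (intro compact_imp_bounded compact_continuous_image) auto
qed (use assms in auto)

lemma lebesgue_integral_on_support:
  fixes f :: "real \<Rightarrow> 'b::euclidean_space"
  assumes "0 < a" "b < L" "\<And>x. x \<notin> {a..b} \<Longrightarrow> f x = 0" "f absolutely_integrable_on {a..b}"
  shows "integrable (lebesgue_on {0<..<L}) f" "(LINT x|lebesgue_on {0<..<L}. f x) = integral {a..b} f"
proof -
  have e: "{x \<in> {a..b} - {0<..<L}. f x \<noteq> 0} = {}" "{x \<in> {0<..<L} - {a..b}. f x \<noteq> 0} = {}"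
    using assms by auto
  have "f absolutely_integrable_on {0<..<L}"
    using absolutely_integrable_spike_set_eq[THEN iffD1, OF _ _ assms(4), of "{0<..<L}"]
    by (simp only: e negligible_empty)
  then show *: "integrable (lebesgue_on {0<..<L}) f"
    by (simp add: integrable_lebesgue_on_iff)
  show "(LINT x|lebesgue_on {0<..<L}. f x) = integral {a..b} f"
  proof -
    have "integral {a..b} f = integral {0<..<L} f"
      by (rule integral_spike_set) (simp_all only: e negligible_empty)
    then show ?thesis using lebesgue_integral_eq_integral[OF *] by simp
  qed
qed

lemma lebesgue_integral_Ioo_eq_Icc:
  fixes f :: "real \<Rightarrow> 'b::euclidean_space"
  shows "integrable (lebesgue_on {0<..<L}) f \<longleftrightarrow> f absolutely_integrable_on {0..L}"
    and "f absolutely_integrable_on {0..L} \<Longrightarrow> (LINT x|lebesgue_on {0<..<L}. f x) = integral {0..L} f"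
proof -
  show *: "integrable (lebesgue_on {0<..<L}) f \<longleftrightarrow> f absolutely_integrable_on {0..L}"
    by (simp add: integrable_lebesgue_on_iff absolutely_integrable_on_Icc_iff_Ioo)
  show "(LINT x|lebesgue_on {0<..<L}. f x) = integral {0..L} f" if "f absolutely_integrable_on {0..L}"
    using * that lebesgue_integral_eq_integral[of "{0<..<L}" f] by (simp add: integral_open_interval_real)
qed

section \<open>Test functions and local integrability\<close>

lemma test_functionE:
  assumes "test_function L \<phi>" "L > 0"
  obtains a b where "0 < a" "a < b" "b < L" "\<And>x. x \<notin> {a..b} \<Longrightarrow> \<phi> x = 0"
    "\<And>x. x \<notin> {a..b} \<Longrightarrow> deriv \<phi> x = 0" "continuous_on UNIV \<phi>" "continuous_on UNIV (deriv \<phi>)"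
    "\<And>x. (\<phi> has_real_derivative deriv \<phi> x) (at x)"
proof -
  let ?K = "closure {x. \<phi> x \<noteq> 0}"
  have K: "compact ?K" "?K \<subseteq> {0<..<L}" and C1: "\<phi> C1_differentiable_on UNIV"
    using assms by (auto simp: test_function_def)
  obtain D where D: "\<And>x. (\<phi> has_vector_derivative D x) (at x)" "continuous_on UNIV D"
    using C1 by (auto simp: C1_differentiable_on_def)
  have D': "(\<phi> has_real_derivative D x) (at x)" for x
    using D by (simp add: has_real_derivative_iff_has_vector_derivative)
  have dD: "deriv \<phi> = D" using D' by (intro ext DERIV_imp_deriv)
  have c\<phi>: "continuous_on UNIV \<phi>"
    using D' by (meson DERIV_isCont continuous_at_imp_continuous_on)
  have "\<exists>a b. 0 < a \<and> a < b \<and> b < L \<and> ?K \<subseteq> {a<..<b}"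
  proof (cases "?K = {}")
    case True then show ?thesis using assms(2) by (intro exI[of _ "L/3"] exI[of _ "L/2"]) auto
  next
    case False
    obtain m where m: "m \<in> ?K" "\<And>x. x \<in> ?K \<Longrightarrow> m \<le> x" using compact_attains_inf[OF K(1) False] by blast
    obtain M where M: "M \<in> ?K" "\<And>x. x \<in> ?K \<Longrightarrow> x \<le> M" using compact_attains_sup[OF K(1) False] by blast
    have "0 < m" "M < L" "m \<le> M" using m M K(2) by auto
    \<comment> \<open>\<open>m / 2\<close> and \<open>(M + L) / 2\<close> leave room on both sides,
      so \<open>a < b\<close> follows from \<open>m \<le> M\<close>.\<close>
    then show ?thesis using m M by (intro exI[of _ "m/2"] exI[of _ "(M+L)/2"]) (auto, force+)
  qed
  then obtain a b where ab: "0 < a" "a < b" "b < L" "?K \<subseteq> {a<..<b}" by blast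
  have z: "\<phi> x = 0" if "x \<notin> ?K" for x using that closure_subset[of "{x. \<phi> x \<noteq> 0}"] by auto
  have "deriv \<phi> x = 0" if "x \<notin> ?K" for x
  proof -
    have op: "open (- ?K)" by (simp add: open_Compl)
    have "x \<in> - ?K" "\<And>y. y \<in> - ?K \<Longrightarrow> 0 = \<phi> y" using that z by (simp_all only: Compl_iff simp_thms)
    from has_field_derivative_transform_within_open[OF DERIV_const op this]
    have "(\<phi> has_real_derivative 0) (at x)" .
    then show ?thesis by (rule DERIV_imp_deriv)
  qed
  then show thesis
    using that[of a b] ab z c\<phi> D D' dD by (metis atLeastAtMost_iff greaterThanLessThan_iff in_mono less_imp_le)
qed

lemma test_functionI:
  assumes "\<And>x. (\<phi> has_real_derivative D x) (at x)" "continuous_on UNIV D"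
    "0 < a" "b < L" "\<And>x. x \<notin> {a..b} \<Longrightarrow> \<phi> x = 0"
  shows "test_function L \<phi>"
proof -
  have "{x. \<phi> x \<noteq> 0} \<subseteq> {a..b}" using assms(5) by blast
  then have s: "closure {x. \<phi> x \<noteq> 0} \<subseteq> {a..b}"
    by (rule closure_minimal) auto
  then have "compact (closure {x. \<phi> x \<noteq> 0})"
    using bounded_subset[of "{a..b}"] by (auto simp: compact_eq_bounded_closed)
  moreover have "\<phi> C1_differentiable_on UNIV"
    using assms(1,2) by (auto simp: C1_differentiable_on_def has_real_derivative_iff_has_vector_derivative)
  ultimately show ?thesis using s assms by (auto simp: test_function_def)
qed

lemma locally_integrable_Icc:
  assumes "locally_integrable L f" "0 < a" "b < L"
  shows "f absolutely_integrable_on {a..b}"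
proof -
  have "integrable (lebesgue_on {a..b}) f"
    using assms unfolding locally_integrable_def by (elim allE[of _ "{a..b}"]) auto
  then show ?thesis by (simp add: integrable_lebesgue_on_iff)
qed

lemma locally_integrableI:
  fixes f :: "real \<Rightarrow> real^2"
  assumes "f absolutely_integrable_on {0..L}"
  shows "locally_integrable L f"
  unfolding locally_integrable_def
proof (intro allI impI)
  fix K assume K: "compact K \<and> K \<subseteq> {0<..<L}"
  then have "K \<in> sets lebesgue" by (simp add: compact_imp_closed)
  moreover have "f absolutely_integrable_on K"
    by (rule set_integrable_subset[OF assms]) (use K \<open>K \<in> sets lebesgue\<close> in auto)
  ultimately show "integrable (lebesgue_on K) f" by (simp add: integrable_lebesgue_on_iff)
qed

lemma integrable_test_function:
  assumes "test_function L \<phi>" "L > 0" "locally_integrable L f"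
  shows "integrable (lebesgue_on {0<..<L}) (\<lambda>x. \<phi> x *\<^sub>R f x)"
    and "integrable (lebesgue_on {0<..<L}) (\<lambda>x. deriv \<phi> x *\<^sub>R f x)"
proof -
  from test_functionE[OF assms(1,2)] obtain a b where ab: "0 < a" "a < b" "b < L"
    "\<And>x. x \<notin> {a..b} \<Longrightarrow> \<phi> x = 0"
    "\<And>x. x \<notin> {a..b} \<Longrightarrow> deriv \<phi> x = 0" "continuous_on UNIV \<phi>" "continuous_on UNIV (deriv \<phi>)" by metis
  show "integrable (lebesgue_on {0<..<L}) (\<lambda>x. \<phi> x *\<^sub>R f x)"
       "integrable (lebesgue_on {0<..<L}) (\<lambda>x. deriv \<phi> x *\<^sub>R f x)"
    by (rule lebesgue_integral_on_support(1)[OF ab(1,3)],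
        use ab in simp, rule absolutely_integrable_continuous_scaleR,
        use ab(6,7) continuous_on_subset in blast,
        rule locally_integrable_Icc[OF assms(3) ab(1,3)])+
qed

text \<open>Lebesgue differentiation: at almost every point \<open>w\<close> is the limit of its
  averages over \<open>{x..x + h}\<close>, which are all 0. As \<open>w\<close> is only locally
  integrable, the differentiation theorem is applied to its truncations to the compact intervals
  \<open>K n\<close>, which exhaust \<open>{0<..<L}\<close>.\<close>

lemma AE_zero_if_interval_integrals_zero:
  assumes w: "locally_integrable L w"
    and z: "\<And>a b. 0 < a \<Longrightarrow> a < b \<Longrightarrow> b < L \<Longrightarrow> integral {a..b} w = 0"
  shows "AE x in lebesgue_on {0<..<L}. w x = 0"
proof -
  define K where "K n = {1 / real (Suc n)..L - 1 / real (Suc n)}" for n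
  define g where "g n = (\<lambda>x. if x \<in> K n then w x else 0)" for n
  have "\<exists>N. negligible N \<and> (\<forall>x. x \<in> interior (K n) - N \<longrightarrow> w x = 0)" for n
  proof -
    have "w absolutely_integrable_on K n"
      unfolding K_def by (rule locally_integrable_Icc[OF w]) auto
    then have "w integrable_on K n" by (auto simp: absolutely_integrable_on_def)
    then have "g n integrable_on UNIV" by (simp add: g_def integrable_restrict_UNIV)
    then have "g n integrable_on cbox a b" for a b using integrable_on_subcbox[of "g n" UNIV] by auto
    from integrable_ccontinuous_explicit[OF this] obtain N where N: "negligible N"
      "\<And>x e. \<lbrakk>x \<notin> N; 0 < e\<rbrakk> \<Longrightarrow> \<exists>d>0. \<forall>h. 0 < h \<and> h < d \<longrightarrow>
          norm (integral (cbox x (x + h *\<^sub>R One)) (g n) /\<^sub>R h ^ DIM(real) - g n x) < e" by metis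
    have "w x = 0" if x: "x \<in> interior (K n) - N" for x
    proof -
      have x': "1 / real (Suc n) < x" "x < L - 1 / real (Suc n)" using x by (auto simp: K_def interior_atLeastAtMost_real)
      have gw: "g n x = w x" using x' by (auto simp: g_def K_def)
      have "norm (w x) \<le> 0 + e" if "e > 0" for e
      proof -
        from N(2)[of x e] x that obtain d where d: "d > 0"
          "\<And>h. 0 < h \<Longrightarrow> h < d \<Longrightarrow> norm (integral {x..x + h} (g n) /\<^sub>R h - w x) < e"
          using gw by auto
        have "0 < min d (L - 1 / real (Suc n) - x)" using d(1) x' by simp
        then obtain h where "0 < h" "h < min d (L - 1 / real (Suc n) - x)" using dense by blast
        then have h: "0 < h" "h < d" "x + h < L - 1 / real (Suc n)" by simp_all
        have "integral {x..x + h} (g n) = integral {x..x+h} w"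
          by (rule Henstock_Kurzweil_Integration.integral_cong) (use x' h in \<open>auto simp: g_def K_def\<close>)
        also have "\<dots> = 0"
        proof (rule z)
          have "0 < 1 / real (Suc n)" by simp
          then show "0 < x" "x + h < L" using x' h by linarith+
        qed (use h in auto)
        finally show ?thesis using d(2)[OF h(1,2)] by simp
      qed
      then have "norm (w x) \<le> 0" by (rule field_le_epsilon)
      then show ?thesis by simp
    qed
    then show ?thesis using N(1) by blast
  qed
  then obtain N where N: "\<And>n. negligible (N n)" "\<And>n x. x \<in> interior (K n) - N n \<Longrightarrow> w x = 0" by metis
  have neg: "negligible (\<Union>n. N n)" using N(1) by (intro negligible_Union_nat)
  have zero: "w x = 0" if x: "x \<in> {0<..<L}" "x \<notin> (\<Union>n. N n)" for x
  proof -
    obtain n where n: "inverse (real (Suc n)) < min x (L - x)"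
      using reals_Archimedean[of "min x (L - x)"] x by auto
    then have "x \<in> interior (K n)" by (auto simp: K_def interior_atLeastAtMost_real inverse_eq_divide)
    then show ?thesis using N(2) x by blast
  qed
  have "AE x in lebesgue. x \<notin> (\<Union>n. N n)"
    using neg by (intro AE_not_in) (simp add: negligible_iff_null_sets)
  then have "AE x in lebesgue. x \<in> {0<..<L} \<longrightarrow> w x = 0"
    by eventually_elim (use zero in blast)
  then show ?thesis by (simp add: AE_restrict_space_iff)
qed

text \<open>For \<open>a < b\<close> a C^1 function that is positive exactly on
  \<open>{a<..<b}\<close>: squares of positive parts are C^1, and the denominator keeps the values
  in [0,1].\<close>

definition bump :: "real \<Rightarrow> real \<Rightarrow> real \<Rightarrow> real" where
  "bump a b x = (max 0 (x - a))\<^sup>2 * (max 0 (b - x))\<^sup>2 / (b - a) ^ 4"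

lemma max0_sq_has_derivative:
  "((\<lambda>x. (max 0 x)\<^sup>2) has_real_derivative 2 * max 0 x) (at (x::real))"
proof -
  consider "x < 0" | "x = 0" | "x > 0" by linarith
  then show ?thesis
  proof cases
    case 1
    have "((\<lambda>x. 0) has_real_derivative 0) (at x)" by simp
    then have "((\<lambda>x. (max 0 x)\<^sup>2) has_real_derivative 0) (at x)"
      by (rule has_field_derivative_transform_within_open[of _ _ _ "{..<0}"]) (use 1 in auto)
    then show ?thesis using 1 by simp
  next
    case 2
    have "((\<lambda>h::real. (max 0 h)\<^sup>2 / h) \<longlongrightarrow> 0) (at 0)"
    proof (rule tendsto_rabs_zero_cancel, rule tendsto_sandwich)
      show "\<forall>\<^sub>F h in at (0::real). 0 \<le> \<bar>(max 0 h)\<^sup>2 / h\<bar>" by simp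
      show "\<forall>\<^sub>F h in at (0::real). \<bar>(max 0 h)\<^sup>2 / h\<bar> \<le> \<bar>h\<bar>"
        by (intro always_eventually) (auto simp: max_def power2_eq_square)
      show "((\<lambda>h::real. \<bar>h\<bar>) \<longlongrightarrow> 0) (at 0)" by (intro tendsto_rabs_zero tendsto_ident_at)
    qed auto
    then show ?thesis using 2 by (simp add: DERIV_def)
  next
    case 3
    have "((\<lambda>x. x\<^sup>2) has_real_derivative 2 * x) (at x)" by (auto intro!: derivative_eq_intros)
    then have "((\<lambda>x. (max 0 x)\<^sup>2) has_real_derivative 2 * x) (at x)"
      by (rule has_field_derivative_transform_within_open[of _ _ _ "{0<..}"]) (use 3 in auto)
    then show ?thesis using 3 by simp
  qed
qed

lemma bump_C1:
  "\<exists>D. (\<forall>x. (bump a b has_real_derivative D x) (at x)) \<and> continuous_on UNIV D"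
proof -
  have 1: "((\<lambda>x. (max 0 (x - a))\<^sup>2) has_real_derivative 2 * max 0 (x - a)) (at x)" for x
  proof -
    have "((\<lambda>x. x - a) has_real_derivative 1) (at x)" by (auto intro!: derivative_eq_intros)
    from DERIV_chain2[where f = "\<lambda>x. (max 0 x)\<^sup>2", OF max0_sq_has_derivative this] show ?thesis by simp
  qed
  have 2: "((\<lambda>x. (max 0 (b - x))\<^sup>2) has_real_derivative - (2 * max 0 (b - x))) (at x)" for x
  proof -
    have "((\<lambda>x. b - x) has_real_derivative -1) (at x)" by (auto intro!: derivative_eq_intros)
    from DERIV_chain2[where f = "\<lambda>x. (max 0 x)\<^sup>2", OF max0_sq_has_derivative this] show ?thesis by simp
  qed
  let ?D = "\<lambda>x. (2 * max 0 (x - a) * (max 0 (b - x))\<^sup>2 + - (2 * max 0 (b - x)) * (max 0 (x - a))\<^sup>2) / (b - a)^4"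
  have "(bump a b has_real_derivative ?D x) (at x)" for x
    unfolding bump_def by (rule DERIV_cdivide[OF DERIV_mult[OF 1 2]])
  moreover have "continuous_on UNIV ?D" unfolding divide_inverse by (intro continuous_intros)
  ultimately show ?thesis by (intro exI[of _ ?D] conjI allI)
qed

lemma bump_zero: "x \<notin> {a<..<b} \<Longrightarrow> bump a b x = 0"
  by (cases "x \<le> a") (auto simp: bump_def)

lemma bump_pos: "x \<in> {a<..<b} \<Longrightarrow> 0 < bump a b x"
  by (simp add: bump_def)

lemma bump_le_1: "a < b \<Longrightarrow> 0 \<le> bump a b x \<and> bump a b x \<le> 1"
proof (cases "x \<in> {a<..<b}")
  case True
  assume "a < b"
  have "(x - a)\<^sup>2 \<le> (b - a)\<^sup>2" "(b - x)\<^sup>2 \<le> (b - a)\<^sup>2" using True by (auto intro!: power_mono)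
  then have "(x - a)\<^sup>2 * (b - x)\<^sup>2 \<le> (b - a)\<^sup>2 * (b - a)\<^sup>2" by (intro mult_mono) auto
  then have "(x - a)\<^sup>2 * (b - x)\<^sup>2 / (b - a)^4 \<le> 1" using \<open>a < b\<close>
    by (simp add: divide_le_eq_1 power4_eq_xxxx power2_eq_square mult.assoc)
  then show ?thesis using True by (auto simp: bump_def max_def)
qed (simp add: bump_zero)

text \<open>As \<open>n\<close> grows these functions increase to the indicator of
  \<open>{a<..<b}\<close>, because \<open>0 < bump a b x \<le> 1\<close> inside and
  \<open>bump a b x = 0\<close> outside.\<close>

lemma bump_power_test_function:
  assumes "0 < a" "a < b" "b < L"
  shows "test_function L (\<lambda>x. 1 - (1 - bump a b x) ^ n)"
proof -
  obtain D where D: "\<And>x. (bump a b has_real_derivative D x) (at x)" "continuous_on UNIV D"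
    using bump_C1 by blast
  have c: "continuous_on UNIV (bump a b)"
    using D(1) by (meson DERIV_isCont continuous_at_imp_continuous_on)
  show ?thesis
  proof (rule test_functionI[where D = "\<lambda>x. real n * (1 - bump a b x) ^ (n - 1) * D x" and a = a and b = b])
    show "((\<lambda>x. 1 - (1 - bump a b x) ^ n) has_real_derivative real n * (1 - bump a b x) ^ (n - 1) * D x) (at x)" for x
      by (rule derivative_eq_intros D refl | simp add: algebra_simps)+
    show "continuous_on UNIV (\<lambda>x. real n * (1 - bump a b x) ^ (n - 1) * D x)"
      by (intro continuous_intros c D)
  qed (use assms bump_zero in auto)
qed

text \<open>The fundamental lemma of the calculus of variations. Test functions increasing to the
  indicator of \<open>{a<..<b}\<close>, together with dominated convergence with majorant
  \<open>norm (w x)\<close>, reduce it to integrals over intervals.\<close>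

lemma AE_zero_if_test_integrals_zero:
  assumes w: "locally_integrable L w"
    and z: "\<And>\<phi>. test_function L \<phi> \<Longrightarrow> (LINT x|lebesgue_on {0<..<L}. \<phi> x *\<^sub>R w x) = 0"
  shows "AE x in lebesgue_on {0<..<L}. w x = 0"
proof (rule AE_zero_if_interval_integrals_zero[OF w])
  fix a b :: real assume ab: "0 < a" "a < b" "b < L"
  define \<phi> where "\<phi> n = (\<lambda>x. 1 - (1 - bump a b x) ^ n)" for n
  have t: "test_function L (\<phi> n)" for n unfolding \<phi>_def by (rule bump_power_test_function[OF ab])
  have L: "L > 0" using ab by simp
  have ai: "w absolutely_integrable_on {a..b}" by (rule locally_integrable_Icc[OF w ab(1,3)])
  have c: "continuous_on {a..b} (\<phi> n)" for n
    using test_functionE[OF t L] continuous_on_subset by (metis subset_UNIV)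
  have aip: "(\<lambda>x. \<phi> n x *\<^sub>R w x) absolutely_integrable_on {a..b}" for n
    by (rule absolutely_integrable_continuous_scaleR[OF c ai])
  have "integral {a..b} (\<lambda>x. \<phi> n x *\<^sub>R w x) = 0" for n
    using lebesgue_integral_on_support(2)[OF ab(1,3) _ aip[of n]] z[OF t[of n]]
    by (fastforce simp: \<phi>_def bump_zero)
  then have i0: "integral {a<..<b} (\<lambda>x. \<phi> n x *\<^sub>R w x) = 0" for n
    by (simp add: integral_open_interval_real)
  have "(\<lambda>n. integral {a<..<b} (\<lambda>x. \<phi> n x *\<^sub>R w x)) \<longlonglongrightarrow> integral {a<..<b} w"
  proof (rule dominated_convergence(2)[where h = "\<lambda>x. norm (w x)"])
    show "(\<lambda>x. \<phi> n x *\<^sub>R w x) integrable_on {a<..<b}" for n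
      using aip by (simp add: absolutely_integrable_on_def integrable_on_Icc_iff_Ioo[symmetric])
    show "(\<lambda>x. norm (w x)) integrable_on {a<..<b}"
      using ai by (simp add: absolutely_integrable_on_def integrable_on_Icc_iff_Ioo[symmetric])
    fix x assume x: "x \<in> {a<..<b}"
    have b: "0 \<le> 1 - bump a b x" "1 - bump a b x < 1" using bump_pos[OF x] bump_le_1[OF ab(2), of x] by auto
    show "norm (\<phi> n x *\<^sub>R w x) \<le> norm (w x)" for n
    proof -
      have "0 \<le> (1 - bump a b x) ^ n" "(1 - bump a b x) ^ n \<le> 1" using b by (auto intro: power_le_one)
      then have "\<bar>\<phi> n x\<bar> \<le> 1" by (simp add: \<phi>_def)
      then show ?thesis using mult_right_mono[of "\<bar>\<phi> n x\<bar>" 1 "norm (w x)"] by simp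
    qed
    have "(\<lambda>n. \<phi> n x *\<^sub>R w x) \<longlonglongrightarrow> (1 - 0) *\<^sub>R w x"
      unfolding \<phi>_def using b by (intro tendsto_intros LIMSEQ_realpow_zero) auto
    then show "(\<lambda>n. \<phi> n x *\<^sub>R w x) \<longlonglongrightarrow> w x" by simp
  qed
  then have "integral {a<..<b} w = 0" using i0 LIMSEQ_unique[OF tendsto_const] by fastforce
  then show "integral {a..b} w = 0" by (simp add: integral_open_interval_real)
qed

section \<open>Uniqueness of weak derivatives and changes on null sets\<close>

lemma has_weak_deriv_diff:
  assumes "has_weak_deriv L f g" "has_weak_deriv L f' g'" "L > 0"
  shows "has_weak_deriv L (\<lambda>x. f x - f' x) (\<lambda>x. g x - g' x)"
proof -
  have li: "locally_integrable L f" "locally_integrable L g" "locally_integrable L f'" "locally_integrable L g'"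
    using assms by (auto simp: has_weak_deriv_def)
  have "(LINT x|lebesgue_on {0<..<L}. deriv \<phi> x *\<^sub>R (f x - f' x)) =
        - (LINT x|lebesgue_on {0<..<L}. \<phi> x *\<^sub>R (g x - g' x))" if t: "test_function L \<phi>" for \<phi>
    using integrable_test_function[OF t assms(3)] li assms t
    by (simp add: scaleR_diff_right has_weak_deriv_def)
  moreover have "locally_integrable L (\<lambda>x. f x - f' x)" "locally_integrable L (\<lambda>x. g x - g' x)"
    using li by (auto simp: locally_integrable_def)
  ultimately show ?thesis by (simp add: has_weak_deriv_def)
qed

text \<open>The difference of two weak derivatives of \<open>f\<close> is a weak derivative of 0,
  hence orthogonal to all test functions. This pins down the arbitrary choice in
  \<open>weak_deriv\<close> almost everywhere.\<close>

lemma weak_deriv_unique: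
  assumes "has_weak_deriv L f g" "has_weak_deriv L f g'" "L > 0"
  shows "AE x in lebesgue_on {0<..<L}. g x = g' x"
proof -
  have d: "has_weak_deriv L (\<lambda>x. f x - f x) (\<lambda>x. g x - g' x)"
    by (rule has_weak_deriv_diff[OF assms])
  have "AE x in lebesgue_on {0<..<L}. g x - g' x = 0"
  proof (rule AE_zero_if_test_integrals_zero)
    show "locally_integrable L (\<lambda>x. g x - g' x)" using d by (simp add: has_weak_deriv_def)
    show "(LINT x|lebesgue_on {0<..<L}. \<phi> x *\<^sub>R (g x - g' x)) = 0" if "test_function L \<phi>" for \<phi>
      using d that by (simp add: has_weak_deriv_def)
  qed
  then show ?thesis by simp
qed

lemma AE_lebesgue_on_subset:
  assumes "AE x in lebesgue_on S. P x" "T \<subseteq> S" "S \<in> sets lebesgue" "T \<in> sets lebesgue"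
  shows "AE x in lebesgue_on T. P x"
proof -
  have "AE x in lebesgue. x \<in> S \<longrightarrow> P x" using assms(1,3) by (simp add: AE_restrict_space_iff)
  then have "AE x in lebesgue. x \<in> T \<longrightarrow> P x" by (rule eventually_mono) (use assms(2) in blast)
  then show ?thesis using assms(4) by (simp add: AE_restrict_space_iff)
qed

lemma borel_measurable_lebesgue_on_AE:
  fixes f g :: "real \<Rightarrow> 'b::euclidean_space"
  assumes "f \<in> borel_measurable (lebesgue_on S)" "AE x in lebesgue_on S. f x = g x" "S \<in> sets lebesgue"
  shows "g \<in> borel_measurable (lebesgue_on S)"
proof -
  have "(\<lambda>x. if x \<in> S then f x else 0) \<in> borel_measurable lebesgue"
    using assms by (simp add: borel_measurable_if)
  moreover have "AE x in lebesgue. (if x \<in> S then f x else 0) = (if x \<in> S then g x else 0)"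
    using assms(2,3) by (auto simp: AE_restrict_space_iff elim!: eventually_mono)
  ultimately have "(\<lambda>x. if x \<in> S then g x else 0) \<in> borel_measurable lebesgue"
    by (rule borel_measurable_AE)
  then show ?thesis using assms(3) by (simp add: borel_measurable_if)
qed

lemma lebesgue_on_integral_cong_AE:
  fixes f g :: "real \<Rightarrow> 'b::euclidean_space"
  assumes "AE x in lebesgue_on S. f x = g x" "S \<in> sets lebesgue"
  shows "integrable (lebesgue_on S) f \<longleftrightarrow> integrable (lebesgue_on S) g"
    and "integral\<^sup>L (lebesgue_on S) f = integral\<^sup>L (lebesgue_on S) g"
proof -
  have s: "AE x in lebesgue_on S. g x = f x" using assms(1) by (simp add: eq_commute)
  show *: "integrable (lebesgue_on S) f \<longleftrightarrow> integrable (lebesgue_on S) g"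
    using borel_measurable_lebesgue_on_AE[OF _ assms] borel_measurable_lebesgue_on_AE[OF _ s assms(2)]
      integrable_cong_AE_imp[of "lebesgue_on S" f g] integrable_cong_AE_imp[of "lebesgue_on S" g f] assms(1) s
    by (meson borel_measurable_integrable)
  show "integral\<^sup>L (lebesgue_on S) f = integral\<^sup>L (lebesgue_on S) g"
  proof (cases "integrable (lebesgue_on S) f")
    case True then show ?thesis using * assms by (intro integral_cong_AE) auto
  next
    \<comment> \<open>Neither side is integrable here, and both integrals take the default value
      0.\<close>
    case False then show ?thesis using * by (simp add: not_integrable_integral_eq)
  qed
qed

lemma locally_integrable_cong_AE:
  assumes "AE x in lebesgue_on {0<..<L}. f x = g x" "locally_integrable L f"
  shows "locally_integrable L g"
  unfolding locally_integrable_def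
proof (intro allI impI)
  fix K assume K: "compact K \<and> K \<subseteq> {0<..<L}"
  then have s: "K \<in> sets lebesgue" by (simp add: compact_imp_closed)
  have "AE x in lebesgue_on K. f x = g x"
    by (rule AE_lebesgue_on_subset[OF assms(1)]) (use K s in auto)
  then show "integrable (lebesgue_on K) g"
    using lebesgue_on_integral_cong_AE(1)[OF _ s] assms(2) K by (auto simp: locally_integrable_def)
qed

lemma has_weak_deriv_cong_AE:
  assumes "has_weak_deriv L f g"
    and f: "AE x in lebesgue_on {0<..<L}. f x = f' x" and g: "AE x in lebesgue_on {0<..<L}. g x = g' x"
  shows "has_weak_deriv L f' g'"
proof -
  have "(LINT x|lebesgue_on {0<..<L}. h x *\<^sub>R u x) = (LINT x|lebesgue_on {0<..<L}. h x *\<^sub>R u' x)"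
    if "AE x in lebesgue_on {0<..<L}. u x = u' x" for h and u u' :: "real \<Rightarrow> real^2"
    by (rule lebesgue_on_integral_cong_AE(2)) (use that in \<open>auto elim!: eventually_mono\<close>)
  from this[OF f] this[OF g] show ?thesis
    using assms locally_integrable_cong_AE by (auto simp: has_weak_deriv_def)
qed

section \<open>Weak differentiability as absolute continuity\<close>

lemma primitive_on_scaleR:
  fixes F h :: "real \<Rightarrow> real^2"
  assumes "primitive_on a b \<phi> \<psi>" "primitive_on a b F h"
  shows "primitive_on a b (\<lambda>x. \<phi> x *\<^sub>R F x) (\<lambda>x. \<psi> x *\<^sub>R F x + \<phi> x *\<^sub>R h x)"
proof -
  have "primitive_on a b (\<lambda>x. \<chi> i. \<phi> x * F x $ i) (\<lambda>x. \<chi> i. \<psi> x * F x $ i + \<phi> x * h x $ i)"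
    by (intro primitive_on_vec_lambda primitive_on_mult primitive_on_nth assms)
  then show ?thesis by (rule primitive_on_cong) (auto simp: vec_eq_iff)
qed

text \<open>Integration by parts against \<open>\<phi>\<close>: the boundary terms vanish because
  the support of a test function avoids 0 and \<open>L\<close>.\<close>

lemma primitive_on_has_weak_deriv:
  assumes F: "primitive_on 0 L F h" and L: "L > 0"
  shows "has_weak_deriv L F h"
proof -
  have c: "continuous_on {0..L} F" by (rule primitive_on_continuous[OF F])
  have h: "h absolutely_integrable_on {0..L}" by (rule primitive_on_integrable[OF F])
  have "(LINT x|lebesgue_on {0<..<L}. deriv \<phi> x *\<^sub>R F x) = - (LINT x|lebesgue_on {0<..<L}. \<phi> x *\<^sub>R h x)"
    if t: "test_function L \<phi>" for \<phi>
  proof -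
    from test_functionE[OF t L] obtain a b where ab: "0 < a" "a < b" "b < L"
      "\<And>x. x \<notin> {a..b} \<Longrightarrow> \<phi> x = 0" "continuous_on UNIV \<phi>" "continuous_on UNIV (deriv \<phi>)"
      "\<And>x. (\<phi> has_real_derivative deriv \<phi> x) (at x)" by metis
    have c\<phi>: "continuous_on {0..L} \<phi>" "continuous_on {0..L} (deriv \<phi>)"
      using ab(5,6) continuous_on_subset by blast+
    have p: "primitive_on 0 L \<phi> (deriv \<phi>)"
      by (rule primitive_on_has_vector_derivative[of "{}"])
         (use c\<phi> ab(7) in \<open>auto simp: has_real_derivative_iff_has_vector_derivative\<close>)
    have i1: "(\<lambda>x. deriv \<phi> x *\<^sub>R F x) absolutely_integrable_on {0..L}"
      by (intro absolutely_integrable_continuous_scaleR absolutely_integrable_continuous_real c c\<phi>)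
    have i2: "(\<lambda>x. \<phi> x *\<^sub>R h x) absolutely_integrable_on {0..L}"
      by (rule absolutely_integrable_continuous_scaleR[OF c\<phi>(1) h])
    have "\<phi> 0 = 0" "\<phi> L = 0" using ab by auto
    then have "0 = integral {0..L} (\<lambda>x. deriv \<phi> x *\<^sub>R F x + \<phi> x *\<^sub>R h x)"
      using primitive_on_diff[OF primitive_on_scaleR[OF p F], of 0 L] L by simp
    also have "\<dots> = integral {0..L} (\<lambda>x. deriv \<phi> x *\<^sub>R F x) + integral {0..L} (\<lambda>x. \<phi> x *\<^sub>R h x)"
      using i1 i2 by (intro Henstock_Kurzweil_Integration.integral_add) (auto simp: absolutely_integrable_on_def)
    finally show ?thesis
      using lebesgue_integral_Ioo_eq_Icc(2)[OF i1] lebesgue_integral_Ioo_eq_Icc(2)[OF i2]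
      by (simp add: eq_neg_iff_add_eq_0)
  qed
  then show ?thesis
    using locally_integrableI[OF absolutely_integrable_continuous_real[OF c]] locally_integrableI[OF h]
    by (simp add: has_weak_deriv_def)
qed

text \<open>The zero mean makes the primitive \<open>integral {0..x} \<psi>\<close> vanish again to
  the right of the support, so it is itself compactly supported in \<open>{0<..<L}\<close>.\<close>

lemma test_function_antiderivative:
  assumes t: "test_function L \<psi>" and L: "L > 0" and z: "(LINT x|lebesgue_on {0<..<L}. \<psi> x) = 0"
  obtains \<phi> where "test_function L \<phi>" "deriv \<phi> = \<psi>"
proof -
  from test_functionE[OF t L] obtain a b where ab: "0 < a" "a < b" "b < L"
    "\<And>x. x \<notin> {a..b} \<Longrightarrow> \<psi> x = 0" "continuous_on UNIV \<psi>" by metis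
  define \<phi> where "\<phi> x = integral {0..x} \<psi>" for x
  have cs: "continuous_on S \<psi>" for S using ab(5) continuous_on_subset by blast
  have zero: "\<phi> x = 0" if "x < a" for x
    using ab that Henstock_Kurzweil_Integration.integral_cong[of "{0..x}" \<psi> "\<lambda>_. 0"] by (simp add: \<phi>_def)
  have d: "(\<phi> has_real_derivative \<psi> x) (at x)" for x
  \<comment> \<open>For \<open>x \<le> 0\<close> the interval \<open>{0..x}\<close> is degenerate
    and the fundamental theorem gives no two-sided derivative; this is covered by
    \<open>\<phi>\<close> being constantly 0 to the left of \<open>a\<close>.\<close>
  proof (cases "x < a")
    case True
    have "((\<lambda>x. 0) has_real_derivative 0) (at x)" by simp
    then have "(\<phi> has_real_derivative 0) (at x)"
      by (rule has_field_derivative_transform_within_open[of _ _ _ "{..<a}"]) (use True zero in auto)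
    then show ?thesis using True ab by simp
  next
    case False
    then have x: "x \<in> {0<..<x+1}" using ab by auto
    have "(\<phi> has_real_derivative \<psi> x) (at x within {0..x+1})"
      unfolding \<phi>_def by (rule integral_has_real_derivative[OF cs]) (use x in auto)
    then show ?thesis using x by (simp add: at_within_Icc_at)
  qed
  have "\<psi> absolutely_integrable_on {a..b}" by (rule absolutely_integrable_continuous_real[OF cs])
  then have z': "integral {a..b} \<psi> = 0"
    using lebesgue_integral_on_support(2)[OF ab(1,3,4)] z by simp
  have zero': "\<phi> x = 0" if "x > b" for x
  proof -
    have "integral {0..x} \<psi> = integral {a..b} \<psi>"
    proof (rule integral_spike_set)
      have "{y \<in> {0..x} - {a..b}. \<psi> y \<noteq> 0} = {}" using ab(4) by auto
      then show "negligible {y \<in> {0..x} - {a..b}. \<psi> y \<noteq> 0}" by (simp only: negligible_empty)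
      have "{y \<in> {a..b} - {0..x}. \<psi> y \<noteq> 0} = {}" using that ab by auto
      then show "negligible {y \<in> {a..b} - {0..x}. \<psi> y \<noteq> 0}" by (simp only: negligible_empty)
    qed
    then show ?thesis by (simp add: \<phi>_def z')
  qed
  have "test_function L \<phi>"
    by (rule test_functionI[OF d ab(5) ab(1,3)]) (use zero zero' in force)
  moreover have "deriv \<phi> = \<psi>" using d by (intro ext DERIV_imp_deriv)
  ultimately show thesis by (rule that)
qed

lemma test_function_diff_scale:
  assumes "test_function L \<phi>" "test_function L \<psi>" "L > 0"
  shows "test_function L (\<lambda>x. \<phi> x - c * \<psi> x)"
proof -
  from test_functionE[OF assms(1,3)] obtain a b where ab: "0 < a" "a < b" "b < L"
      "\<And>x. x \<notin> {a..b} \<Longrightarrow> \<phi> x = 0" "continuous_on UNIV \<phi>" "continuous_on UNIV (deriv \<phi>)"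
      "\<And>x. (\<phi> has_real_derivative deriv \<phi> x) (at x)" by metis
  from test_functionE[OF assms(2,3)] obtain a' b' where ab': "0 < a'" "a' < b'" "b' < L"
      "\<And>x. x \<notin> {a'..b'} \<Longrightarrow> \<psi> x = 0" "continuous_on UNIV \<psi>" "continuous_on UNIV (deriv \<psi>)"
      "\<And>x. (\<psi> has_real_derivative deriv \<psi> x) (at x)" by metis
  show ?thesis
  proof (rule test_functionI[where a = "min a a'" and b = "max b b'"])
    show "((\<lambda>x. \<phi> x - c * \<psi> x) has_real_derivative deriv \<phi> x - c * deriv \<psi> x) (at x)" for x
      by (rule DERIV_diff[OF ab(7) DERIV_cmult[OF ab'(7)]])
    show "continuous_on UNIV (\<lambda>x. deriv \<phi> x - c * deriv \<psi> x)" by (intro continuous_intros ab(6) ab'(6))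
    fix x assume "x \<notin> {min a a'..max b b'}"
    then have "x \<notin> {a..b}" "x \<notin> {a'..b'}" by auto
    then show "\<phi> x - c * \<psi> x = 0" using ab(4)[of x] ab'(4)[of x] by simp
  qed (use ab(1,3) ab'(1,3) in auto)
qed

lemma integrable_test_function_real:
  assumes "test_function L \<phi>" "L > 0"
  shows "integrable (lebesgue_on {0<..<L}) \<phi>"
proof -
  have "continuous_on {0..L} \<phi>" using test_functionE[OF assms] continuous_on_subset by (metis subset_UNIV)
  then show ?thesis by (simp add: lebesgue_integral_Ioo_eq_Icc absolutely_integrable_continuous_real)
qed

text \<open>Du Bois-Reymond: every test function is a multiple of the fixed \<open>\<psi>0\<close>
  plus one of zero mean, and the latter is the derivative of a test function, hence orthogonal to
  \<open>w\<close>. So the pairing with \<open>w\<close> sees only the mean of a test function, as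
  the pairing with a constant does.\<close>

lemma has_weak_deriv_zero_const:
  assumes w: "has_weak_deriv L w (\<lambda>x. 0)" and L: "L > 0"
  shows "\<exists>c. AE x in lebesgue_on {0<..<L}. w x = c"
proof -
  let ?M = "lebesgue_on {0<..<L}"
  have li: "locally_integrable L w" using w by (simp add: has_weak_deriv_def)
  \<comment> \<open>Exponent 1 gives the bump itself, in the form to which
    \<open>bump_power_test_function\<close> applies.\<close>
  define \<psi>0 where "\<psi>0 x = 1 - (1 - bump (L/3) (L/2) x) ^ 1" for x
  have t0: "test_function L \<psi>0"
    unfolding \<psi>0_def by (rule bump_power_test_function) (use L in auto)
  define m0 where "m0 = (LINT x|?M. \<psi>0 x)"
  have "m0 \<noteq> 0"
  proof
    assume "m0 = 0"
    have "AE x in ?M. \<psi>0 x = 0"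
      using \<open>m0 = 0\<close> bump_le_1[of "L/3" "L/2"] L
      by (subst integral_nonneg_eq_0_iff_AE[symmetric])
         (auto simp: m0_def[symmetric] integrable_test_function_real[OF t0 L], simp add: \<psi>0_def)
    then have "AE x in lebesgue_on {L/3<..<L/2}. \<psi>0 x = 0"
      by (rule AE_lebesgue_on_subset) (use L in auto)
    then have "AE x in lebesgue. x \<notin> {L/3<..<L/2}"
      using bump_pos[of _ "L/3" "L/2"]
      by (auto simp: AE_restrict_space_iff \<psi>0_def elim!: eventually_mono) force
    then have "negligible {L/3<..<L/2}"
      by (auto simp: negligible_iff_null_sets intro!: AE_iff_null_sets[THEN iffD2])
    then show False using L open_not_negligible[of "{L/3<..<L/2}"] by auto
  qed
  \<comment> \<open>The only possible value of the constant: pairing it with \<open>\<psi>0\<close>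
    gives \<open>m0\<close> times itself.\<close>
  define c where "c = (1 / m0) *\<^sub>R (LINT x|?M. \<psi>0 x *\<^sub>R w x)"
  have "AE x in ?M. w x - c = 0"
  proof (rule AE_zero_if_test_integrals_zero)
    have lc: "locally_integrable L (\<lambda>x. c)"
      by (rule locally_integrableI) (simp add: absolutely_integrable_on_const)
    then show "locally_integrable L (\<lambda>x. w x - c)" using li by (auto simp: locally_integrable_def)
    fix \<psi> assume t: "test_function L \<psi>"
    define m where "m = (LINT x|?M. \<psi> x) / m0"
    note i = integrable_test_function_real[OF t L] integrable_test_function_real[OF t0 L]
    have "(LINT x|?M. \<psi> x - m * \<psi>0 x) = 0"
      using i \<open>m0 \<noteq> 0\<close> by (simp add: m_def m0_def)
    from test_function_antiderivative[OF test_function_diff_scale[OF t t0 L] L this]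
    obtain \<phi> where \<phi>: "test_function L \<phi>" "deriv \<phi> = (\<lambda>x. \<psi> x - m * \<psi>0 x)" by blast
    have iw: "integrable ?M (\<lambda>x. \<psi> x *\<^sub>R w x)" "integrable ?M (\<lambda>x. \<psi>0 x *\<^sub>R w x)" "integrable ?M (\<lambda>x. \<psi> x *\<^sub>R c)"
      using integrable_test_function(1) t t0 L li lc by blast+
    have "(LINT x|?M. (\<psi> x - m * \<psi>0 x) *\<^sub>R w x) = 0"
      using w \<phi> by (auto simp: has_weak_deriv_def)
    moreover have "(LINT x|?M. (\<psi> x - m * \<psi>0 x) *\<^sub>R w x) = (LINT x|?M. \<psi> x *\<^sub>R w x) - m *\<^sub>R (LINT x|?M. \<psi>0 x *\<^sub>R w x)"
      using iw by (simp add: scaleR_diff_left scaleR_scaleR[symmetric] del: scaleR_scaleR)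
    moreover have "m *\<^sub>R (LINT x|?M. \<psi>0 x *\<^sub>R w x) = (LINT x|?M. \<psi> x) *\<^sub>R c"
      by (simp add: m_def c_def)
    ultimately show "(LINT x|?M. \<psi> x *\<^sub>R (w x - c)) = 0"
      using iw i by (simp add: scaleR_diff_right)
  qed
  then show ?thesis by auto
qed

text \<open>Subtracting the indefinite integral of \<open>h\<close> leaves a function with weak
  derivative 0, which is constant almost everywhere.\<close>

lemma has_weak_deriv_primitive:
  assumes f: "has_weak_deriv L f h" and h: "h absolutely_integrable_on {0..L}" and L: "L > 0"
  obtains F where "primitive_on 0 L F h" "AE x in lebesgue_on {0<..<L}. f x = F x"
proof -
  have "primitive_on 0 L (\<lambda>x. integral {0..x} h) h"
    using h by (simp add: primitive_on_def)
  from has_weak_deriv_diff[OF f primitive_on_has_weak_deriv[OF this L] L]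
  obtain c where c: "AE x in lebesgue_on {0<..<L}. f x - integral {0..x} h = c"
    using has_weak_deriv_zero_const[OF _ L] by auto
  show thesis
  proof (rule that[of "\<lambda>x. c + integral {0..x} h"])
    show "primitive_on 0 L (\<lambda>x. c + integral {0..x} h) h"
      using h by (simp add: primitive_on_def)
    show "AE x in lebesgue_on {0<..<L}. f x = c + integral {0..x} h"
      using c by eventually_elim (auto simp: algebra_simps)
  qed
qed

section \<open>Arclength parametrized curves and their tangent angle\<close>

lemma weak_deriv_AE:
  assumes "has_weak_deriv L f g" "L > 0"
  shows "AE x in lebesgue_on {0<..<L}. weak_deriv L f x = g x"
proof -
  have "has_weak_deriv L f (weak_deriv L f)"
    unfolding weak_deriv_def using assms(1) by (metis someI_ex)
  then show ?thesis by (rule weak_deriv_unique[OF _ assms])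
qed

text \<open>The inner choice \<open>weak_deriv L f\<close> agrees with \<open>g\<close> only almost
  everywhere, so it must first be shown to have the weak derivative \<open>h\<close> as
  well.\<close>

lemma weak_deriv2_AE:
  assumes "has_weak_deriv L f g" "has_weak_deriv L g h" "L > 0"
  shows "AE x in lebesgue_on {0<..<L}. weak_deriv L (weak_deriv L f) x = h x"
proof (rule weak_deriv_AE[OF _ assms(3)])
  have "AE x in lebesgue_on {0<..<L}. g x = weak_deriv L f x"
    using weak_deriv_AE[OF assms(1,3)] by (simp add: eq_commute)
  then show "has_weak_deriv L (weak_deriv L f) h"
    by (rule has_weak_deriv_cong_AE[OF assms(2)]) simp
qed

lemma continuous_AE_eq_imp_eq:
  fixes f g :: "real \<Rightarrow> 'a::euclidean_space"
  assumes c: "continuous_on {0..L} f" "continuous_on {0..L} g" and L: "L > 0"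
    and ae: "AE x in lebesgue_on {0<..<L}. f x = g x" and x: "x \<in> {0..L}"
  shows "f x = g x"
proof -
  have "continuous_on {0..L} (\<lambda>x. norm (f x - g x))" by (intro continuous_intros c)
  moreover have "integral {0..L} (\<lambda>x. norm (f x - g x)) = 0"
  proof -
    have "(\<lambda>x. norm (f x - g x)) absolutely_integrable_on {0..L}"
      by (intro absolutely_integrable_continuous_real continuous_intros c)
    then have "integral {0..L} (\<lambda>x. norm (f x - g x)) = (LINT x|lebesgue_on {0<..<L}. norm (f x - g x))"
      by (simp add: lebesgue_integral_Ioo_eq_Icc)
    also have "\<dots> = (LINT x|lebesgue_on {0<..<L}. 0)"
      by (rule lebesgue_on_integral_cong_AE(2)) (use ae in \<open>auto elim!: eventually_mono\<close>)
    finally show ?thesis by simp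
  qed
  ultimately have "norm (f x - g x) = 0"
    using integral_eq_0_iff[of 0 L "\<lambda>x. norm (f x - g x)"] x L by auto
  then show ?thesis by simp
qed

lemma AE_Ioo_const_continuous:
  fixes f :: "real \<Rightarrow> real"
  assumes "continuous_on {0..L} f" "L > 0" "AE x in lebesgue_on {0<..<L}. f x = c" "x \<in> {0..L}"
  shows "f x = c"
  using continuous_AE_eq_imp_eq[OF assms(1) continuous_on_const assms(2,3,4)] .

text \<open>Replaces Holder's inequality for bounding L^1 by L^p quantities: the level
  \<open>l\<close> is free, so once \<open>l\<close> is small, a small integral of
  \<open>t powr p\<close> makes the integral of \<open>t\<close> small.\<close>

lemma powr_ge_linear:
  fixes t p l :: real
  assumes "0 \<le> t" "1 \<le> p" "0 < l"
  shows "t \<le> l + l powr (1 - p) * t powr p"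
proof (cases "t \<le> l")
  case True
  then show ?thesis by (simp add: add_increasing2)
next
  case False
  then have "t = t powr (1 - p) * t powr p" using assms by (simp add: powr_add[symmetric])
  also have "\<dots> \<le> l powr (1 - p) * t powr p"
    by (intro mult_right_mono powr_mono2') (use False assms in auto)
  finally show ?thesis using assms by simp
qed

lemma Lp_absolutely_integrable:
  fixes f :: "real \<Rightarrow> real^2"
  assumes "f \<in> Lp p L" "p \<ge> 1"
  shows "f absolutely_integrable_on {0..L}"
proof -
  have "integrable (lebesgue_on {0<..<L}) f"
  proof (rule measurable_bounded_by_integrable_imp_lebesgue_integrable[where g = "\<lambda>x. 1 + 1 powr (1 - p) * norm (f x) powr p"])
    show "integrable (lebesgue_on {0<..<L}) (\<lambda>x. 1 + 1 powr (1 - p) * norm (f x) powr p)"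
      using assms(1) by (auto simp: Lp_def integrable_lebesgue_on_iff absolutely_integrable_on_const)
    show "norm (f x) \<le> 1 + 1 powr (1 - p) * norm (f x) powr p" for x
      by (rule powr_ge_linear) (use assms in auto)
  qed (use assms in \<open>auto simp: Lp_def\<close>)
  then show ?thesis by (simp add: lebesgue_integral_Ioo_eq_Icc)
qed

lemma continuous_on_norm_powr:
  fixes f :: "real \<Rightarrow> 'a::real_normed_vector"
  assumes "continuous_on S f" "p > 0"
  shows "continuous_on S (\<lambda>x. norm (f x) powr p)"
  using assms by (intro continuous_on_powr' continuous_intros) auto

lemma continuous_in_Lp:
  assumes "continuous_on {0..L} f" "p > 0"
  shows "f \<in> Lp p L"
proof -
  have "f absolutely_integrable_on {0..L}" "(\<lambda>x. norm (f x) powr p) absolutely_integrable_on {0..L}"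
    by (intro absolutely_integrable_continuous_real continuous_on_norm_powr assms)+
  then show ?thesis
    by (auto simp: Lp_def lebesgue_integral_Ioo_eq_Icc[symmetric] borel_measurable_integrable)
qed

lemma Lp_diff:
  assumes "f \<in> Lp p L" "g \<in> Lp p L" "p \<ge> 1"
  shows "(\<lambda>x. f x - g x) \<in> Lp p L"
proof -
  have m: "(\<lambda>x. f x - g x) \<in> borel_measurable (lebesgue_on {0<..<L})"
    using assms by (auto simp: Lp_def)
  have bound: "norm (f x - g x) powr p \<le> 2 powr p * (norm (f x) powr p + norm (g x) powr p)" for x
  proof -
    have "norm (f x - g x) \<le> 2 * max (norm (f x)) (norm (g x))"
      using norm_triangle_ineq4[of "f x" "g x"] by linarith
    then have "norm (f x - g x) powr p \<le> (2 * max (norm (f x)) (norm (g x))) powr p"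
      by (intro powr_mono2) (use assms in auto)
    also have "\<dots> = 2 powr p * max (norm (f x)) (norm (g x)) powr p"
      by (rule powr_mult)
    also have "\<dots> \<le> 2 powr p * (norm (f x) powr p + norm (g x) powr p)"
      by (intro mult_left_mono) (auto simp: max_def)
    finally show ?thesis .
  qed
  have "integrable (lebesgue_on {0<..<L}) (\<lambda>x. norm (f x - g x) powr p)"
  proof (rule measurable_bounded_by_integrable_imp_lebesgue_integrable)
    show "integrable (lebesgue_on {0<..<L}) (\<lambda>x. 2 powr p * (norm (f x) powr p + norm (g x) powr p))"
      using assms by (auto simp: Lp_def)
  qed (use m bound in auto)
  with m show ?thesis by (simp add: Lp_def)
qed

section \<open>Plane unit vectors, tangents and the angle\<close>

lemma lagrange_identity_2:
  fixes a b p q :: real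
  shows "(a * q - b * p)\<^sup>2 + (a * p + b * q)\<^sup>2 = (a\<^sup>2 + b\<^sup>2) * (p\<^sup>2 + q\<^sup>2)"
  by (simp add: power2_eq_square algebra_simps)

lemma rotation_identity_2:
  fixes a b p q :: real
  assumes "a\<^sup>2 + b\<^sup>2 = 1"
  shows "a * (a * p + b * q) - b * (a * q - b * p) = p" "b * (a * p + b * q) + a * (a * q - b * p) = q"
proof -
  have "a * (a * p + b * q) - b * (a * q - b * p) = (a\<^sup>2 + b\<^sup>2) * p"
    "b * (a * p + b * q) + a * (a * q - b * p) = (a\<^sup>2 + b\<^sup>2) * q"
    by (simp_all add: power2_eq_square algebra_simps)
  then show "a * (a * p + b * q) - b * (a * q - b * p) = p" "b * (a * p + b * q) + a * (a * q - b * p) = q"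
    using assms by simp_all
qed

text \<open>The classical data of a curve in \<open>W2p_arc\<close>: a tangent of norm 1 at every
  point, not just almost everywhere, and one version \<open>K\<close> of the second derivative.
  Later arguments use these instead of the choice made by \<open>weak_deriv\<close>.\<close>

definition arclength_lift :: "real \<Rightarrow> real \<Rightarrow> (real \<Rightarrow> real^2) \<Rightarrow> (real \<Rightarrow> real^2) \<Rightarrow> (real \<Rightarrow> real^2) \<Rightarrow> bool" where
  "arclength_lift p L \<gamma> T K \<longleftrightarrow> primitive_on 0 L \<gamma> T \<and> primitive_on 0 L T K \<and> K \<in> Lp p L \<and>
     (\<forall>x\<in>{0..L}. norm (T x) = 1)"

text \<open>Weak differentiability is integrated twice: from the second weak derivative to a
  continuous tangent \<open>T\<close>, and from \<open>T\<close> to the curve. Continuous functions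
  that agree almost everywhere agree, which makes the statements about \<open>\<eta>\<close> and
  \<open>norm (T x)\<close> pointwise.\<close>

lemma W2p_arc_lift:
  assumes "\<eta> \<in> W2p_arc p L" "p \<ge> 1" "L > 0"
  obtains T K where "arclength_lift p L \<eta> T K"
proof -
  obtain g h where gh: "g \<in> Lp p L" "h \<in> Lp p L" "has_weak_deriv L \<eta> g" "has_weak_deriv L g h"
    and c: "continuous_on {0..L} \<eta>" and n: "AE s in lebesgue_on {0<..<L}. norm (weak_deriv L \<eta> s) = 1"
    using assms(1) by (auto simp: W2p_arc_def W2p_def)
  obtain T where T: "primitive_on 0 L T h" "AE x in lebesgue_on {0<..<L}. g x = T x"
    by (rule has_weak_deriv_primitive[OF gh(4) Lp_absolutely_integrable[OF gh(2) assms(2)] assms(3)])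
  have cT: "continuous_on {0..L} T" by (rule primitive_on_continuous[OF T(1)])
  have "has_weak_deriv L \<eta> T" by (rule has_weak_deriv_cong_AE[OF gh(3) _ T(2)]) simp
  then obtain F where F: "primitive_on 0 L F T" "AE x in lebesgue_on {0<..<L}. \<eta> x = F x"
    by (rule has_weak_deriv_primitive[OF _ absolutely_integrable_continuous_real[OF cT] assms(3)])
  have e: "\<eta> x = F x" if "x \<in> {0..L}" for x
    by (rule continuous_AE_eq_imp_eq[OF c primitive_on_continuous[OF F(1)] assms(3) F(2) that])
  have "primitive_on 0 L \<eta> T" by (rule primitive_on_cong[OF F(1)]) (use e in auto)
  moreover have "AE x in lebesgue_on {0<..<L}. norm (T x) = 1"
    using n weak_deriv_AE[OF gh(3) assms(3)] T(2) by eventually_elim auto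
  then have "norm (T x) = 1" if "x \<in> {0..L}" for x
    using AE_Ioo_const_continuous[OF _ assms(3) _ that, of "\<lambda>x. norm (T x)" 1] cT continuous_on_norm by blast
  ultimately show thesis using that[of T h] T gh by (auto simp: arclength_lift_def)
qed

lemma arclength_liftD:
  assumes "arclength_lift p L \<eta> T K" "L > 0"
  shows "has_weak_deriv L \<eta> T" "has_weak_deriv L T K"
  using assms primitive_on_has_weak_deriv by (auto simp: arclength_lift_def)

lemma arclength_lift_W2p_arc:
  assumes l: "arclength_lift p L \<eta> T K" and e: "\<eta> \<in> extensional {0..L}" and p: "p \<ge> 1" and L: "L > 0"
  shows "\<eta> \<in> W2p_arc p L"
proof -
  have c: "continuous_on {0..L} \<eta>" "continuous_on {0..L} T"
    using l primitive_on_continuous by (auto simp: arclength_lift_def)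
  then have "\<eta> \<in> Lp p L" "T \<in> Lp p L" using p continuous_in_Lp by auto
  then have "\<eta> \<in> W2p p L"
    using e c l arclength_liftD[OF l L] by (auto simp: W2p_def arclength_lift_def)
  moreover have "AE s in lebesgue_on {0<..<L}. norm (T s) = 1"
    using l by (intro AE_I2) (auto simp: arclength_lift_def)
  then have "AE s in lebesgue_on {0<..<L}. norm (weak_deriv L \<eta> s) = 1"
    using weak_deriv_AE[OF arclength_liftD(1)[OF l L] L] by eventually_elim simp
  ultimately show ?thesis by (simp add: W2p_arc_def)
qed

lemma arclength_lift_energy:
  assumes l: "arclength_lift p L \<eta> T K" and L: "L > 0"
    and k: "AE x in lebesgue_on {0<..<L}. T x $ 1 * K x $ 2 - T x $ 2 * K x $ 1 = k x"
  shows "bending_energy p L \<eta> = (LINT x|lebesgue_on {0<..<L}. \<bar>k x\<bar> powr p)"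
  unfolding bending_energy_def
proof (rule lebesgue_on_integral_cong_AE(2))
  show "AE x in lebesgue_on {0<..<L}. \<bar>signed_curvature L \<eta> x\<bar> powr p = \<bar>k x\<bar> powr p"
    using k weak_deriv_AE[OF arclength_liftD(1)[OF l L] L]
      weak_deriv2_AE[OF arclength_liftD(1)[OF l L] arclength_liftD(2)[OF l L] L]
    by eventually_elim (simp add: signed_curvature_def Let_def)
qed simp

lemma norm_vec2: "norm (v :: real^2) = sqrt ((v $ 1)\<^sup>2 + (v $ 2)\<^sup>2)"
  by (simp add: norm_vec_def L2_set_def sum_2)

definition direction :: "real \<Rightarrow> real^2" where
  "direction t = (\<chi> i. if i = 1 then cos t else sin t)"

lemma direction_nth [simp]: "direction t $ 1 = cos t" "direction t $ 2 = sin t"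
  by (simp_all add: direction_def)

lemma norm_direction [simp]: "norm (direction t) = 1"
  by (simp add: norm_vec2)

lemma primitive_on_direction:
  assumes "primitive_on a b \<theta> k"
  shows "primitive_on a b (\<lambda>x. direction (\<alpha> + \<theta> x)) (\<lambda>x. k x *\<^sub>R (\<chi> i. if i = 1 then - sin (\<alpha> + \<theta> x) else cos (\<alpha> + \<theta> x)))"
proof -
  have c: "primitive_on a b (\<lambda>x. cos (\<alpha> + \<theta> x)) (\<lambda>x. - sin (\<alpha> + \<theta> x) * k x)"
    by (rule primitive_on_chain[OF assms]) (auto intro!: derivative_eq_intros continuous_intros)
  have s: "primitive_on a b (\<lambda>x. sin (\<alpha> + \<theta> x)) (\<lambda>x. cos (\<alpha> + \<theta> x) * k x)"
    by (rule primitive_on_chain[OF assms]) (auto intro!: derivative_eq_intros continuous_intros)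
  have "primitive_on a b (\<lambda>x. \<chi> i::2. (if i = 1 then (\<lambda>x. cos (\<alpha> + \<theta> x)) else (\<lambda>x. sin (\<alpha> + \<theta> x))) x)
     (\<lambda>x. \<chi> i::2. (if i = 1 then (\<lambda>x. - sin (\<alpha> + \<theta> x) * k x) else (\<lambda>x. cos (\<alpha> + \<theta> x) * k x)) x)"
    by (rule primitive_on_vec_lambda) (use c s in auto)
  then show ?thesis
    by (rule primitive_on_cong) (auto simp: direction_def vec_eq_iff)
qed

lemma primitive_on_unique_AE:
  fixes F :: "real \<Rightarrow> real^2"
  assumes "primitive_on 0 L F f" "primitive_on 0 L F g" "L > 0"
  shows "AE x in lebesgue_on {0<..<L}. f x = g x"
  using assms by (intro weak_deriv_unique[of L F] primitive_on_has_weak_deriv)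

text \<open>Since \<open>T\<close> stays close to the unit tangent with angle \<open>\<theta>\<close>, the angle difference is the
  arcsine of the cross product of the two tangents, so no covering argument is needed.\<close>

lemma angle_lift_near:
  assumes T: "primitive_on 0 L T K" "\<And>x. x \<in> {0..L} \<Longrightarrow> norm (T x) = 1" and L: "L > 0"
    and \<theta>: "primitive_on 0 L \<theta> k" and \<delta>: "0 < \<delta>" "\<delta> < pi / 2"
    and near: "\<And>x. x \<in> {0..L} \<Longrightarrow> norm (T x - direction (\<alpha> + \<theta> x)) < sin \<delta>"
  obtains \<phi> \<kappa> where "primitive_on 0 L \<phi> \<kappa>" "\<And>x. x \<in> {0..L} \<Longrightarrow> T x = direction (\<alpha> + \<phi> x)"
    "\<And>x. x \<in> {0..L} \<Longrightarrow> \<bar>\<phi> x - \<theta> x\<bar> < \<delta>"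
    "AE x in lebesgue_on {0<..<L}. T x $ 1 * K x $ 2 - T x $ 2 * K x $ 1 = \<kappa> x"
proof -
  define E where "E x = direction (\<alpha> + \<theta> x)" for x
  define z where "z x = E x $ 1 * T x $ 2 - E x $ 2 * T x $ 1" for x
  obtain E' where E': "primitive_on 0 L E E'"
    unfolding E_def using primitive_on_direction[OF \<theta>] by blast
  define z' where "z' x = (E' x $ 1 * T x $ 2 + E x $ 1 * K x $ 2) - (E' x $ 2 * T x $ 1 + E x $ 2 * K x $ 1)" for x
  have pz: "primitive_on 0 L z z'"
    unfolding z_def z'_def by (intro primitive_on_minus_fun primitive_on_mult primitive_on_nth E' T)
  have zb: "\<bar>z x\<bar> < sin \<delta>" "cos (arcsin (z x)) = E x $ 1 * T x $ 1 + E x $ 2 * T x $ 2" "\<bar>z x\<bar> < 1" if x: "x \<in> {0..L}" for x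
  proof -
    let ?a = "cos (\<alpha> + \<theta> x)" and ?b = "sin (\<alpha> + \<theta> x)"
    have ab: "?a\<^sup>2 + ?b\<^sup>2 = 1" by simp
    have t: "(T x $ 1)\<^sup>2 + (T x $ 2)\<^sup>2 = 1" using T(2)[OF x] by (simp add: norm_vec2)
    have E1: "E x $ 1 = ?a" "E x $ 2 = ?b" by (simp_all add: E_def)
    \<comment> \<open>\<open>z x\<close> and \<open>y\<close> are the sine and cosine of the angle
      from the reference direction to \<open>T x\<close>. Closeness forces \<open>y > 0\<close>, so
      the arcsine recovers this angle.\<close>
    define y where "y = ?a * T x $ 1 + ?b * T x $ 2"
    have zy: "(z x)\<^sup>2 + y\<^sup>2 = 1"
    proof -
      have "(z x)\<^sup>2 + y\<^sup>2 = (?a\<^sup>2 + ?b\<^sup>2) * ((T x $ 1)\<^sup>2 + (T x $ 2)\<^sup>2)"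
        unfolding z_def y_def E1 by (rule lagrange_identity_2)
      then show ?thesis using ab t by simp
    qed
    have n2: "(norm (T x - direction (\<alpha> + \<theta> x)))\<^sup>2 = 2 - 2 * y"
    proof -
      have "(norm (T x - direction (\<alpha> + \<theta> x)))\<^sup>2 = (T x $ 1 - ?a)\<^sup>2 + (T x $ 2 - ?b)\<^sup>2"
        by (simp add: norm_vec2)
      also have "\<dots> = (?a\<^sup>2 + ?b\<^sup>2) + ((T x $ 1)\<^sup>2 + (T x $ 2)\<^sup>2) - 2 * y"
        by (simp add: y_def power2_eq_square algebra_simps)
      finally show ?thesis using ab t by simp
    qed
    have sd: "0 < sin \<delta>" "sin \<delta> < 1"
      using \<delta> sin_gt_zero2 sin_monotone_2pi[of \<delta> "pi/2"] by auto
    have lt: "(norm (T x - direction (\<alpha> + \<theta> x)))\<^sup>2 < (sin \<delta>)\<^sup>2"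
      by (rule power_strict_mono) (use near[OF x] in auto)
    have "(sin \<delta>)\<^sup>2 < 1" using sd by (simp add: power_less_one_iff abs_square_less_1)
    then have y0: "y > 0" using lt n2 by linarith
    have "(z x)\<^sup>2 = 1 - y\<^sup>2" using zy by simp
    \<comment> \<open>This is \<open>(y - 1)\<^sup>2 \<ge> 0\<close>; it bounds the sine by the
      chord \<open>norm (T x - direction (\<alpha> + \<theta> x))\<close>.\<close>
    also have "\<dots> \<le> 2 - 2 * y"
      using zero_le_power2[of "y - 1"] unfolding power2_eq_square by (simp add: algebra_simps)
    finally have "(z x)\<^sup>2 < (sin \<delta>)\<^sup>2" using n2 lt by linarith
    then show zd: "\<bar>z x\<bar> < sin \<delta>" using sd by (metis abs_of_pos abs_less_iff power2_less_imp_less power2_abs less_imp_le)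
    then show z1: "\<bar>z x\<bar> < 1" using sd by linarith
    have "cos (arcsin (z x)) = sqrt (1 - (z x)\<^sup>2)" using z1 by (intro cos_arcsin) auto
    also have "\<dots> = y" using zy y0 by (simp add: real_sqrt_unique)
    finally show "cos (arcsin (z x)) = E x $ 1 * T x $ 1 + E x $ 2 * T x $ 2" by (simp add: y_def E1)
  qed
  define \<phi> where "\<phi> x = \<theta> x + arcsin (z x)" for x
  define \<kappa> where "\<kappa> x = k x + inverse (sqrt (1 - (z x)\<^sup>2)) * z' x" for x
  have p\<phi>: "primitive_on 0 L \<phi> \<kappa>"
    unfolding \<phi>_def \<kappa>_def
  proof (intro primitive_on_add \<theta> primitive_on_chain[OF pz])
    show "(arcsin has_real_derivative inverse (sqrt (1 - y\<^sup>2))) (at y)" if "y \<in> z ` {0..L}" for y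
      using that zb(3) by (intro DERIV_arcsin) (auto simp: abs_less_iff)
    show "continuous_on (z ` {0..L}) (\<lambda>y. inverse (sqrt (1 - y\<^sup>2)))"
    proof (intro continuous_intros ballI)
      fix y assume "y \<in> z ` {0..L}"
      then have "y\<^sup>2 < 1" using zb(3) by (auto simp: abs_square_less_1)
      then show "sqrt (1 - y\<^sup>2) \<noteq> 0" by simp
    qed
  qed
  have TE: "T x = direction (\<alpha> + \<phi> x)" if x: "x \<in> {0..L}" for x
  proof -
    let ?a = "cos (\<alpha> + \<theta> x)" and ?b = "sin (\<alpha> + \<theta> x)"
    have ab: "?a\<^sup>2 + ?b\<^sup>2 = 1" by simp
    have s: "sin (arcsin (z x)) = ?a * T x $ 2 - ?b * T x $ 1" "cos (arcsin (z x)) = ?a * T x $ 1 + ?b * T x $ 2"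
      using zb[OF x] by (auto simp: z_def E_def)
    have "cos (\<alpha> + \<theta> x + arcsin (z x)) = T x $ 1" "sin (\<alpha> + \<theta> x + arcsin (z x)) = T x $ 2"
      unfolding cos_add[of "\<alpha> + \<theta> x"] sin_add[of "\<alpha> + \<theta> x"] s
      using rotation_identity_2[OF ab, of "T x $ 1" "T x $ 2"] by simp_all
    then show ?thesis by (simp add: vec_eq_iff forall_2 \<phi>_def add.assoc)
  qed
  have near\<phi>: "\<bar>\<phi> x - \<theta> x\<bar> < \<delta>" if x: "x \<in> {0..L}" for x
  proof -
    have z: "- sin \<delta> < z x" "z x < sin \<delta>" "\<bar>z x\<bar> < 1" using zb[OF x] by auto
    have "arcsin (z x) < arcsin (sin \<delta>)" by (rule arcsin_less_arcsin) (use z in auto)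
    moreover have "arcsin (- sin \<delta>) < arcsin (z x)" by (rule arcsin_less_arcsin) (use z in auto)
    ultimately show ?thesis using \<delta> by (simp add: \<phi>_def arcsin_sin arcsin_minus abs_less_iff)
  qed
  \<comment> \<open>Differentiating \<open>T\<close> through the lifted angle gives a second version
    of its derivative, equal to \<open>K\<close> almost everywhere; its determinant with
    \<open>T\<close> is \<open>\<kappa>\<close>.\<close>
  have "primitive_on 0 L T (\<lambda>x. \<kappa> x *\<^sub>R (\<chi> i. if i = 1 then - sin (\<alpha> + \<phi> x) else cos (\<alpha> + \<phi> x)))"
    by (rule primitive_on_cong[OF primitive_on_direction[OF p\<phi>]]) (use TE in auto)
  from primitive_on_unique_AE[OF T(1) this L]
  have "AE x in lebesgue_on {0<..<L}. x \<in> {0<..<L} \<longrightarrow> T x $ 1 * K x $ 2 - T x $ 2 * K x $ 1 = \<kappa> x"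
  proof eventually_elim
    case (elim x)
    have 1: "cos (\<alpha> + \<phi> x) * cos (\<alpha> + \<phi> x) + sin (\<alpha> + \<phi> x) * sin (\<alpha> + \<phi> x) = 1"
      by (simp flip: power2_eq_square)
    have "T x $ 1 * K x $ 2 - T x $ 2 * K x $ 1 =
        \<kappa> x * (cos (\<alpha> + \<phi> x) * cos (\<alpha> + \<phi> x) + sin (\<alpha> + \<phi> x) * sin (\<alpha> + \<phi> x))" if "x \<in> {0<..<L}"
    proof -
      have "T x $ 1 = cos (\<alpha> + \<phi> x)" "T x $ 2 = sin (\<alpha> + \<phi> x)"
        "K x $ 1 = - (\<kappa> x * sin (\<alpha> + \<phi> x))" "K x $ 2 = \<kappa> x * cos (\<alpha> + \<phi> x)"
        using TE[of x] elim that by auto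
      moreover have "c * (k * c) - s * - (k * s) = k * (c * c + s * s)" for c s k :: real
        by (simp add: algebra_simps)
      ultimately show ?thesis by (simp only:)
    qed
    then show ?case unfolding 1 by simp
  qed
  then have "AE x in lebesgue_on {0<..<L}. T x $ 1 * K x $ 2 - T x $ 2 * K x $ 1 = \<kappa> x"
    by (simp add: AE_restrict_space_iff)
  then show thesis using that p\<phi> TE near\<phi> by blast
qed

text \<open>By Lagrange's identity and \<open>norm (T x) = 1\<close>, the determinant of
  \<open>T x\<close> and \<open>K x\<close> is at most \<open>norm (K x)\<close> in absolute
  value.\<close>

lemma curvature_Lp:
  assumes l: "arclength_lift p L \<eta> T K" and p: "p \<ge> 1"
    and k: "AE x in lebesgue_on {0<..<L}. T x $ 1 * K x $ 2 - T x $ 2 * K x $ 1 = k x"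
  shows "(\<lambda>x. \<bar>k x\<bar> powr p) absolutely_integrable_on {0..L}"
proof -
  have K: "K \<in> Lp p L" using l by (simp add: arclength_lift_def)
  have n: "norm (T x) = 1" if "x \<in> {0<..<L}" for x using l that by (auto simp: arclength_lift_def)
  have T: "T \<in> borel_measurable (lebesgue_on {0<..<L})"
    using l primitive_on_continuous continuous_in_Lp[of L T 1] by (auto simp: arclength_lift_def Lp_def)
  have Tm: "(\<lambda>x. T x $ i) \<in> borel_measurable (lebesgue_on {0<..<L})" for i
    using borel_measurable_continuous_onI[OF linear_continuous_on[OF bounded_linear_vec_nth]] T by measurable
  have Km: "(\<lambda>x. K x $ i) \<in> borel_measurable (lebesgue_on {0<..<L})" for i
    using K borel_measurable_continuous_onI[OF linear_continuous_on[OF bounded_linear_vec_nth]]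
    unfolding Lp_def by (auto intro: measurable_compose)
  have m: "(\<lambda>x. \<bar>T x $ 1 * K x $ 2 - T x $ 2 * K x $ 1\<bar> powr p) \<in> borel_measurable (lebesgue_on {0<..<L})"
    using Tm Km by measurable
  have "integrable (lebesgue_on {0<..<L}) (\<lambda>x. \<bar>T x $ 1 * K x $ 2 - T x $ 2 * K x $ 1\<bar> powr p)"
  proof (rule measurable_bounded_by_integrable_imp_lebesgue_integrable[OF m])
    show "integrable (lebesgue_on {0<..<L}) (\<lambda>x. norm (K x) powr p)" using K by (simp add: Lp_def)
    fix x assume x: "x \<in> {0<..<L}"
    have t: "(T x $ 1)\<^sup>2 + (T x $ 2)\<^sup>2 = 1" using n[OF x] by (simp add: norm_vec2)
    have "(T x $ 1 * K x $ 2 - T x $ 2 * K x $ 1)\<^sup>2 + (T x $ 1 * K x $ 1 + T x $ 2 * K x $ 2)\<^sup>2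
       = ((T x $ 1)\<^sup>2 + (T x $ 2)\<^sup>2) * ((K x $ 1)\<^sup>2 + (K x $ 2)\<^sup>2)"
      by (rule lagrange_identity_2)
    then have "(T x $ 1 * K x $ 2 - T x $ 2 * K x $ 1)\<^sup>2 \<le> (K x $ 1)\<^sup>2 + (K x $ 2)\<^sup>2"
      using zero_le_power2[of "T x $ 1 * K x $ 1 + T x $ 2 * K x $ 2"] unfolding t mult_1 by linarith
    then have "\<bar>T x $ 1 * K x $ 2 - T x $ 2 * K x $ 1\<bar> \<le> norm (K x)"
      unfolding norm_vec2 by (metis real_sqrt_abs real_sqrt_le_mono)
    then show "norm (\<bar>T x $ 1 * K x $ 2 - T x $ 2 * K x $ 1\<bar> powr p) \<le> norm (K x) powr p"
      using p by (auto intro!: powr_mono2)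
  qed simp
  then have "integrable (lebesgue_on {0<..<L}) (\<lambda>x. \<bar>k x\<bar> powr p)"
    by (rule lebesgue_on_integral_cong_AE(1)[THEN iffD1, rotated 2]) (use k in \<open>auto elim!: eventually_mono\<close>)
  then show ?thesis by (simp add: lebesgue_integral_Ioo_eq_Icc)
qed

text \<open>A quantitative Sobolev embedding: \<open>norm (u x)\<close> is at most
  \<open>norm (u y)\<close> plus the integral of the norm of \<open>k\<close>. Integrating over
  \<open>y\<close> leaves the L^1 norms of \<open>u\<close> and \<open>k\<close>, both estimated by
  \<open>powr_ge_linear\<close> at level \<open>l\<close>.\<close>

lemma sup_bound_of_Lp:
  fixes u k :: "real \<Rightarrow> real^2"
  assumes u: "primitive_on 0 L u k" and L: "L > 0" and p: "p \<ge> 1" and k: "k \<in> Lp p L"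
    and l: "0 < l" and x: "x \<in> {0..L}"
    and A: "(LINT x|lebesgue_on {0<..<L}. norm (u x) powr p) \<le> A" "(LINT x|lebesgue_on {0<..<L}. norm (k x) powr p) \<le> A"
  shows "L * norm (u x) \<le> (1 + L) * (l * L + l powr (1 - p) * A)"
proof -
  have cu: "continuous_on {0..L} u" by (rule primitive_on_continuous[OF u])
  have up: "u \<in> Lp p L" by (rule continuous_in_Lp[OF cu]) (use p in simp)
  have int: "integral {0..L} (\<lambda>x. norm (f x)) \<le> l * L + l powr (1 - p) * A" "(\<lambda>x. norm (f x)) integrable_on {0..L}"
    if f: "f \<in> Lp p L" and fA: "(LINT x|lebesgue_on {0<..<L}. norm (f x) powr p) \<le> A" for f
  proof -
    have i: "(\<lambda>x. norm (f x) powr p) absolutely_integrable_on {0..L}"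
      using f by (auto simp: Lp_def lebesgue_integral_Ioo_eq_Icc)
    show fi: "(\<lambda>x. norm (f x)) integrable_on {0..L}"
      using Lp_absolutely_integrable[OF f p] by (simp add: absolutely_integrable_on_def)
    have ip: "(\<lambda>x. norm (f x) powr p) integrable_on {0..L}" using i by (simp add: absolutely_integrable_on_def)
    have "integral {0..L} (\<lambda>x. norm (f x)) \<le> integral {0..L} (\<lambda>x. l + l powr (1 - p) * norm (f x) powr p)"
    proof (rule integral_le[OF fi])
      show "(\<lambda>x. l + l powr (1 - p) * norm (f x) powr p) integrable_on {0..L}"
        by (intro integrable_add integrable_on_mult_right ip) auto
    qed (use powr_ge_linear p l in auto)
    also have "\<dots> = l * L + l powr (1 - p) * integral {0..L} (\<lambda>x. norm (f x) powr p)"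
      using ip L by (subst Henstock_Kurzweil_Integration.integral_add) (auto intro: integrable_on_mult_right)
    also have "\<dots> \<le> l * L + l powr (1 - p) * A"
      using fA lebesgue_integral_Ioo_eq_Icc(2)[OF i] by (auto intro!: mult_left_mono)
    finally show "integral {0..L} (\<lambda>x. norm (f x)) \<le> l * L + l powr (1 - p) * A" .
  qed
  have *: "norm (u x) \<le> norm (u y) + integral {0..L} (\<lambda>x. norm (k x))" if y: "y \<in> {0..L}" for y
  proof -
    have "norm (u t - u s) \<le> integral {0..L} (\<lambda>x. norm (k x))" if st: "0 \<le> s" "s \<le> t" "t \<le> L" for s t
    proof -
      have ki: "k integrable_on {s..t}" "(\<lambda>x. norm (k x)) integrable_on {s..t}"
        using absolutely_integrable_on_Icc_subset[OF primitive_on_integrable[OF u], of s t] st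
        by (auto simp: absolutely_integrable_on_def)
      have "norm (u t - u s) = norm (integral {s..t} k)" using primitive_on_diff[OF u st] by simp
      also have "\<dots> \<le> integral {s..t} (\<lambda>x. norm (k x))"
        by (rule integral_norm_bound_integral) (use ki in auto)
      also have "\<dots> \<le> integral {0..L} (\<lambda>x. norm (k x))"
        by (rule integral_subset_le) (use ki int(2)[OF k A(2)] st in auto)
      finally show ?thesis .
    qed
    from this[of x y] this[of y x] x y show ?thesis
      by (cases "x \<le> y") (auto, (smt (verit) norm_minus_commute norm_triangle_sub)+)
  qed
  have "integral {0..L} (\<lambda>y. norm (u x)) \<le> integral {0..L} (\<lambda>y. norm (u y) + integral {0..L} (\<lambda>x. norm (k x)))"
    by (rule integral_le) (use * int(2)[OF up A(1)] in \<open>auto intro!: integrable_add\<close>)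
  also have "\<dots> = integral {0..L} (\<lambda>y. norm (u y)) + L * integral {0..L} (\<lambda>x. norm (k x))"
    using int(2)[OF up A(1)] L by (subst Henstock_Kurzweil_Integration.integral_add) auto
  also have "\<dots> \<le> (l * L + l powr (1 - p) * A) + L * (l * L + l powr (1 - p) * A)"
    using int(1)[OF up A(1)] int(1)[OF k A(2)] L by (intro add_mono mult_left_mono) auto
  also have "\<dots> = (1 + L) * (l * L + l powr (1 - p) * A)" by (simp add: algebra_simps)
  finally show ?thesis using L by simp
qed

text \<open>Converts nearness in \<open>W2p_dist\<close>, which is defined through chosen weak
  derivatives, into uniform nearness of tangents, with an \<epsilon> that is independent of the
  curves.\<close>

lemma W2p_close_imp_tangents_close:
  assumes L: "L > 0" and p: "p \<ge> 1" and \<delta>: "\<delta> > 0"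
  shows "\<exists>\<epsilon>>0. \<forall>\<eta> \<gamma> T K T' K'. arclength_lift p L \<eta> T K \<longrightarrow> arclength_lift p L \<gamma> T' K' \<longrightarrow>
     W2p_dist p L \<eta> \<gamma> < \<epsilon> \<longrightarrow> (\<forall>x\<in>{0..L}. norm (T x - T' x) < \<delta>)"
proof -
  \<comment> \<open>The two terms in \<open>sup_bound_of_Lp\<close> are balanced: with the factor
    \<open>1 + L\<close> included, \<open>l\<close> makes the first one
    \<open>L * \<delta> / 4\<close>, and \<open>A\<close> makes the second one equal to it.\<close>
  define l where "l = \<delta> / (4 * (1 + L))"
  have l: "l > 0" using \<delta> L by (simp add: l_def)
  define A where "A = L * \<delta> * l powr (p - 1) / (4 * (1 + L))"
  have A: "A > 0" using \<delta> L l by (simp add: A_def)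
  have lA: "l powr (1 - p) * A = L * \<delta> / (4 * (1 + L))"
  proof -
    have "l powr (1 - p) * l powr (p - 1) = 1" using l by (simp add: powr_add[symmetric])
    then show ?thesis unfolding A_def by (simp add: mult.commute mult.left_commute)
  qed
  define \<epsilon> where "\<epsilon> = A powr (1 / p)"
  have lL: "(1 + L) * l = \<delta> / 4" unfolding l_def using L by (simp add: divide_simps)
  have \<epsilon>: "\<epsilon> > 0" using A by (simp add: \<epsilon>_def)
  have "norm (T x - T' x) < \<delta>" if l1: "arclength_lift p L \<eta> T K" and l2: "arclength_lift p L \<gamma> T' K'"
    and d: "W2p_dist p L \<eta> \<gamma> < \<epsilon>" and x: "x \<in> {0..L}" for \<eta> \<gamma> T K T' K' x
  proof -
    let ?M = "lebesgue_on {0<..<L}" and ?f = "\<lambda>x. \<eta> x - \<gamma> x"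
    have w1: "has_weak_deriv L ?f (\<lambda>x. T x - T' x)"
      by (rule has_weak_deriv_diff[OF arclength_liftD(1)[OF l1 L] arclength_liftD(1)[OF l2 L] L])
    have w2: "has_weak_deriv L (\<lambda>x. T x - T' x) (\<lambda>x. K x - K' x)"
      by (rule has_weak_deriv_diff[OF arclength_liftD(2)[OF l1 L] arclength_liftD(2)[OF l2 L] L])
    have cong: "(LINT x|?M. norm (g x) powr p) = (LINT x|?M. norm (h x) powr p)" if "AE x in ?M. g x = h x"
      for g h :: "real \<Rightarrow> real^2"
      by (rule lebesgue_on_integral_cong_AE(2)) (use that in \<open>auto elim!: eventually_mono\<close>)
    have nn: "Lp_norm p L g \<ge> 0" for g by (simp add: Lp_norm_def)
    have small: "(LINT x|?M. norm (g x) powr p) \<le> A" if "Lp_norm p L g < \<epsilon>" for g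
    proof (rule ccontr)
      assume "\<not> ?thesis"
      then have "A powr (1/p) \<le> Lp_norm p L g"
        unfolding Lp_norm_def using A p by (intro powr_mono2) auto
      then show False using that by (simp add: \<epsilon>_def)
    qed
    have "Lp_norm p L (weak_deriv L ?f) < \<epsilon>" "Lp_norm p L (weak_deriv L (weak_deriv L ?f)) < \<epsilon>"
      using d nn[of ?f] nn[of "weak_deriv L ?f"] nn[of "weak_deriv L (weak_deriv L ?f)"]
      by (simp_all add: W2p_dist_def W2p_norm_def)
    then have i: "(LINT x|?M. norm (T x - T' x) powr p) \<le> A" "(LINT x|?M. norm (K x - K' x) powr p) \<le> A"
      using small[of "weak_deriv L ?f"] small[of "weak_deriv L (weak_deriv L ?f)"]
      by (simp_all only: cong[OF weak_deriv_AE[OF w1 L]] cong[OF weak_deriv2_AE[OF w1 w2 L]])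
    have "L * norm (T x - T' x) \<le> (1 + L) * (l * L + l powr (1 - p) * A)"
    proof (rule sup_bound_of_Lp[OF _ L p _ l x i])
      show "primitive_on 0 L (\<lambda>x. T x - T' x) (\<lambda>x. K x - K' x)"
        using l1 l2 by (auto simp: arclength_lift_def intro: primitive_on_minus_fun)
      show "(\<lambda>x. K x - K' x) \<in> Lp p L" using l1 l2 p by (auto simp: arclength_lift_def intro: Lp_diff)
    qed
    also have "\<dots> = 2 * (L * ((1 + L) * l))" unfolding lA by (simp add: l_def)
    also have "\<dots> = L * (\<delta> / 2)" unfolding lL by simp
    finally have "norm (T x - T' x) \<le> \<delta> / 2" using L by simp
    then show ?thesis using \<delta> by simp
  qed
  then show ?thesis using \<epsilon> by blast
qed

section \<open>Lower bounds for the energy\<close>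

lemma has_integral_reflect_about:
  fixes f :: "real \<Rightarrow> real"
  assumes "(f has_integral i) {u..v}"
  shows "((\<lambda>x. f (c - x)) has_integral i) {c - v..c - u}"
proof -
  have "((\<lambda>x. f (- 1 *\<^sub>R x + c)) has_integral (1 / \<bar>- 1\<bar> ^ DIM(real)) *\<^sub>R i)
      ((\<lambda>x. (1 / - 1) *\<^sub>R x + - ((1 / - 1) *\<^sub>R c)) ` cbox u v)"
    by (rule has_integral_affinity) (use assms in auto)
  moreover have "(\<lambda>x. (1 / - 1) *\<^sub>R x + - ((1 / - 1) *\<^sub>R c)) ` cbox u v = {c - v..c - u}"
    by (auto simp: image_iff intro!: bexI[of _ "c - x" for x])
  ultimately show ?thesis by simp
qed

lemma integral_reflect_about:
  fixes f :: "real \<Rightarrow> real"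
  assumes "f integrable_on {u..v}"
  shows "integral {c - v..c - u} (\<lambda>x. f (c - x)) = integral {u..v} f"
    "(\<lambda>x. f (c - x)) integrable_on {c - v..c - u}"
  using has_integral_reflect_about[OF integrable_integral[OF assms], of c]
  by (auto simp: integral_unique)

lemma absolutely_integrable_reflect_about:
  fixes f :: "real \<Rightarrow> real"
  assumes "f absolutely_integrable_on {a..b}"
  shows "(\<lambda>x. f (a + b - x)) absolutely_integrable_on {a..b}"
  using integral_reflect_about(2)[of f a b "a + b"] integral_reflect_about(2)[of "\<lambda>x. norm (f x)" a b "a + b"] assms
  by (auto simp: absolutely_integrable_on_def)

lemma primitive_on_reflect_about:
  fixes F f :: "real \<Rightarrow> real"
  assumes F: "primitive_on a b F f"
  shows "primitive_on a b (\<lambda>x. - F (a + b - x)) (\<lambda>x. f (a + b - x))"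
proof (rule primitive_onI)
  show "(\<lambda>x. f (a + b - x)) absolutely_integrable_on {a..b}"
    by (rule absolutely_integrable_reflect_about[OF primitive_on_integrable[OF F]])
  fix x y assume xy: "a \<le> x" "x \<le> y" "y \<le> b"
  have "f absolutely_integrable_on {a + b - y..a + b - x}"
    by (rule absolutely_integrable_on_Icc_subset[OF primitive_on_integrable[OF F]]) (use xy in auto)
  then have "integral {x..y} (\<lambda>x. f (a + b - x)) = integral {a + b - y..a + b - x} f"
    using integral_reflect_about(1)[of f "a + b - y" "a + b - x" "a + b"] by (auto simp: absolutely_integrable_on_def)
  also have "\<dots> = F (a + b - x) - F (a + b - y)"
    using primitive_on_diff[OF F, of "a + b - y" "a + b - x"] xy by simp
  finally show "- F (a + b - y) - - F (a + b - x) = integral {x..y} (\<lambda>x. f (a + b - x))" by simp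
qed

text \<open>Young's inequality with exponents \<open>p\<close> and \<open>p / (p - 1)\<close> for
  \<open>\<bar>r\<bar>\<close> and \<open>V powr (p - 1)\<close>. Equality at \<open>r = V\<close>
  is what lets the flat-core curve attain the bound.\<close>

lemma young_powr:
  fixes p V r :: real
  assumes "p > 1" "V \<ge> 0"
  shows "p * V powr (p - 1) * r \<le> \<bar>r\<bar> powr p + (p - 1) * V powr p"
proof -
  have "\<bar>r\<bar> * V powr (p - 1) \<le> \<bar>r\<bar> powr p / p + (V powr (p - 1)) powr (p / (p - 1)) / (p / (p - 1))"
    by (rule Youngs_inequality) (use assms in \<open>auto simp: field_simps\<close>)
  then have "p * (\<bar>r\<bar> * V powr (p - 1)) \<le> p * (\<bar>r\<bar> powr p / p + V powr p / (p / (p - 1)))"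
    using assms by (intro mult_left_mono) (auto simp: powr_powr)
  also have "\<dots> = \<bar>r\<bar> powr p + (p - 1) * V powr p" using assms by (simp add: field_simps)
  finally have "p * V powr (p - 1) * \<bar>r\<bar> \<le> \<bar>r\<bar> powr p + (p - 1) * V powr p" by (simp add: mult_ac)
  moreover have "p * V powr (p - 1) * r \<le> p * V powr (p - 1) * \<bar>r\<bar>"
    using assms by (intro mult_left_mono) auto
  ultimately show ?thesis by linarith
qed

text \<open>Young's inequality has a slack of order \<open>V powr p\<close> while
  \<open>r < V / 2\<close>. It is stated with the factor \<open>1 - 2 * r / V\<close> because that
  can be integrated along a curve: if \<open>r\<close> is the derivative of the angle and
  \<open>V\<close> is \<open>v\<close> at the angle, then \<open>r / V\<close> is the derivative of
  \<open>\<Psi>\<close> at the angle, where \<open>\<Psi>\<close> has derivative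
  \<open>1 / v\<close>. For \<open>r \<ge> V / 2\<close> the claimed slack is not positive.\<close>

lemma young_powr_gap:
  fixes p V W r :: real
  assumes p: "p > 2" and W: "0 < W" "W \<le> V"
  shows "p * V powr (p - 1) * r + (p - 2) / 2 * W powr p * (1 - 2 * r / V) \<le> \<bar>r\<bar> powr p + (p - 1) * V powr p"
proof (cases "r / V \<ge> 1 / 2")
  case True
  then have "(p - 2) / 2 * W powr p * (1 - 2 * r / V) \<le> 0"
    using p by (intro mult_nonneg_nonpos) (auto simp: mult.commute)
  then show ?thesis using young_powr[of p V r] p W by linarith
next
  case False
  define \<rho> where "\<rho> = r / V"
  have V: "V > 0" using W by linarith
  have r: "r = \<rho> * V" using V by (simp add: \<rho>_def)
  have \<rho>: "\<rho> < 1 / 2" using False by (simp add: \<rho>_def)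
  have Vp: "V powr (p - 1) * V = V powr p" using V by (simp add: powr_diff)
  have "(p - 2) / 2 * W powr p * (1 - 2 * r / V) = (p - 2) / 2 * (1 - 2 * \<rho>) * W powr p"
    by (simp add: \<rho>_def)
  also have "\<dots> \<le> (p - 2) / 2 * (1 - 2 * \<rho>) * V powr p"
    using p W \<rho> by (intro mult_left_mono powr_mono2 mult_nonneg_nonneg) auto
  finally have 1: "(p - 2) / 2 * W powr p * (1 - 2 * r / V) \<le> (p - 2) / 2 * (1 - 2 * \<rho>) * V powr p" .
  have 2: "p * V powr (p - 1) * r = p * \<rho> * V powr p" unfolding r Vp[symmetric] by simp
  have "p * \<rho> + (p - 2) / 2 * (1 - 2 * \<rho>) = 2 * \<rho> + (p - 2) / 2" by (simp add: field_simps)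
  also have "\<dots> \<le> p - 1" using \<rho> p by (simp add: field_simps)
  finally have "(p * \<rho> + (p - 2) / 2 * (1 - 2 * \<rho>)) * V powr p \<le> (p - 1) * V powr p"
    by (intro mult_right_mono) auto
  then have "p * \<rho> * V powr p + (p - 2) / 2 * (1 - 2 * \<rho>) * V powr p \<le> (p - 1) * V powr p"
    by (simp only: distrib_right)
  moreover have "0 \<le> \<bar>r\<bar> powr p" by simp
  ultimately show ?thesis using 1 2 by linarith
qed

text \<open>\<open>G\<close> is a calibration: its increment along an angle function bounds the
  integral of the density from below. \<open>v\<close> and \<open>G\<close> stay abstract because
  the right end segment is treated with a reflected function in the role of
  \<open>G\<close>.\<close>

locale lower_bound =
  fixes p :: real and v G :: "real \<Rightarrow> real"
  assumes p: "p > 2"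
    and v_cont: "continuous_on UNIV v" and v_nonneg: "\<And>x. 0 \<le> v x"
    and G: "\<And>x. (G has_real_derivative p * v x powr (p - 1)) (at x)"
begin

definition density :: "(real \<Rightarrow> real) \<Rightarrow> (real \<Rightarrow> real) \<Rightarrow> real \<Rightarrow> real" where
  "density \<phi> k s = \<bar>k s\<bar> powr p + (p - 1) * v (\<phi> s) powr p"

lemma density_nonneg: "0 \<le> density \<phi> k s"
  using p by (simp add: density_def)

lemma G_mono: "x \<le> y \<Longrightarrow> G x \<le> G y"
  by (rule DERIV_nonneg_imp_nondecreasing) (use G p in \<open>auto intro!: exI mult_nonneg_nonneg\<close>)

lemma density_integrable:
  assumes "primitive_on a b \<phi> k" "(\<lambda>s. \<bar>k s\<bar> powr p) absolutely_integrable_on {a..b}" "a \<le> x" "y \<le> b"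
  shows "density \<phi> k integrable_on {x..y}"
proof -
  have "continuous_on {x..y} \<phi>"
    using primitive_on_continuous[OF assms(1)] continuous_on_subset assms(3,4) by fastforce
  then have "continuous_on {x..y} (\<lambda>s. v (\<phi> s))"
    by (rule continuous_on_compose2[OF v_cont]) auto
  then have "continuous_on {x..y} (\<lambda>s. (p - 1) * v (\<phi> s) powr p)"
    using p v_nonneg by (intro continuous_intros continuous_on_powr') auto
  moreover have "(\<lambda>s. \<bar>k s\<bar> powr p) integrable_on {x..y}"
    using absolutely_integrable_on_Icc_subset[OF assms(2-4)] by (simp add: absolutely_integrable_on_def)
  ultimately show ?thesis
    unfolding density_def[abs_def] by (intro integrable_add) (auto intro: integrable_continuous_real)
qed

text \<open>Young's inequality at each point, integrated by the chain rule for the absolutely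
  continuous angle.\<close>

lemma increment_le_density_integral:
  assumes P: "primitive_on a b \<phi> k" and k: "(\<lambda>s. \<bar>k s\<bar> powr p) absolutely_integrable_on {a..b}"
    and xy: "a \<le> x" "x \<le> y" "y \<le> b"
  shows "G (\<phi> y) - G (\<phi> x) \<le> integral {x..y} (density \<phi> k)"
proof -
  have ch: "primitive_on a b (\<lambda>s. G (\<phi> s)) (\<lambda>s. p * v (\<phi> s) powr (p - 1) * k s)"
  proof (rule primitive_on_chain[OF P])
    show "continuous_on (\<phi> ` {a..b}) (\<lambda>y. p * v y powr (p - 1))"
      using p v_nonneg v_cont continuous_on_subset[of UNIV v "\<phi> ` {a..b}"]
      by (intro continuous_intros continuous_on_powr') auto
  qed (use G in auto)
  have "G (\<phi> y) - G (\<phi> x) = integral {x..y} (\<lambda>s. p * v (\<phi> s) powr (p - 1) * k s)"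
    by (rule primitive_on_diff[OF ch xy])
  also have "\<dots> \<le> integral {x..y} (density \<phi> k)"
  proof (rule integral_le)
    show "(\<lambda>s. p * v (\<phi> s) powr (p - 1) * k s) integrable_on {x..y}"
      using absolutely_integrable_on_Icc_subset[OF primitive_on_integrable[OF ch] xy(1,3)]
      by (simp add: absolutely_integrable_on_def)
    show "density \<phi> k integrable_on {x..y}" by (rule density_integrable[OF P k xy(1,3)])
  qed (use young_powr p v_nonneg in \<open>auto simp: density_def\<close>)
  finally show ?thesis .
qed

lemma density_integral_split:
  assumes "primitive_on a b \<phi> k" "(\<lambda>s. \<bar>k s\<bar> powr p) absolutely_integrable_on {a..b}"
    and "a \<le> x" "x \<le> y" "y \<le> z" "z \<le> b"
  shows "integral {x..z} (density \<phi> k) = integral {x..y} (density \<phi> k) + integral {y..z} (density \<phi> k)"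
  using Henstock_Kurzweil_Integration.integral_combine[of x y z "density \<phi> k"] density_integrable[OF assms(1,2)] assms(3-) by simp

lemma density_integral_nonneg: "0 \<le> integral {x..y} (density \<phi> k)"
  by (cases "density \<phi> k integrable_on {x..y}")
     (auto intro: Henstock_Kurzweil_Integration.integral_nonneg simp: density_nonneg not_integrable_integral)

text \<open>The angle at the free end of a straight segment may miss \<open>0\<close> by a small amount \<open>m > 0\<close>, which
  loses \<open>G m = o(v(m)\<^sup>p)\<close> in the variation of \<open>G\<close>. This is outweighed by the potential energy, of
  order \<open>v(m)\<^sup>p\<close>, that is paid along the whole segment: \<open>\<Psi>\<close> is the time that the optimal profile needs
  to reach an angle starting from \<open>0\<close>, and this time is short compared with the segment.\<close>

lemma free_end_bound:
  assumes P: "primitive_on a b \<phi> k" and k: "(\<lambda>s. \<bar>k s\<bar> powr p) absolutely_integrable_on {a..b}"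
    and ab: "a \<le> b" and G0: "G 0 = 0"
    and v_pos: "\<And>x. 0 < x \<Longrightarrow> x < \<delta> \<Longrightarrow> 0 < v x"
    and v_mono: "\<And>x y. 0 < x \<Longrightarrow> x \<le> y \<Longrightarrow> y < \<delta> \<Longrightarrow> v x \<le> v y"
    and \<Psi>: "\<And>x. 0 < x \<Longrightarrow> x < \<delta> \<Longrightarrow> (\<Psi> has_real_derivative 1 / v x) (at x)"
    and \<Psi>c: "continuous_on {0..<\<delta>} \<Psi>" and \<Psi>0: "\<Psi> 0 = 0"
    and \<Psi>B: "\<And>x. 0 < x \<Longrightarrow> x < \<delta> \<Longrightarrow> \<Psi> x \<le> B" and B: "p * B \<le> (p - 2) / 2 * (b - a)"
    and \<phi>: "\<And>s. s \<in> {a..b} \<Longrightarrow> \<phi> s < \<delta>"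
  shows "G (\<phi> b) \<le> integral {a..b} (density \<phi> k)"
proof (cases "\<exists>x\<in>{a..b}. \<phi> x \<le> 0")
  \<comment> \<open>The angle is at most 0 at some \<open>x\<close>, so
    \<open>G (\<phi> x) \<le> 0\<close> and the increment of \<open>G\<close> from \<open>x\<close>
    onwards suffices.\<close>
  case True
  then obtain x where x: "x \<in> {a..b}" "\<phi> x \<le> 0" by blast
  have "G (\<phi> b) - G (\<phi> x) \<le> integral {x..b} (density \<phi> k)"
    by (rule increment_le_density_integral[OF P k]) (use x in auto)
  moreover have "integral {a..b} (density \<phi> k) = integral {a..x} (density \<phi> k) + integral {x..b} (density \<phi> k)"
    by (rule density_integral_split[OF P k]) (use x in auto)
  ultimately show ?thesis
    using G_mono[OF x(2)] G0 density_integral_nonneg[of a x \<phi> k] by linarith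
next
  case False
  then have pos: "\<phi> x > 0" if "x \<in> {a..b}" for x using that by force
  have c\<phi>: "continuous_on {a..b} \<phi>" by (rule primitive_on_continuous[OF P])
  \<comment> \<open>The interval is split at a minimum point \<open>c\<close> of the angle, so that
    \<open>v (\<phi> s) \<ge> v m\<close> on both sides. To the left of \<open>c\<close> only the
    potential is counted; to the right Young's inequality with slack is integrated from the angle
    \<open>m\<close> to \<open>\<phi> b\<close>.\<close>
  obtain c where c: "c \<in> {a..b}" "\<And>x. x \<in> {a..b} \<Longrightarrow> \<phi> c \<le> \<phi> x"
    using continuous_attains_inf[OF _ _ c\<phi>] ab by auto
  define m where "m = \<phi> c"
  have m: "0 < m" "m < \<delta>" using pos[OF c(1)] \<phi>[OF c(1)] by (auto simp: m_def)
  define \<kappa> where "\<kappa> = (p - 2) / 2"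
  have p\<kappa>: "p = 2 * \<kappa> + 2" unfolding \<kappa>_def by (simp add: field_simps)
  have \<kappa>: "0 < \<kappa>" "\<kappa> \<le> p - 1" using p by (auto simp: \<kappa>_def)
  define w where "w = v m powr p"
  have w: "w > 0" using v_pos[OF m] by (simp add: w_def)
  have in_range: "m \<le> \<phi> s" "\<phi> s < \<delta>" "0 < \<phi> s" if "s \<in> {a..b}" for s
    using c(2)[OF that] \<phi>[OF that] pos[OF that] by (auto simp: m_def)
  \<comment> \<open>\<open>h\<close> absorbs the part of the slack that is a derivative; what
    remains of the slack is the constant \<open>\<kappa> * w\<close>.\<close>
  define h where "h x = G x - 2 * \<kappa> * w * \<Psi> x" for x
  define h' where "h' x = p * v x powr (p - 1) - 2 * \<kappa> * w * (1 / v x)" for x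
  have ch: "primitive_on a b (\<lambda>s. h (\<phi> s)) (\<lambda>s. h' (\<phi> s) * k s)"
  proof (rule primitive_on_chain[OF P])
    show "(h has_real_derivative h' y) (at y)" if "y \<in> \<phi> ` {a..b}" for y
      unfolding h_def h'_def
      by (rule DERIV_diff[OF G DERIV_cmult[OF \<Psi>]]) (use that in_range in auto)
    show "continuous_on (\<phi> ` {a..b}) h'"
    proof -
      have cv: "continuous_on (\<phi> ` {a..b}) v" using v_cont continuous_on_subset by blast
      have nz: "v y \<noteq> 0" if "y \<in> \<phi> ` {a..b}" for y using v_pos in_range that by force
      show ?thesis unfolding h'_def by (intro continuous_intros continuous_on_powr' cv) (use nz in auto)
    qed
  qed
  have I: "(\<lambda>s. h' (\<phi> s) * k s) integrable_on {c..b}"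
    using absolutely_integrable_on_Icc_subset[OF primitive_on_integrable[OF ch], of c b] c(1)
    by (auto simp: absolutely_integrable_on_def)
  have "h (\<phi> b) - h (\<phi> c) + \<kappa> * w * (b - c) = integral {c..b} (\<lambda>s. h' (\<phi> s) * k s + \<kappa> * w)"
    using primitive_on_diff[OF ch, of c b] c(1) I by (subst Henstock_Kurzweil_Integration.integral_add) auto
  also have "\<dots> \<le> integral {c..b} (density \<phi> k)"
  proof (rule integral_le)
    show "(\<lambda>s. h' (\<phi> s) * k s + \<kappa> * w) integrable_on {c..b}" by (intro integrable_add I) auto
    show "density \<phi> k integrable_on {c..b}" by (rule density_integrable[OF P k]) (use c in auto)
    fix s assume "s \<in> {c..b}"
    then have s: "s \<in> {a..b}" using c by auto
    have "p * v (\<phi> s) powr (p - 1) * k s + (p - 2) / 2 * v m powr p * (1 - 2 * k s / v (\<phi> s)) \<le> density \<phi> k s"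
      unfolding density_def
      by (rule young_powr_gap[OF p v_pos[OF m] v_mono[OF m(1)]]) (use in_range[OF s] in auto)
    moreover have "h' (\<phi> s) * k s + \<kappa> * w
        = p * v (\<phi> s) powr (p - 1) * k s + (p - 2) / 2 * v m powr p * (1 - 2 * k s / v (\<phi> s))"
      by (simp add: h'_def \<kappa>_def w_def algebra_simps diff_divide_distrib)
    ultimately show "h' (\<phi> s) * k s + \<kappa> * w \<le> density \<phi> k s" by simp
  qed
  finally have 1: "h (\<phi> b) - h m + \<kappa> * w * (b - c) \<le> integral {c..b} (density \<phi> k)" by (simp add: m_def)
  have "\<kappa> * w * (c - a) = integral {a..c} (\<lambda>s. \<kappa> * w)" using c by simp
  also have "\<dots> \<le> integral {a..c} (density \<phi> k)"
  proof (rule integral_le)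
    show "density \<phi> k integrable_on {a..c}" by (rule density_integrable[OF P k]) (use c in auto)
    fix s assume "s \<in> {a..c}"
    then have s: "s \<in> {a..b}" using c by auto
    have "w \<le> v (\<phi> s) powr p"
      unfolding w_def using v_mono[OF m(1)] in_range[OF s] v_nonneg p by (intro powr_mono2) auto
    then have "\<kappa> * w \<le> (p - 1) * v (\<phi> s) powr p" using \<kappa> w by (intro mult_mono) auto
    then show "\<kappa> * w \<le> density \<phi> k s" by (simp add: density_def add_increasing)
  qed auto
  finally have 2: "\<kappa> * w * (c - a) \<le> integral {a..c} (density \<phi> k)" .
  have 3: "integral {a..b} (density \<phi> k) = integral {a..c} (density \<phi> k) + integral {c..b} (density \<phi> k)"
    by (rule density_integral_split[OF P k]) (use c in auto)
  \<comment> \<open>For \<open>0 < x < m\<close> the derivative of \<open>G\<close> equals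
    \<open>p * v x powr p / v x\<close>, which is at most \<open>p * w\<close> times the derivative
    of \<open>\<Psi>\<close>.\<close>
  have 4: "G m \<le> p * w * \<Psi> m"
  proof -
    define R where "R x = p * w * \<Psi> x - G x" for x
    have dR: "(R has_real_derivative p * w * (1 / v x) - p * v x powr (p - 1)) (at x)" if "0 < x" "x < m" for x
      unfolding R_def using that m by (intro DERIV_diff DERIV_cmult \<Psi> G) auto
    have "continuous_on {0..m} R"
      unfolding R_def
    proof (intro continuous_intros)
      show "continuous_on {0..m} \<Psi>" using \<Psi>c by (rule continuous_on_subset) (use m in auto)
      show "continuous_on {0..m} G" using G by (meson DERIV_isCont continuous_at_imp_continuous_on)
    qed
    then obtain l z where z: "0 < z" "z < m" "(R has_real_derivative l) (at z)" "R m - R 0 = (m - 0) * l"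
      using MVT[of 0 m R] m dR by (metis real_differentiable_def)
    have l: "l = p * w * (1 / v z) - p * v z powr (p - 1)" using DERIV_unique[OF z(3) dR[OF z(1,2)]] .
    have vz: "v z > 0" "v z \<le> v m" using v_pos v_mono z m by auto
    have "v z powr (p - 1) = v z powr p / v z" using vz by (simp add: powr_diff)
    also have "\<dots> \<le> w / v z" unfolding w_def using vz p by (intro divide_right_mono powr_mono2) auto
    finally have "p * v z powr (p - 1) \<le> p * (w / v z)" using p by (intro mult_left_mono) auto
    then have "l \<ge> 0" unfolding l by simp
    then have "0 \<le> (m - 0) * l" using m(1) by (intro mult_nonneg_nonneg) auto
    then have "R m \<ge> R 0" using z(4) by linarith
    then show ?thesis by (simp add: R_def G0 \<Psi>0)
  qed
  have b: "0 < \<phi> b" "\<phi> b < \<delta>" using in_range ab by auto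
  \<comment> \<open>The origin of the bound on \<open>B\<close>: since
    \<open>p = 2 * \<kappa> + 2\<close>, the losses at \<open>\<phi> b\<close> and at
    \<open>m\<close> add up to at most \<open>w * (p * B)\<close>, while the segment pays
    \<open>w * (\<kappa> * (b - a))\<close>.\<close>
  have "w * (2 * \<kappa> * \<Psi> (\<phi> b) + 2 * \<Psi> m) \<le> w * (2 * \<kappa> * B + 2 * B)"
    using w \<kappa> \<Psi>B[OF b] \<Psi>B[OF m] by (intro mult_left_mono add_mono) auto
  also have "\<dots> = w * (p * B)" unfolding p\<kappa> by (simp add: algebra_simps)
  also have "\<dots> \<le> w * (\<kappa> * (b - a))" using w B by (intro mult_left_mono) (auto simp: \<kappa>_def)
  finally have 5: "w * (2 * \<kappa> * \<Psi> (\<phi> b) + 2 * \<Psi> m) \<le> w * (\<kappa> * (b - a))" .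
  have "integral {a..b} (density \<phi> k) \<ge> h (\<phi> b) - h m + \<kappa> * w * (b - c) + \<kappa> * w * (c - a)"
    using 1 2 3 by linarith
  moreover have "h (\<phi> b) - h m + \<kappa> * w * (b - c) + \<kappa> * w * (c - a)
      = G (\<phi> b) - G m + p * w * \<Psi> m + (w * (\<kappa> * (b - a)) - w * (2 * \<kappa> * \<Psi> (\<phi> b) + 2 * \<Psi> m))"
    unfolding h_def p\<kappa> by (simp add: algebra_simps)
  ultimately show ?thesis using 4 5 by linarith
qed

end

text \<open>The bounds for the two end segments and the increment of \<open>G\<close> between them
  telescope to \<open>G \<Theta>\<close>. The right end is a left end seen backwards: replacing the
  angle by its difference from \<open>\<Theta>\<close> and arclength \<open>s\<close> by
  \<open>s1 + L - s\<close> preserves the density.\<close>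

lemma (in lower_bound) total_bound:
  assumes P: "primitive_on 0 L \<phi> k" and k: "(\<lambda>s. \<bar>k s\<bar> powr p) absolutely_integrable_on {0..L}"
    and s: "0 < s0" "s0 \<le> s1" "s1 < L" and G0: "G 0 = 0"
    and refl: "\<And>x. v (\<Theta> - x) = v x"
    and v_pos: "\<And>x. 0 < x \<Longrightarrow> x < \<delta> \<Longrightarrow> 0 < v x"
    and v_mono: "\<And>x y. 0 < x \<Longrightarrow> x \<le> y \<Longrightarrow> y < \<delta> \<Longrightarrow> v x \<le> v y"
    and \<Psi>: "\<And>x. 0 < x \<Longrightarrow> x < \<delta> \<Longrightarrow> (\<Psi> has_real_derivative 1 / v x) (at x)"
    and \<Psi>c: "continuous_on {0..<\<delta>} \<Psi>" and \<Psi>0: "\<Psi> 0 = 0"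
    and \<Psi>B: "\<And>x. 0 < x \<Longrightarrow> x < \<delta> \<Longrightarrow> \<Psi> x \<le> B"
    and B: "p * B \<le> (p - 2) / 2 * s0" "p * B \<le> (p - 2) / 2 * (L - s1)"
    and \<phi>0: "\<And>s. s \<in> {0..s0} \<Longrightarrow> \<phi> s < \<delta>"
    and \<phi>1: "\<And>s. s \<in> {s1..L} \<Longrightarrow> \<Theta> - \<delta> < \<phi> s"
  shows "G \<Theta> \<le> integral {0..L} (density \<phi> k)"
proof -
  have sub: "primitive_on x y \<phi> k" "(\<lambda>s. \<bar>k s\<bar> powr p) absolutely_integrable_on {x..y}" if "0 \<le> x" "y \<le> L" for x y
    using primitive_on_subinterval[OF P that] absolutely_integrable_on_Icc_subset[OF k that] .
  have 1: "G (\<phi> s0) \<le> integral {0..s0} (density \<phi> k)"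
    by (rule free_end_bound[OF sub _ G0 v_pos v_mono \<Psi> \<Psi>c \<Psi>0 \<Psi>B _ \<phi>0]) (use s B in auto)
  have 2: "G (\<phi> s1) - G (\<phi> s0) \<le> integral {s0..s1} (density \<phi> k)"
    by (rule increment_le_density_integral[OF P k]) (use s in auto)
  have 3: "G \<Theta> - G (\<phi> s1) \<le> integral {s1..L} (density \<phi> k)"
  proof -
    \<comment> \<open>\<open>G'\<close> vanishes at 0 and has the same derivative as
      \<open>G\<close>, because \<open>v\<close> is symmetric about
      \<open>\<Theta> / 2\<close>.\<close>
    define G' where "G' x = G \<Theta> - G (\<Theta> - x)" for x
    have "(G' has_real_derivative p * v x powr (p - 1)) (at x)" for x
    proof -
      have "((\<lambda>x. \<Theta> - x) has_real_derivative -1) (at x)" by (auto intro!: derivative_eq_intros)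
      from DERIV_diff[OF DERIV_const[of "G \<Theta>"] DERIV_chain2[OF G this]]
      show ?thesis unfolding G'_def by (simp add: refl)
    qed
    then interpret r: lower_bound p v G' using p v_cont v_nonneg by unfold_locales auto
    define \<psi> where "\<psi> s = \<Theta> - \<phi> (s1 + L - s)" for s
    define j where "j s = k (s1 + L - s)" for s
    have P': "primitive_on s1 L \<psi> j"
      using primitive_on_add[OF primitive_on_const[of s1 L \<Theta>] primitive_on_reflect_about[OF sub(1)[of s1 L]]] s
      unfolding \<psi>_def j_def by simp
    have k': "(\<lambda>s. \<bar>j s\<bar> powr p) absolutely_integrable_on {s1..L}"
      using absolutely_integrable_reflect_about[OF sub(2)[of s1 L]] s unfolding j_def by simp
    have "G' (\<psi> L) \<le> integral {s1..L} (r.density \<psi> j)"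
    proof (rule r.free_end_bound[OF P' k' _ _ v_pos v_mono \<Psi> \<Psi>c \<Psi>0 \<Psi>B])
      show "\<psi> t < \<delta>" if "t \<in> {s1..L}" for t using \<phi>1[of "s1 + L - t"] that by (auto simp: \<psi>_def)
      show "G' 0 = 0" by (simp add: G'_def)
    qed (use s B in auto)
    moreover have "integral {s1..L} (r.density \<psi> j) = integral {s1..L} (density \<phi> k)"
    proof -
      have "r.density \<psi> j = (\<lambda>s. density \<phi> k (s1 + L - s))"
        by (simp add: fun_eq_iff density_def \<psi>_def j_def refl)
      then show ?thesis
        using integral_reflect_about(1)[of "density \<phi> k" s1 L "s1 + L"] density_integrable[OF P k, of s1 L] s
        by simp
    qed
    ultimately show ?thesis by (simp add: G'_def \<psi>_def)
  qed
  have "integral {0..L} (density \<phi> k) = integral {0..s0} (density \<phi> k) + integral {s0..L} (density \<phi> k)"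
    by (rule density_integral_split[OF P k]) (use s in auto)
  moreover have "integral {s0..L} (density \<phi> k) = integral {s0..s1} (density \<phi> k) + integral {s1..L} (density \<phi> k)"
    by (rule density_integral_split[OF P k]) (use s in auto)
  ultimately show ?thesis using 1 2 3 by linarith
qed

section \<open>The profile of a loop\<close>

text \<open>\<open>sin t powr (- e) * cos t\<close> has the antiderivative
  \<open>sin t powr (1 - e) / (1 - e)\<close>, continuous up to 0 because \<open>e < 1\<close>. The
  remaining factor \<open>1 - cos t\<close> is at most \<open>(sin t)\<^sup>2\<close> and cancels
  the singularity.\<close>

lemma inverse_sin_powr_integrable_half:
  assumes e: "0 < e" "e < 1"
  shows "(\<lambda>t. sin t powr (- e)) integrable_on {0..pi / 2}"
proof -
  define F where "F t = sin t powr (1 - e) / (1 - e)" for t :: real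
  have "((\<lambda>t. sin t powr (- e) * cos t) has_integral (F (pi / 2) - F 0)) {0..pi / 2}"
  proof (rule fundamental_theorem_of_calculus_interior)
    show "continuous_on {0..pi / 2} F"
      unfolding F_def using e by (intro continuous_intros continuous_on_powr') (auto simp: sin_ge_zero)
    fix t :: real assume t: "t \<in> {0<..<pi / 2}"
    then have s: "sin t > 0" by (intro sin_gt_zero2) auto
    have "(F has_real_derivative sin t powr (- e) * cos t) (at t)"
      using DERIV_cdivide[OF DERIV_chain2[OF has_real_derivative_powr[OF s, of "1 - e"] DERIV_sin], of "1 - e"] e
      unfolding F_def by simp
    then show "(F has_vector_derivative sin t powr (- e) * cos t) (at t)"
      by (simp add: has_real_derivative_iff_has_vector_derivative)
  qed simp
  then have "(\<lambda>t. sin t powr (- e) * cos t) integrable_on {0..pi / 2}" by blast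
  then have "(\<lambda>t. sin t powr (- e) * cos t + 1) integrable_on {0..pi / 2}" by (intro integrable_add) auto
  then have g: "(\<lambda>t. sin t powr (- e) * cos t + 1) integrable_on {0<..<pi / 2}"
    by (simp add: integrable_on_Icc_iff_Ioo)
  have "(\<lambda>t. sin t powr (- e)) integrable_on {0<..<pi / 2}"
  proof (rule measurable_bounded_by_integrable_imp_integrable_real[OF _ g])
    have "continuous_on {0<..<pi / 2} (\<lambda>t. sin t powr (- e))"
    proof (intro continuous_on_powr continuous_intros ballI)
      fix t :: real assume "t \<in> {0<..<pi / 2}"
      then show "sin t \<noteq> 0" using sin_gt_zero2[of t] by auto
    qed
    then show "(\<lambda>t. sin t powr (- e)) \<in> borel_measurable (lebesgue_on {0<..<pi / 2})"
      by (rule continuous_imp_measurable_on_sets_lebesgue) auto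
    fix t :: real assume t: "t \<in> {0<..<pi / 2}"
    then have s: "sin t > 0" "cos t > 0" by (auto intro: sin_gt_zero2 cos_gt_zero)
    have "1 - cos t \<le> (1 - cos t) * (1 + cos t)" using s by (simp add: mult_le_cancel_left1 algebra_simps power2_eq_square)
    also have "\<dots> = (sin t)\<^sup>2" using sin_cos_squared_add[of t] by (simp add: algebra_simps power2_eq_square)
    finally have "sin t powr (- e) * (1 - cos t) \<le> sin t powr (- e) * sin t powr 2"
      using s by (intro mult_left_mono) auto
    also have "\<dots> = sin t powr (2 - e)" by (simp add: powr_add[symmetric])
    also have "\<dots> \<le> 1" using s e powr_mono2[of "2 - e" "sin t" 1] by simp
    finally show "\<bar>sin t powr (- e)\<bar> \<le> sin t powr (- e) * cos t + 1" by (simp add: algebra_simps)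
  qed auto
  then show ?thesis by (simp add: integrable_on_Icc_iff_Ioo)
qed

lemma inverse_sin_powr_integrable:
  assumes "0 < e" "e < 1"
  shows "(\<lambda>t. sin t powr (- e)) integrable_on {0..pi}"
proof (rule Henstock_Kurzweil_Integration.integrable_combine[of 0 "pi / 2"])
  show "(\<lambda>t. sin t powr (- e)) integrable_on {0..pi / 2}"
    by (rule inverse_sin_powr_integrable_half[OF assms])
  from integral_reflect_about(2)[OF this, of pi]
  show "(\<lambda>t. sin t powr (- e)) integrable_on {pi / 2..pi}" by simp
qed auto

text \<open>Separation of variables for \<open>y' = sin y powr e\<close>: the time to get from 0 to
  \<open>x\<close>. The unknown \<open>y\<close> is half of the tangent angle, so
  \<open>x = pi\<close> completes a full loop.\<close>

definition loop_time :: "real \<Rightarrow> real \<Rightarrow> real" where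
  "loop_time e x = integral {0..x} (\<lambda>t. sin t powr (- e))"

lemma loop_time:
  assumes e: "0 < e" "e < 1"
  shows "loop_time e 0 = 0" "continuous_on {0..pi} (loop_time e)"
    "\<And>x. 0 < x \<Longrightarrow> x < pi \<Longrightarrow> (loop_time e has_real_derivative 1 / sin x powr e) (at x)"
    "\<And>x y. 0 \<le> x \<Longrightarrow> x < y \<Longrightarrow> y \<le> pi \<Longrightarrow> loop_time e x < loop_time e y"
proof -
  note i = inverse_sin_powr_integrable[OF e]
  show "loop_time e 0 = 0" by (simp add: loop_time_def)
  show c: "continuous_on {0..pi} (loop_time e)"
    unfolding loop_time_def[abs_def] by (rule indefinite_integral_continuous_1[OF i])
  show d: "(loop_time e has_real_derivative 1 / sin x powr e) (at x)" if x: "0 < x" "x < pi" for x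
  proof -
    have s: "sin x > 0" using x by (rule sin_gt_zero)
    have "isCont (\<lambda>t. sin t powr (- e)) x" using s by (intro continuous_intros) auto
    then have "continuous (at x within {0..pi} - {}) (\<lambda>t. sin t powr (- e))"
      by (rule continuous_at_imp_continuous_at_within)
    from integral_has_vector_derivative_continuous_at[OF i _ _ this] x
    have "((\<lambda>u. integral {0..u} (\<lambda>t. sin t powr (- e))) has_vector_derivative sin x powr (- e)) (at x within {0..pi})"
      by auto
    then show ?thesis
      using x unfolding loop_time_def[abs_def]
      by (simp add: at_within_Icc_at has_real_derivative_iff_has_vector_derivative powr_minus divide_inverse)
  qed
  show "loop_time e x < loop_time e y" if "0 \<le> x" "x < y" "y \<le> pi" for x y
  proof (rule DERIV_pos_imp_increasing_open[OF that(2)])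
    show "continuous_on {x..y} (loop_time e)" using c by (rule continuous_on_subset) (use that in auto)
    fix t assume "x < t" "t < y"
    then have "0 < t" "t < pi" using that by auto
    then show "\<exists>D. (loop_time e has_real_derivative D) (at t) \<and> 0 < D"
      using d[of t] sin_gt_zero[of t] by (intro exI[of _ "1 / sin t powr e"]) auto
  qed
qed

text \<open>The solution is the inverse function of \<open>loop_time e\<close>, continued by
  constants. The equation has no uniqueness at 0 and pi, which is why it can rest there before and
  after.\<close>

lemma single_loop:
  assumes e: "0 < e" "e < 1"
  shows "\<exists>y. (\<forall>x\<le>0. y x = 0) \<and> (\<forall>x\<ge>loop_time e pi. y x = pi) \<and> continuous_on UNIV y \<and>
    (\<forall>x. 0 < x \<and> x < loop_time e pi \<longrightarrow>
      0 < y x \<and> y x < pi \<and> (y has_real_derivative sin (y x) powr e) (at x))"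
proof -
  define C where "C = loop_time e pi"
  define g where "g = the_inv_into {0..pi} (loop_time e)"
  note H = loop_time[OF e]
  have inj: "inj_on (loop_time e) {0..pi}"
    by (rule linorder_inj_onI) (use H(4) in force)+
  have C: "C > 0" using H(4)[of 0 pi] H(1) by (simp add: C_def)
  have gH: "g (loop_time e x) = x" if "x \<in> {0..pi}" for x
    unfolding g_def by (rule the_inv_into_f_f[OF inj that])
  have im: "loop_time e ` {0..pi} = {0..C}"
  proof
    show "loop_time e ` {0..pi} \<subseteq> {0..C}"
    proof
      fix z assume "z \<in> loop_time e ` {0..pi}"
      then obtain x where x: "0 \<le> x" "x \<le> pi" "z = loop_time e x" by auto
      then show "z \<in> {0..C}" using H(4)[of 0 x] H(4)[of x pi] H(1) C
        by (cases "x = 0"; cases "x = pi") (auto simp: C_def less_imp_le)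
    qed
    show "{0..C} \<subseteq> loop_time e ` {0..pi}"
    proof
      fix z assume "z \<in> {0..C}"
      then show "z \<in> loop_time e ` {0..pi}"
        using IVT'[of "loop_time e" 0 z pi] H(1,2) by (auto simp: C_def)
    qed
  qed
  have Hg: "loop_time e (g z) = z" "g z \<in> {0..pi}" if "z \<in> {0..C}" for z
    using that gH im by (metis imageE)+
  have cg: "continuous_on {0..C} g"
    using continuous_on_inv[OF H(2), of g] gH im by auto
  \<comment> \<open>Clamping the argument to \<open>{0..C}\<close> produces the constant
    continuations.\<close>
  define y where "y x = g (min C (max 0 x))" for x
  have g0: "g 0 = 0" using gH[of 0] H(1) by simp
  have gC: "g C = pi" using gH[of pi] by (simp add: C_def)
  have cy: "continuous_on UNIV y"
    unfolding y_def by (rule continuous_on_compose2[OF cg]) (use C in \<open>auto intro!: continuous_intros\<close>)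
  have r: "0 < y x \<and> y x < pi" if x: "0 < x" "x < C" for x
  proof -
    have "y x = g x" using x by (simp add: y_def)
    moreover have "g x \<noteq> 0" "g x \<noteq> pi" using Hg(1)[of x] x H(1) by (auto simp: C_def)
    ultimately show ?thesis using Hg(2)[of x] x by auto
  qed
  have "(y has_real_derivative sin (y x) powr e) (at x)" if x: "0 < x" "x < C" for x
  proof -
    have "(y has_real_derivative inverse (1 / sin (y x) powr e)) (at x)"
    proof (rule DERIV_inverse_function[where a = 0 and b = C])
      show "(loop_time e has_real_derivative 1 / sin (y x) powr e) (at (y x))"
        using r[OF x] by (intro H(3)) auto
      show "1 / sin (y x) powr e \<noteq> 0" using r[OF x] sin_gt_zero[of "y x"] by auto
      show "loop_time e (y z) = z" if "0 < z" "z < C" for z using that Hg(1)[of z] by (simp add: y_def)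
      show "isCont y x" using cy by (simp add: continuous_on_eq_continuous_at)
    qed (use x in auto)
    then show ?thesis by simp
  qed
  moreover have "y x = 0" if "x \<le> 0" for x using that C g0 by (simp add: y_def)
  moreover have "y x = pi" if "C \<le> x" for x using that C gC by (simp add: y_def)
  ultimately show ?thesis using cy r unfolding C_def by blast
qed

text \<open>Loops are glued end to end: each one adds pi to \<open>y\<close>, and
  \<open>\<bar>sin (y x)\<bar>\<close> is unchanged by that shift. \<open>S\<close> collects the
  joints; away from them \<open>sin (y x) \<noteq> 0\<close> during the loops, so that powers of the
  sine can be differentiated in \<open>loop_integrals\<close>.\<close>

lemma iterated_loop:
  assumes e: "0 < e" "e < 1"
  shows "\<exists>y S. finite S \<and> (\<forall>x\<le>0. y x = 0) \<and> (\<forall>x\<ge>real n * loop_time e pi. y x = real n * pi) \<and>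
    continuous_on UNIV y \<and> (\<forall>x. x \<notin> S \<longrightarrow> (y has_real_derivative \<bar>sin (y x)\<bar> powr e) (at x)) \<and>
    (\<forall>x\<in>{0<..<real n * loop_time e pi} - S. sin (y x) \<noteq> 0)"
proof (induction n)
  case 0
  show ?case by (intro exI[of _ "\<lambda>x. 0"] exI[of _ "{}"]) auto
next
  case (Suc n)
  define C where "C = loop_time e pi"
  have C: "C > 0" using loop_time(1,4)[OF e] pi_gt_zero unfolding C_def by (metis order_refl)
  from Suc obtain y S where y: "finite S" "\<And>x. x \<le> 0 \<Longrightarrow> y x = 0" "\<And>x. x \<ge> real n * C \<Longrightarrow> y x = real n * pi"
    "continuous_on UNIV y" "\<And>x. x \<notin> S \<Longrightarrow> (y has_real_derivative \<bar>sin (y x)\<bar> powr e) (at x)"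
    "\<And>x. x \<in> {0<..<real n * C} - S \<Longrightarrow> sin (y x) \<noteq> 0" unfolding C_def by blast
  obtain z where z: "\<And>x. x \<le> 0 \<Longrightarrow> z x = 0" "\<And>x. C \<le> x \<Longrightarrow> z x = pi" "continuous_on UNIV z"
    "\<And>x. 0 < x \<Longrightarrow> x < C \<Longrightarrow> 0 < z x \<and> z x < pi"
    "\<And>x. 0 < x \<Longrightarrow> x < C \<Longrightarrow> (z has_real_derivative sin (z x) powr e) (at x)"
    using single_loop[OF e] unfolding C_def by blast
  \<comment> \<open>At most one summand varies at a time: \<open>z (x - real n * C)\<close> is 0
    before \<open>real n * C\<close>, and \<open>y\<close> has come to rest after it.\<close>
  define w where "w x = y x + z (x - real n * C)" for x
  define S' where "S' = S \<union> {real n * C, real (Suc n) * C}"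
  have abs_sin: "\<bar>sin (real n * pi + t)\<bar> = \<bar>sin t\<bar>" for t
    by (simp add: sin_add abs_mult)
  have nC: "real n * C \<ge> 0" using C by simp
  show ?case
  proof (intro exI[of _ w] exI[of _ S'] conjI allI impI ballI, unfold C_def[symmetric])
    show "finite S'" using y by (simp add: S'_def)
    show "w x = 0" if "x \<le> 0" for x using y(2) z(1)[of "x - real n * C"] that nC by (simp add: w_def)
    show "w x = real (Suc n) * pi" if "real (Suc n) * C \<le> x" for x
      using y(3)[of x] z(2)[of "x - real n * C"] that C by (simp add: w_def algebra_simps)
    show "continuous_on UNIV w"
      unfolding w_def by (intro continuous_intros y continuous_on_compose2[OF z(3)]) auto
    show "(w has_real_derivative \<bar>sin (w x)\<bar> powr e) (at x)" if x: "x \<notin> S'" for x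
    proof -
      consider "x < real n * C" | "real n * C < x" "x < real (Suc n) * C" | "real (Suc n) * C < x"
        using x by (fastforce simp: S'_def)
      then show ?thesis
      proof cases
        case 1
        have "(y has_real_derivative \<bar>sin (y x)\<bar> powr e) (at x)" using x by (intro y) (simp add: S'_def)
        then have "(w has_real_derivative \<bar>sin (y x)\<bar> powr e) (at x)"
          by (rule has_field_derivative_transform_within_open[of _ _ _ "{..<real n * C}"])
             (use 1 z in \<open>auto simp: w_def\<close>)
        then show ?thesis using 1 z(1)[of "x - real n * C"] by (simp add: w_def)
      next
        case 2
        have x': "0 < x - real n * C" "x - real n * C < C" using 2 by (auto simp: algebra_simps)
        have sh: "((\<lambda>x. x - real n * C) has_real_derivative 1) (at x)" by (auto intro!: derivative_eq_intros)
        have "((\<lambda>x. real n * pi + z (x - real n * C)) has_real_derivative sin (z (x - real n * C)) powr e) (at x)"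
          using DERIV_add[OF DERIV_const DERIV_chain2[OF z(5)[OF x'] sh], of "real n * pi"] by simp
        then have "(w has_real_derivative sin (z (x - real n * C)) powr e) (at x)"
          by (rule has_field_derivative_transform_within_open[of _ _ _ "{real n * C<..}"])
             (use 2 y(3) in \<open>simp_all add: w_def\<close>)
        moreover have "w x = real n * pi + z (x - real n * C)" using 2 y(3)[of x] by (simp add: w_def)
        moreover have "sin (z (x - real n * C)) > 0" using z(4)[OF x'] sin_gt_zero by blast
        ultimately show ?thesis by (simp add: abs_sin)
      next
        case 3
        have c: "w t = real (Suc n) * pi" if "real (Suc n) * C < t" for t
          using y(3)[of t] z(2)[of "t - real n * C"] that C by (simp add: w_def algebra_simps)
        have "((\<lambda>x. real (Suc n) * pi) has_real_derivative 0) (at x)" by simp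
        then have "(w has_real_derivative 0) (at x)"
          by (rule has_field_derivative_transform_within_open[of _ _ _ "{real (Suc n) * C<..}"]) (use 3 c in auto)
        moreover have "sin (w x) = 0" unfolding c[OF 3] by (simp only: sin_npi)
        ultimately show ?thesis using e by simp
      qed
    qed
    fix x assume x: "x \<in> {0<..<real (Suc n) * C} - S'"
    show "sin (w x) \<noteq> 0"
    proof (cases "x < real n * C")
      case True
      then have "w x = y x" using z(1)[of "x - real n * C"] by (simp add: w_def)
      then show ?thesis using y(6)[of x] x True by (auto simp: S'_def)
    next
      case False
      then have x': "0 < x - real n * C" "x - real n * C < C" using x by (auto simp: algebra_simps S'_def)
      have "w x = real n * pi + z (x - real n * C)" using False y(3)[of x] by (simp add: w_def)
      moreover have "sin (z (x - real n * C)) > 0" using z(4)[OF x'] sin_gt_zero by blast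
      ultimately show ?thesis using abs_sin[of "z (x - real n * C)"] by auto
    qed
  qed
qed

text \<open>The odd power \<open>sgn u * \<bar>u\<bar> powr a\<close>, written with positive parts
  so that continuity at 0 is immediate for \<open>a > 0\<close>.\<close>

definition signed_powr :: "real \<Rightarrow> real \<Rightarrow> real" where
  "signed_powr a u = max 0 u powr a - max 0 (- u) powr a"

lemma signed_powr_continuous: "a > 0 \<Longrightarrow> continuous_on S (signed_powr a)"
  unfolding signed_powr_def[abs_def]
  by (intro continuous_intros continuous_on_powr' continuous_on_max) auto

lemma signed_powr_mult: "signed_powr a u * \<bar>u\<bar> powr b = signed_powr (a + b) u" if "a > 0"
  using that by (cases "u > 0"; cases "u = 0") (auto simp: signed_powr_def powr_add)

lemma signed_powr_1: "signed_powr 1 u = u"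
  by (simp add: signed_powr_def max_def)

lemma signed_powr_derivative:
  assumes "u \<noteq> 0"
  shows "(signed_powr a has_real_derivative a * \<bar>u\<bar> powr (a - 1)) (at u)"
proof (cases "u > 0")
  case True
  then have "((\<lambda>u. u powr a) has_real_derivative a * \<bar>u\<bar> powr (a - 1)) (at u)"
    using has_real_derivative_powr[of u a] by simp
  then show ?thesis
    by (rule has_field_derivative_transform_within_open[of _ _ _ "{0<..}"])
       (use True in \<open>auto simp: signed_powr_def\<close>)
next
  case False
  then have u: "- u > 0" using assms by simp
  have "((\<lambda>u. - u) has_real_derivative -1) (at u)" by (auto intro!: derivative_eq_intros)
  from DERIV_minus[OF DERIV_chain2[OF has_real_derivative_powr[OF u, of a] this]]
  have "((\<lambda>u. - ((- u) powr a)) has_real_derivative a * \<bar>u\<bar> powr (a - 1)) (at u)"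
    using u by simp
  then show ?thesis
    by (rule has_field_derivative_transform_within_open[of _ _ _ "{..<0}"])
       (use u in \<open>auto simp: signed_powr_def\<close>)
qed

lemma abs_powr_derivative:
  assumes "u \<noteq> 0" "a > 1"
  shows "((\<lambda>u. \<bar>u\<bar> powr a) has_real_derivative a * signed_powr (a - 1) u) (at u)"
proof (cases "u > 0")
  case True
  then have "((\<lambda>u. u powr a) has_real_derivative a * signed_powr (a - 1) u) (at u)"
    using has_real_derivative_powr[of u a] by (simp add: signed_powr_def)
  then show ?thesis
    by (rule has_field_derivative_transform_within_open[of _ _ _ "{0<..}"]) (use True in auto)
next
  case False
  then have u: "- u > 0" using assms by simp
  have "((\<lambda>u. - u) has_real_derivative -1) (at u)" by (auto intro!: derivative_eq_intros)
  from DERIV_chain2[OF has_real_derivative_powr[OF u, of a] this]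
  have "((\<lambda>u. (- u) powr a) has_real_derivative a * signed_powr (a - 1) u) (at u)"
    using u by (simp add: signed_powr_def)
  then show ?thesis
    by (rule has_field_derivative_transform_within_open[of _ _ _ "{..<0}"]) (use u in auto)
qed

text \<open>Both antiderivatives vanish where the sine does. \<open>Q\<close> has derivative
  \<open>\<nu> * ((1 - e) - (2 - e) * (sin (y s))\<^sup>2)\<close>, since the factor
  \<open>\<bar>sin (y s)\<bar> powr e\<close> of the speed restores integer powers; hence the
  squared sine has mean \<open>(1 - e) / (2 - e)\<close>. For \<open>e = 2 / p\<close> the mean of
  \<open>cos (2 * y s)\<close> is then \<open>1 / (p - 1)\<close>, the constant in the hypothesis on
  the endpoints.\<close>

lemma loop_integrals:
  fixes y :: "real \<Rightarrow> real"
  assumes e: "0 < e" "e < 1" and \<nu>: "\<nu> > 0" and ab: "a \<le> b" and S: "finite S"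
    and cy: "continuous_on {a..b} y"
    and dy: "\<And>s. s \<in> {a<..<b} - S \<Longrightarrow> (y has_real_derivative \<nu> * \<bar>sin (y s)\<bar> powr e) (at s)"
    and nz: "\<And>s. s \<in> {a<..<b} - S \<Longrightarrow> sin (y s) \<noteq> 0"
    and ends: "sin (y a) = 0" "sin (y b) = 0"
  shows "((\<lambda>s. (sin (y s))\<^sup>2) has_integral (b - a) * (1 - e) / (2 - e)) {a..b}"
    and "((\<lambda>s. sin (2 * y s)) has_integral 0) {a..b}"
proof -
  define Q where "Q s = cos (y s) * signed_powr (1 - e) (sin (y s))" for s
  have "((\<lambda>s. \<nu> * ((1 - e) - (2 - e) * (sin (y s))\<^sup>2)) has_integral Q b - Q a) {a..b}"
  proof (rule fundamental_theorem_of_calculus_interior_strong[OF S ab])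
    show "continuous_on {a..b} Q"
      unfolding Q_def using e
      by (intro continuous_intros cy continuous_on_compose2[OF signed_powr_continuous[of "1 - e" UNIV]]) auto
    fix s assume s: "s \<in> {a<..<b} - S"
    define u where "u = sin (y s)"
    define c where "c = cos (y s)"
    have u: "u \<noteq> 0" using nz[OF s] by (simp add: u_def)
    have c2: "c * c = 1 - u * u" using sin_cos_squared_add[of "y s"] by (simp add: c_def u_def power2_eq_square)
    have ds: "((\<lambda>s. sin (y s)) has_real_derivative c * (\<nu> * \<bar>u\<bar> powr e)) (at s)"
      unfolding c_def u_def by (rule DERIV_chain2[OF DERIV_sin dy[OF s]])
    have dc: "((\<lambda>s. cos (y s)) has_real_derivative - u * (\<nu> * \<bar>u\<bar> powr e)) (at s)"
      unfolding u_def by (rule DERIV_chain2[OF DERIV_cos dy[OF s]])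
    have "(Q has_real_derivative (- u * (\<nu> * \<bar>u\<bar> powr e)) * signed_powr (1 - e) u
        + ((1 - e) * \<bar>u\<bar> powr (1 - e - 1) * (c * (\<nu> * \<bar>u\<bar> powr e))) * c) (at s)"
      unfolding Q_def c_def u_def
      by (rule DERIV_mult[OF dc[unfolded u_def] DERIV_chain2[OF signed_powr_derivative[OF nz[OF s]] ds[unfolded c_def u_def]]])
    moreover have "(- u * (\<nu> * \<bar>u\<bar> powr e)) * signed_powr (1 - e) u = - \<nu> * u\<^sup>2"
      using signed_powr_mult[of "1 - e" u e] e signed_powr_1[of u] by (simp add: power2_eq_square mult_ac)
    moreover have "((1 - e) * \<bar>u\<bar> powr (1 - e - 1) * (c * (\<nu> * \<bar>u\<bar> powr e))) * c = \<nu> * (1 - e) * (c * c)"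
    proof -
      have "\<bar>u\<bar> powr (1 - e - 1) * \<bar>u\<bar> powr e = 1" using u by (simp add: powr_add[symmetric])
      then have "\<nu> * (1 - e) * (c * c) * (\<bar>u\<bar> powr (1 - e - 1) * \<bar>u\<bar> powr e) = \<nu> * (1 - e) * (c * c)" by (simp only: mult_1_right)
      then show ?thesis by (simp only: mult_ac)
    qed
    ultimately have "(Q has_real_derivative - \<nu> * u\<^sup>2 + \<nu> * (1 - e) * (c * c)) (at s)" by (simp only:)
    moreover have "- \<nu> * u\<^sup>2 + \<nu> * (1 - e) * (c * c) = \<nu> * ((1 - e) - (2 - e) * u\<^sup>2)"
      unfolding c2 by (simp add: power2_eq_square algebra_simps)
    ultimately show "(Q has_vector_derivative \<nu> * ((1 - e) - (2 - e) * (sin (y s))\<^sup>2)) (at s)"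
      by (simp add: has_real_derivative_iff_has_vector_derivative u_def)
  qed
  moreover have "Q a = 0" "Q b = 0" using ends e by (simp_all add: Q_def signed_powr_def)
  ultimately have q: "((\<lambda>s. \<nu> * ((1 - e) - (2 - e) * (sin (y s))\<^sup>2)) has_integral 0) {a..b}" by simp
  have "((\<lambda>s. ((1 - e) - (1 / \<nu>) * (\<nu> * ((1 - e) - (2 - e) * (sin (y s))\<^sup>2))) * (1 / (2 - e))) has_integral
      ((b - a) *\<^sub>R (1 - e) - (1 / \<nu>) * 0) * (1 / (2 - e))) {a..b}"
    using ab has_integral_const_real[of "1 - e" a b]
    by (intro has_integral_mult_left has_integral_diff has_integral_mult_right q) auto
  moreover have "((1 - e) - (1 / \<nu>) * (\<nu> * ((1 - e) - (2 - e) * (sin (y s))\<^sup>2))) * (1 / (2 - e)) = (sin (y s))\<^sup>2" for s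
    using \<nu> e by simp
  ultimately show "((\<lambda>s. (sin (y s))\<^sup>2) has_integral (b - a) * (1 - e) / (2 - e)) {a..b}" by simp
  \<comment> \<open>A power of the sine with derivative \<open>sin (2 * y s)\<close>: a loop has no
    net displacement across its axis.\<close>
  define R where "R s = \<bar>sin (y s)\<bar> powr (2 - e) / (\<nu> * (1 - e / 2))" for s
  have "((\<lambda>s. sin (2 * y s)) has_integral R b - R a) {a..b}"
  proof (rule fundamental_theorem_of_calculus_interior_strong[OF S ab])
    show "continuous_on {a..b} R"
      unfolding R_def using e \<nu> by (intro continuous_intros continuous_on_powr' cy) auto
    fix s assume s: "s \<in> {a<..<b} - S"
    define u where "u = sin (y s)"
    have ds: "((\<lambda>s. sin (y s)) has_real_derivative cos (y s) * (\<nu> * \<bar>u\<bar> powr e)) (at s)"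
      unfolding u_def by (rule DERIV_chain2[OF DERIV_sin dy[OF s]])
    have e2: "2 - e > 1" using e by simp
    have "(R has_real_derivative (2 - e) * signed_powr (2 - e - 1) u * (cos (y s) * (\<nu> * \<bar>u\<bar> powr e)) / (\<nu> * (1 - e / 2))) (at s)"
      unfolding R_def u_def
      by (rule DERIV_cdivide[OF DERIV_chain2[OF abs_powr_derivative[OF nz[OF s] e2] ds[unfolded u_def]]])
    moreover have "(2 - e) * signed_powr (2 - e - 1) u * (cos (y s) * (\<nu> * \<bar>u\<bar> powr e)) = (\<nu> * (1 - e / 2)) * sin (2 * y s)"
    proof -
      have "signed_powr (2 - e - 1) u * \<bar>u\<bar> powr e = u"
        using signed_powr_mult[of "2 - e - 1" u e] e signed_powr_1[of u] by simp
      then have "(2 - e) * (cos (y s) * \<nu>) * (signed_powr (2 - e - 1) u * \<bar>u\<bar> powr e) = (2 - e) * (cos (y s) * \<nu>) * u" by (simp only:)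
      then have "(2 - e) * signed_powr (2 - e - 1) u * (cos (y s) * (\<nu> * \<bar>u\<bar> powr e)) = (2 - e) * (cos (y s) * \<nu>) * u"
        by (simp only: mult_ac)
      also have "\<dots> = \<nu> * (1 - e / 2) * (2 * u * cos (y s))" by (simp add: field_simps)
      finally show ?thesis by (simp add: u_def sin_double)
    qed
    moreover have "\<nu> * (1 - e / 2) \<noteq> 0" using \<nu> e by simp
    ultimately have "(R has_real_derivative sin (2 * y s)) (at s)" by (metis nonzero_mult_div_cancel_left)
    then show "(R has_vector_derivative sin (2 * y s)) (at s)"
      by (simp add: has_real_derivative_iff_has_vector_derivative)
  qed
  moreover have "R a = 0" "R b = 0" using ends e by (simp_all add: R_def)
  ultimately show "((\<lambda>s. sin (2 * y s)) has_integral 0) {a..b}" by simp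
qed

section \<open>Flat-core curves\<close>

text \<open>Scaled so that \<open>n\<close> loops take exactly the length \<open>l\<close>; the
  factor 2 passes from the half angle to the angle.\<close>

definition loop_speed :: "real \<Rightarrow> real \<Rightarrow> nat \<Rightarrow> real" where
  "loop_speed p l n = 2 * real n * loop_time (2 / p) pi / l"

lemma loop_time_pi_pos: "0 < e \<Longrightarrow> e < 1 \<Longrightarrow> 0 < loop_time e pi"
  using loop_time(1,4)[of e] pi_gt_zero by (metis order_refl)

text \<open>The angle is obtained from an existence statement only; as a predicate its properties
  can be assumed of a locale parameter. The loops start at arclength 0 here and are shifted by
  \<open>s0\<close> later.\<close>

definition loops_angle :: "real \<Rightarrow> real \<Rightarrow> nat \<Rightarrow> (real \<Rightarrow> real) \<Rightarrow> real set \<Rightarrow> bool" where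
  "loops_angle p l n \<theta> S \<longleftrightarrow> finite S \<and> (\<forall>s\<le>0. \<theta> s = 0) \<and> (\<forall>s\<ge>l. \<theta> s = 2 * pi * real n) \<and> continuous_on UNIV \<theta> \<and>
    (\<forall>s. s \<notin> S \<longrightarrow> (\<theta> has_real_derivative loop_speed p l n * \<bar>sin (\<theta> s / 2)\<bar> powr (2 / p)) (at s)) \<and>
    (\<forall>s\<in>{0<..<l} - S. sin (\<theta> s / 2) \<noteq> 0)"

lemma loops_angle_exists:
  assumes p: "p > 2" and l: "l > 0" and n: "n \<ge> 1"
  shows "\<exists>\<theta> S. loops_angle p l n \<theta> S"
proof -
  define e where "e = 2 / p"
  have e: "0 < e" "e < 1" using p by (auto simp: e_def)
  define C where "C = loop_time e pi"
  have C: "C > 0" unfolding C_def by (rule loop_time_pi_pos[OF e])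
  define \<nu> where "\<nu> = real n * C / l"
  have \<nu>: "\<nu> > 0" using C l n by (simp add: \<nu>_def)
  obtain y S where y: "finite S" "\<And>x. x \<le> 0 \<Longrightarrow> y x = 0" "\<And>x. x \<ge> real n * C \<Longrightarrow> y x = real n * pi"
    "continuous_on UNIV y" "\<And>x. x \<notin> S \<Longrightarrow> (y has_real_derivative \<bar>sin (y x)\<bar> powr e) (at x)"
    "\<And>x. x \<in> {0<..<real n * C} - S \<Longrightarrow> sin (y x) \<noteq> 0"
    using iterated_loop[OF e, of n] unfolding C_def by blast
  define \<theta> where "\<theta> s = 2 * y (\<nu> * s)" for s
  define S' where "S' = (\<lambda>x. x / \<nu>) ` S"
  have S': "\<nu> * s \<notin> S" if "s \<notin> S'" for s
  proof
    assume "\<nu> * s \<in> S"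
    then have "\<nu> * s / \<nu> \<in> S'" unfolding S'_def by (rule imageI)
    then show False using that \<nu> by simp
  qed
  have \<nu>l: "\<nu> * l = real n * C" using l by (simp add: \<nu>_def)
  show ?thesis
    unfolding loops_angle_def
  proof (intro exI[of _ \<theta>] exI[of _ S'] conjI allI impI ballI)
    show "finite S'" using y by (simp add: S'_def)
    show "\<theta> s = 0" if "s \<le> 0" for s using y(2)[of "\<nu> * s"] \<nu> that by (simp add: \<theta>_def mult_nonneg_nonpos)
    show "\<theta> s = 2 * pi * real n" if "l \<le> s" for s
      using y(3)[of "\<nu> * s"] mult_left_mono[OF that, of \<nu>] \<nu> \<nu>l by (simp add: \<theta>_def)
    show "continuous_on UNIV \<theta>"
      unfolding \<theta>_def by (intro continuous_intros continuous_on_compose2[OF y(4)]) auto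
    show "(\<theta> has_real_derivative loop_speed p l n * \<bar>sin (\<theta> s / 2)\<bar> powr (2 / p)) (at s)" if s: "s \<notin> S'" for s
    proof -
      have "((\<lambda>s. \<nu> * s) has_real_derivative \<nu>) (at s)" by (auto intro!: derivative_eq_intros)
      from DERIV_cmult[OF DERIV_chain2[OF y(5)[OF S'[OF s]] this], of 2]
      have "(\<theta> has_real_derivative 2 * (\<bar>sin (y (\<nu> * s))\<bar> powr e * \<nu>)) (at s)" by (simp add: \<theta>_def[abs_def])
      moreover have "2 * (\<bar>sin (y (\<nu> * s))\<bar> powr e * \<nu>) = loop_speed p l n * \<bar>sin (\<theta> s / 2)\<bar> powr (2 / p)"
        by (simp add: \<theta>_def loop_speed_def \<nu>_def C_def e_def)
      ultimately show ?thesis by simp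
    qed
    show "sin (\<theta> s / 2) \<noteq> 0" if "s \<in> {0<..<l} - S'" for s
    proof -
      have "\<nu> * s < real n * C" using that \<nu> mult_strict_left_mono[of s l \<nu>] \<nu>l by simp
      then show ?thesis using y(6)[of "\<nu> * s"] S'[of s] that \<nu> by (simp add: \<theta>_def)
    qed
  qed
qed

lemma integral_nth:
  fixes f :: "real \<Rightarrow> real^2"
  assumes "f integrable_on A"
  shows "integral A f $ i = integral A (\<lambda>x. f x $ i)"
  using integral_linear[OF assms bounded_linear_vec_nth[of i]] by (simp add: o_def)

text \<open>The assumption named \<open>D\<close> says that the displacement \<open>L - l\<close> of
  the segments and the displacement \<open>l / (p - 1)\<close> of the loops add up to the prescribed
  \<open>D\<close>.\<close>

locale flat_core =
  fixes p L D \<alpha> l s0 :: real and n :: nat and \<theta> :: "real \<Rightarrow> real" and S :: "real set" and P0 P1 :: "real^2"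
  assumes p: "p > 2" and L: "L > 0" and l: "l > 0" and n: "n \<ge> 1" and s0: "0 < s0" "s0 + l < L"
    and D: "l * (p - 2) = (L - D) * (p - 1)" and P1: "P1 = P0 + D *\<^sub>R direction \<alpha>"
    and loops: "loops_angle p l n \<theta> S"
begin

lemma S: "finite S"
  and \<theta>0: "s \<le> 0 \<Longrightarrow> \<theta> s = 0" and \<theta>1: "s \<ge> l \<Longrightarrow> \<theta> s = 2 * pi * real n"
  and \<theta>c: "continuous_on UNIV \<theta>"
  and \<theta>d: "s \<notin> S \<Longrightarrow> (\<theta> has_real_derivative loop_speed p l n * \<bar>sin (\<theta> s / 2)\<bar> powr (2 / p)) (at s)"
  and \<theta>nz: "s \<in> {0<..<l} - S \<Longrightarrow> sin (\<theta> s / 2) \<noteq> 0"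
  using loops unfolding loops_angle_def by blast+

definition "\<mu> = loop_speed p l n"

definition v :: "real \<Rightarrow> real" where "v x = \<mu> * \<bar>sin (x / 2)\<bar> powr (2 / p)"

definition angle :: "real \<Rightarrow> real" where "angle s = \<theta> (s - s0)"

definition tangent :: "real \<Rightarrow> real^2" where "tangent s = direction (\<alpha> + angle s)"

text \<open>\<open>restrict\<close> because elements of \<open>W2p\<close> are extensional.\<close>

definition curve :: "real \<Rightarrow> real^2" where
  "curve = restrict (\<lambda>s. P0 + integral {0..s} tangent) {0..L}"

text \<open>The angular speed is written as \<open>v (angle s)\<close>, which is continuous also at
  the joints, where the derivative of the angle has not been computed.\<close>

definition curve'' :: "real \<Rightarrow> real^2" where
  "curve'' s = v (angle s) *\<^sub>R (\<chi> i. if i = 1 then - sin (\<alpha> + angle s) else cos (\<alpha> + angle s))"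

lemma \<mu>_pos: "\<mu> > 0"
  using p l n loop_time_pi_pos[of "2 / p"] by (simp add: \<mu>_def loop_speed_def)

lemma v_nonneg: "0 \<le> v x"
  using \<mu>_pos by (simp add: v_def)

lemma v_cont: "continuous_on A v"
  unfolding v_def[abs_def] using p by (intro continuous_intros continuous_on_powr') auto

text \<open>The reason for the exponent \<open>2 / p\<close>: \<open>v x powr p\<close> is a
  multiple of \<open>1 - cos x\<close>, so its integral along a competitor is fixed by the
  displacement. Up to a factor, \<open>\<mu> powr p\<close> is the Lagrange multiplier of that
  constraint.\<close>

lemma v_powr: "v x powr p = \<mu> powr p * (sin (x / 2))\<^sup>2"
proof -
  have "(\<bar>sin (x / 2)\<bar> powr (2 / p)) powr p = \<bar>sin (x / 2)\<bar> powr 2" using p by (simp add: powr_powr)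
  then show ?thesis using \<mu>_pos by (simp add: v_def powr_mult)
qed

lemma angle_cont: "continuous_on A angle"
  unfolding angle_def by (rule continuous_on_compose2[OF \<theta>c]) (auto intro!: continuous_intros)

lemma angle_derivative:
  assumes "s - s0 \<notin> S"
  shows "(angle has_real_derivative v (angle s)) (at s)"
proof -
  have "((\<lambda>s. s - s0) has_real_derivative 1) (at s)" by (auto intro!: derivative_eq_intros)
  from DERIV_chain2[OF \<theta>d[OF assms] this] show ?thesis by (simp add: angle_def[abs_def] v_def \<mu>_def)
qed

lemma angle_primitive: "primitive_on 0 L angle (\<lambda>s. v (angle s))"
proof (rule primitive_on_has_vector_derivative)
  show "finite ((\<lambda>x. x + s0) ` S)" using S by simp
  show "continuous_on {0..L} (\<lambda>s. v (angle s))"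
    by (rule continuous_on_compose2[OF v_cont[of UNIV] angle_cont]) auto
  fix x assume "x \<in> {0<..<L} - (\<lambda>x. x + s0) ` S"
  then have "x - s0 \<notin> S" by (metis DiffD2 diff_add_cancel imageI)
  then show "(angle has_vector_derivative v (angle x)) (at x)"
    using angle_derivative by (simp add: has_real_derivative_iff_has_vector_derivative)
qed (rule angle_cont)

lemma angle_outside: "s \<le> s0 \<Longrightarrow> angle s = 0" "s \<ge> s0 + l \<Longrightarrow> angle s = 2 * pi * real n"
  using \<theta>0[of "s - s0"] \<theta>1[of "s - s0"] by (auto simp: angle_def)

lemma sin_angle_outside: "s \<notin> {s0..s0 + l} \<Longrightarrow> sin (angle s / 2) = 0" "s \<notin> {s0..s0 + l} \<Longrightarrow> sin (angle s) = 0"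
proof -
  assume "s \<notin> {s0..s0 + l}"
  then consider "s \<le> s0" | "s \<ge> s0 + l" by fastforce
  then have "sin (angle s / 2) = 0 \<and> sin (angle s) = 0"
  proof cases
    case 2
    have "sin (angle s / 2) = sin (real n * pi)" using angle_outside(2)[OF 2] by (simp add: mult.commute)
    moreover have "sin (angle s) = sin (real (2 * n) * pi)" using angle_outside(2)[OF 2] by (simp add: mult_ac)
    ultimately show ?thesis by (simp only: sin_npi simp_thms)
  qed (simp add: angle_outside)
  then show "sin (angle s / 2) = 0" "sin (angle s) = 0" by auto
qed

text \<open>The half angle satisfies the equation of \<open>loop_integrals\<close> with speed
  \<open>\<mu> / 2\<close> on \<open>{s0..s0 + l}\<close>, and both integrands vanish on the
  segments. The locale assumption on \<open>l\<close> turns the mean of the squared sine into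
  \<open>(L - D) / 2\<close>.\<close>

lemma angle_integrals:
  "((\<lambda>s. (sin (angle s / 2))\<^sup>2) has_integral (L - D) / 2) {0..L}"
  "((\<lambda>s. sin (angle s)) has_integral 0) {0..L}"
proof -
  have e: "0 < 2 / p" "2 / p < 1" using p by auto
  have \<nu>: "\<mu> / 2 > 0" using \<mu>_pos by simp
  have d: "((\<lambda>s. angle s / 2) has_real_derivative \<mu> / 2 * \<bar>sin (angle s / 2)\<bar> powr (2 / p)) (at s)"
    if "s \<in> {s0<..<s0 + l} - (\<lambda>x. x + s0) ` S" for s
  proof -
    have "s - s0 \<notin> S" using that by (metis DiffD2 diff_add_cancel imageI)
    from DERIV_cdivide[OF angle_derivative[OF this], of 2] show ?thesis by (simp add: v_def)
  qed
  have nz: "sin (angle s / 2) \<noteq> 0" if "s \<in> {s0<..<s0 + l} - (\<lambda>x. x + s0) ` S" for s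
  proof -
    have "s - s0 \<notin> S" using that by (metis DiffD2 diff_add_cancel imageI)
    then show ?thesis using \<theta>nz[of "s - s0"] that by (auto simp: angle_def)
  qed
  have ends: "sin (angle s0 / 2) = 0" "sin (angle (s0 + l) / 2) = 0"
  proof -
    show "sin (angle s0 / 2) = 0" by (simp add: angle_outside)
    have "sin (angle (s0 + l) / 2) = sin (real n * pi)" using angle_outside(2)[of "s0 + l"] by (simp add: mult.commute)
    then show "sin (angle (s0 + l) / 2) = 0" by (simp only: sin_npi)
  qed
  have c: "continuous_on {s0..s0 + l} (\<lambda>s. angle s / 2)" by (intro continuous_intros angle_cont) auto
  have fin: "finite ((\<lambda>x. x + s0) ` S)" using S by simp
  note I = loop_integrals[OF e \<nu> _ fin c d nz ends]
  have "(1 - 2 / p) / (2 - 2 / p) = (p - 2) / (2 * (p - 1))" using p by (simp add: field_simps)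
  then have "(s0 + l - s0) * (1 - 2 / p) / (2 - 2 / p) = l * (p - 2) / (2 * (p - 1))"
    by (metis add_diff_cancel_left' times_divide_eq_right)
  also have "\<dots> = (L - D) / 2" unfolding D
    by (rule mult_divide_mult_cancel_right) (use p in simp)
  finally have val: "(s0 + l - s0) * (1 - 2 / p) / (2 - 2 / p) = (L - D) / 2" .
  have sub: "{s0..s0 + l} \<subseteq> {0..L}" using s0 by auto
  have "((\<lambda>s. (sin (angle s / 2))\<^sup>2) has_integral (L - D) / 2) {s0..s0 + l}"
    using I(1) l unfolding val by simp
  then show "((\<lambda>s. (sin (angle s / 2))\<^sup>2) has_integral (L - D) / 2) {0..L}"
    by (rule has_integral_on_superset[OF _ _ sub]) (use sin_angle_outside in auto)
  have "((\<lambda>s. sin (angle s)) has_integral 0) {s0..s0 + l}" using I(2) l by simp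
  then show "((\<lambda>s. sin (angle s)) has_integral 0) {0..L}"
    by (rule has_integral_on_superset[OF _ _ sub]) (use sin_angle_outside in auto)
qed

lemma cos_angle_integral: "((\<lambda>s. cos (angle s)) has_integral D) {0..L}"
proof -
  have c: "1 - 2 * (sin (angle s / 2))\<^sup>2 = cos (angle s)" for s
    using cos_double_sin[of "angle s / 2"] by simp
  have "((\<lambda>s. 1 - 2 * (sin (angle s / 2))\<^sup>2) has_integral L *\<^sub>R 1 - 2 * ((L - D) / 2)) {0..L}"
    using L has_integral_const_real[of "1::real" 0 L]
    by (intro has_integral_diff has_integral_mult_right angle_integrals) auto
  moreover have "L *\<^sub>R 1 - 2 * ((L - D) / 2) = D" by (simp add: field_simps)
  ultimately show ?thesis unfolding c by (simp only:)
qed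

section \<open>Admissibility and energy of the flat-core curve\<close>

lemma tangent_primitive: "primitive_on 0 L tangent curve''"
  unfolding tangent_def curve''_def by (rule primitive_on_direction[OF angle_primitive])

lemma tangent_cont: "continuous_on {0..L} tangent"
  by (rule primitive_on_continuous[OF tangent_primitive])

lemma curve_primitive: "primitive_on 0 L curve tangent"
proof -
  have "primitive_on 0 L (\<lambda>s. P0 + integral {0..s} tangent) tangent"
    using absolutely_integrable_continuous_real[OF tangent_cont] by (simp add: primitive_on_def)
  then show ?thesis by (rule primitive_on_cong) (auto simp: curve_def)
qed

lemma curve_lift: "arclength_lift p L curve tangent curve''"
proof -
  have "continuous_on {0..L} curve''"
  proof -
    have cs: "continuous_on {0..L} (\<lambda>s. v (angle s))"
      by (rule continuous_on_compose2[OF v_cont[of UNIV] angle_cont]) auto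
    have "continuous_on {0..L} (\<lambda>s. \<chi> i::2. if i = 1 then - sin (\<alpha> + angle s) else cos (\<alpha> + angle s))"
    proof (rule continuous_on_vec_lambda)
      show "continuous_on {0..L} (\<lambda>s. if i = 1 then - sin (\<alpha> + angle s) else cos (\<alpha> + angle s))" for i :: 2
        by (cases "i = 1") (auto intro!: continuous_intros angle_cont)
    qed
    then show ?thesis unfolding curve''_def[abs_def] by (rule continuous_on_scaleR[OF cs])
  qed
  then show ?thesis
    using curve_primitive tangent_primitive continuous_in_Lp[of L curve'' p] p
    by (simp add: arclength_lift_def tangent_def)
qed

lemma curve_in_A_pin: "curve \<in> A_pin p P0 P1 L"
proof -
  have ti: "tangent integrable_on {0..L}" using tangent_cont by (rule integrable_continuous_real)
  have "integral {0..L} tangent = D *\<^sub>R direction \<alpha>"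
  proof -
    \<comment> \<open>In the frame turned by \<alpha> the displacement is \<open>D\<close> along the
      axis and 0 across it; rotating back gives the two coordinates.\<close>
    have "((\<lambda>s. cos \<alpha> * cos (angle s) - sin \<alpha> * sin (angle s)) has_integral cos \<alpha> * D - sin \<alpha> * 0) {0..L}"
      by (intro has_integral_diff has_integral_mult_right cos_angle_integral angle_integrals)
    moreover have "((\<lambda>s. sin \<alpha> * cos (angle s) + cos \<alpha> * sin (angle s)) has_integral sin \<alpha> * D + cos \<alpha> * 0) {0..L}"
      by (intro has_integral_add has_integral_mult_right cos_angle_integral angle_integrals)
    ultimately show ?thesis
      by (simp add: vec_eq_iff forall_2 integral_nth[OF ti] tangent_def cos_add sin_add integral_unique mult.commute)
  qed
  then have "curve L = P1" "curve 0 = P0" using L by (auto simp: curve_def P1)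
  moreover have "curve \<in> W2p_arc p L"
    by (rule arclength_lift_W2p_arc[OF curve_lift]) (use p L in \<open>auto simp: curve_def\<close>)
  ultimately show ?thesis by (simp add: A_pin_def)
qed

lemma curve_curvature: "tangent s $ 1 * curve'' s $ 2 - tangent s $ 2 * curve'' s $ 1 = v (angle s)"
proof -
  have "c * (k * c) - s * (k * - s) = k * (s * s + c * c)" for c s k :: real by (simp add: algebra_simps)
  then show ?thesis
    using sin_cos_squared_add[of "\<alpha> + angle s"] by (simp add: tangent_def curve''_def power2_eq_square)
qed

lemma v_powr_integrable: "(\<lambda>s. \<bar>v (angle s)\<bar> powr p) absolutely_integrable_on {0..L}"
  using curvature_Lp[OF curve_lift] p curve_curvature by simp

lemma curve_energy_eq_integral: "bending_energy p L curve = integral {0..L} (\<lambda>s. \<bar>v (angle s)\<bar> powr p)"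
proof -
  have "bending_energy p L curve = (LINT x|lebesgue_on {0<..<L}. \<bar>v (angle x)\<bar> powr p)"
    by (rule arclength_lift_energy[OF curve_lift L]) (simp add: curve_curvature)
  then show ?thesis using lebesgue_integral_Ioo_eq_Icc(2)[OF v_powr_integrable] by simp
qed

text \<open>The value does not depend on \<open>s0\<close>; it is unbounded in \<open>n\<close>
  because \<open>\<mu>\<close> is linear in \<open>n\<close>.\<close>

lemma curve_energy: "bending_energy p L curve = \<mu> powr p * ((L - D) / 2)"
proof -
  have "((\<lambda>s. \<mu> powr p * (sin (angle s / 2))\<^sup>2) has_integral \<mu> powr p * ((L - D) / 2)) {0..L}"
    by (intro has_integral_mult_right angle_integrals)
  moreover have "(\<lambda>s. \<bar>v (angle s)\<bar> powr p) = (\<lambda>s. \<mu> powr p * (sin (angle s / 2))\<^sup>2)"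
    by (simp add: fun_eq_iff v_nonneg v_powr)
  ultimately show ?thesis unfolding curve_energy_eq_integral by (simp only: integral_unique)
qed

text \<open>Detects from the tangent that a point is not inside a loop; this tells curves with
  different \<open>s0\<close> apart.\<close>

lemma tangent_eq_iff_sin: "tangent s = direction \<alpha> \<Longrightarrow> sin (angle s / 2) = 0"
proof -
  assume "tangent s = direction \<alpha>"
  then have "cos (\<alpha> + angle s) = cos \<alpha>" "sin (\<alpha> + angle s) = sin \<alpha>"
    by (auto simp: tangent_def vec_eq_iff forall_2)
  then have "cos ((\<alpha> + angle s) - \<alpha>) = cos \<alpha> * cos \<alpha> + sin \<alpha> * sin \<alpha>" unfolding cos_diff by simp
  then have "cos (angle s) = 1" using sin_cos_squared_add[of \<alpha>] by (simp add: power2_eq_square)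
  then show "sin (angle s / 2) = 0" using cos_double_sin[of "angle s / 2"] by simp
qed

text \<open>Along the flat-core curve Young's inequality is an equality, so its density integrates
  to exactly \<open>G \<Theta>\<close>; for a nearby competitor \<open>total_bound\<close> gives at
  least \<open>G \<Theta>\<close>. The potential parts of the two integrals coincide by the
  displacement constraint and cancel.\<close>

lemma curve_local_minimizer: "local_minimizer p P0 P1 L curve"
proof -
  define e where "e = 2 / p"
  have e: "0 < e" "e < 1" using p by (auto simp: e_def)
  \<comment> \<open>The largest value for which \<open>p * B\<close> is at most
    \<open>(p - 2) / 2\<close> times the length of either end segment, as \<open>total_bound\<close>
    demands.\<close>
  define B where "B = (p - 2) / (2 * p) * min s0 (L - (s0 + l))"
  have B: "B > 0" using p s0 by (simp add: B_def)
  \<comment> \<open>The time to reach the angle \<open>x\<close>, rescaled from the half-angle time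
    so that its derivative is \<open>1 / v x\<close>.\<close>
  define \<Psi> where "\<Psi> x = loop_time e (x / 2) * (2 / \<mu>)" for x
  note H = loop_time[OF e]
  \<comment> \<open>\<open>loop_time e\<close> is continuous with value 0 at 0, so
    \<open>\<Psi>\<close> stays below \<open>B\<close> near 0. The bound 1 keeps \<delta> below
    \<open>pi / 2\<close>, where \<open>v\<close> is increasing and the angle lift is
    available.\<close>
  obtain \<delta> where \<delta>: "0 < \<delta>" "\<delta> \<le> 1" "\<And>x. 0 < x \<Longrightarrow> x < \<delta> \<Longrightarrow> \<Psi> x \<le> B"
  proof -
    have "continuous (at 0 within {0..pi}) (loop_time e)" using H(2) by (simp add: continuous_on_eq_continuous_within)
    moreover have "B * \<mu> / 2 > 0" using B \<mu>_pos by simp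
    ultimately obtain d where d: "d > 0" "\<And>x. x \<in> {0..pi} \<Longrightarrow> dist x 0 < d \<Longrightarrow> dist (loop_time e x) (loop_time e 0) < B * \<mu> / 2"
      unfolding continuous_within_eps_delta by blast
    show thesis
    proof (rule that[of "min d 1"])
      show "0 < min d 1" using d by simp
      fix x assume x: "0 < x" "x < min d 1"
      have "dist (loop_time e (x / 2)) (loop_time e 0) < B * \<mu> / 2"
        by (rule d(2)) (use x pi_gt3 in \<open>auto simp: dist_real_def\<close>)
      then have "loop_time e (x / 2) < B * \<mu> / 2" using H(1) by (simp add: dist_real_def)
      then show "\<Psi> x \<le> B" using \<mu>_pos by (simp add: \<Psi>_def field_simps)
    qed simp
  qed
  have \<delta>2: "\<delta> < pi / 2" using \<delta> pi_gt3 by linarith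
  have v_pos: "0 < v x" if "0 < x" "x < \<delta>" for x
    using that \<delta>2 \<mu>_pos sin_gt_zero[of "x / 2"] by (simp add: v_def)
  have v_mono: "v x \<le> v y" if "0 < x" "x \<le> y" "y < \<delta>" for x y
  proof -
    have "sin (x / 2) \<le> sin (y / 2)" "0 \<le> sin (x / 2)"
      using that \<delta>2 sin_monotone_2pi_le[of "x / 2" "y / 2"] sin_ge_zero[of "x / 2"] by auto
    then show ?thesis using \<mu>_pos p by (auto simp: v_def intro!: mult_left_mono powr_mono2)
  qed
  have \<Psi>: "(\<Psi> has_real_derivative 1 / v x) (at x)" if x: "0 < x" "x < \<delta>" for x
  proof -
    have "0 < x / 2" "x / 2 < pi" using x \<delta>2 by auto
    note dH = H(3)[OF this]
    have "((\<lambda>x. x / 2) has_real_derivative 1 / 2) (at x)" by (auto intro!: derivative_eq_intros)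
    from DERIV_cmult_right[OF DERIV_chain2[OF dH this], of "2 / \<mu>"]
    have "(\<Psi> has_real_derivative 1 / sin (x / 2) powr e * (1 / 2) * (2 / \<mu>)) (at x)" by (simp add: \<Psi>_def[abs_def])
    moreover have "sin (x / 2) > 0" using x \<delta>2 by (intro sin_gt_zero) auto
    ultimately show ?thesis by (simp add: v_def e_def mult.commute)
  qed
  have \<Psi>c: "continuous_on {0..<\<delta>} \<Psi>"
    unfolding \<Psi>_def using \<delta>2 \<mu>_pos
    by (intro continuous_intros continuous_on_compose2[OF H(2)]) auto
  have \<Psi>0: "\<Psi> 0 = 0" using H(1) by (simp add: \<Psi>_def)
  obtain G0 where G0: "\<And>x. (G0 has_vector_derivative p * v x powr (p - 1)) (at x)"
  proof -
    have cont: "continuous_on UNIV (\<lambda>x. p * v x powr (p - 1))"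
      using p v_nonneg by (intro continuous_intros continuous_on_powr' v_cont) auto
    have "\<exists>F. \<forall>x :: real. - \<infinity> < ereal x \<longrightarrow> ereal x < \<infinity> \<longrightarrow> (F has_vector_derivative p * v x powr (p - 1)) (at x)"
      by (rule einterval_antiderivative) (use cont in \<open>auto simp: continuous_on_eq_continuous_at\<close>)
    then show thesis using that by auto
  qed
  define G where "G x = G0 x - G0 0" for x
  have dG: "(G has_real_derivative p * v x powr (p - 1)) (at x)" for x
    using DERIV_diff[OF G0[folded has_real_derivative_iff_has_vector_derivative] DERIV_const]
    by (simp add: G_def[abs_def])
  interpret lb: lower_bound p v G
    by unfold_locales (use p v_cont v_nonneg dG in auto)
  define \<Theta> where "\<Theta> = 2 * pi * real n"
  have ang_prim: "primitive_on 0 L (\<lambda>s. G (angle s)) (\<lambda>s. p * v (angle s) powr (p - 1) * v (angle s))"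
  proof (rule primitive_on_chain[OF angle_primitive dG])
    show "continuous_on (angle ` {0..L}) (\<lambda>y. p * v y powr (p - 1))"
      using p v_nonneg by (intro continuous_intros continuous_on_powr' v_cont) auto
  qed
  have dens: "integral {0..L} (lb.density angle (\<lambda>s. v (angle s))) = G \<Theta>"
  proof -
    have "p * v (angle s) powr (p - 1) * v (angle s) = lb.density angle (\<lambda>s. v (angle s)) s" for s
    proof -
      have "v (angle s) powr (p - 1) * v (angle s) = v (angle s) powr p"
        using p v_nonneg[of "angle s"] by (cases "v (angle s) = 0") (auto simp: powr_diff)
      then show ?thesis using v_nonneg by (simp add: lb.density_def algebra_simps)
    qed
    then have "integral {0..L} (lb.density angle (\<lambda>s. v (angle s))) = G (angle L) - G (angle 0)"
      using primitive_on_diff[OF ang_prim, of 0 L] L by simp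
    then show ?thesis using angle_outside(1)[of 0] angle_outside(2)[of L] s0 by (simp add: \<Theta>_def G_def)
  qed
  \<comment> \<open>The constraint enters here: \<open>(sin (\<phi> s / 2))\<^sup>2\<close> is
    \<open>(1 - cos (\<phi> s)) / 2\<close>, whose integral is prescribed by
    \<open>D\<close>.\<close>
  have split: "integral {0..L} (lb.density \<phi> k) = integral {0..L} (\<lambda>s. \<bar>k s\<bar> powr p) + (p - 1) * \<mu> powr p * ((L - D) / 2)"
    if P: "primitive_on 0 L \<phi> k" and k: "(\<lambda>s. \<bar>k s\<bar> powr p) absolutely_integrable_on {0..L}"
      and c: "((\<lambda>s. cos (\<phi> s)) has_integral D) {0..L}" for \<phi> k
  proof -
    have "1 / 2 * (1 - cos (\<phi> s)) = (sin (\<phi> s / 2))\<^sup>2" for s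
      using cos_double_sin[of "\<phi> s / 2"] by simp
    moreover have "((\<lambda>s. 1 / 2 * (1 - cos (\<phi> s))) has_integral 1 / 2 * (L *\<^sub>R 1 - D)) {0..L}"
      using L has_integral_const_real[of "1::real" 0 L]
      by (intro has_integral_mult_right has_integral_diff c) auto
    ultimately have "((\<lambda>s. (sin (\<phi> s / 2))\<^sup>2) has_integral (L - D) / 2) {0..L}" by simp
    from has_integral_mult_right[OF this, of "(p - 1) * \<mu> powr p"]
    have q: "((\<lambda>s. (p - 1) * v (\<phi> s) powr p) has_integral (p - 1) * \<mu> powr p * ((L - D) / 2)) {0..L}"
      by (simp add: v_powr mult.assoc)
    have "((\<lambda>s. \<bar>k s\<bar> powr p) has_integral integral {0..L} (\<lambda>s. \<bar>k s\<bar> powr p)) {0..L}"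
      using k by (auto simp: absolutely_integrable_on_def)
    from has_integral_add[OF this q] show ?thesis unfolding lb.density_def[abs_def] by (simp add: integral_unique)
  qed
  have "sin \<delta> > 0" using \<delta> \<delta>2 by (intro sin_gt_zero) auto
  moreover have p1: "p \<ge> 1" using p by simp
  ultimately obtain \<epsilon> where \<epsilon>: "\<epsilon> > 0" "\<forall>\<eta> \<gamma> T K T' K'. arclength_lift p L \<eta> T K \<longrightarrow> arclength_lift p L \<gamma> T' K' \<longrightarrow>
     W2p_dist p L \<eta> \<gamma> < \<epsilon> \<longrightarrow> (\<forall>x\<in>{0..L}. norm (T x - T' x) < sin \<delta>)"
    using W2p_close_imp_tangents_close[OF L p1, of "sin \<delta>"] by blast
  have "bending_energy p L curve \<le> bending_energy p L \<eta>"
    if \<eta>: "\<eta> \<in> A_pin p P0 P1 L" and close: "W2p_dist p L \<eta> curve < \<epsilon>" for \<eta>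
  proof -
    have \<eta>': "\<eta> \<in> W2p_arc p L" "\<eta> 0 = P0" "\<eta> L = P1" using \<eta> by (auto simp: A_pin_def)
    obtain T K where lift: "arclength_lift p L \<eta> T K" by (rule W2p_arc_lift[OF \<eta>'(1) p1 L])
    have T: "primitive_on 0 L T K" "\<And>x. x \<in> {0..L} \<Longrightarrow> norm (T x) = 1" "primitive_on 0 L \<eta> T"
      using lift by (auto simp: arclength_lift_def)
    have near: "norm (T x - direction (\<alpha> + angle x)) < sin \<delta>" if "x \<in> {0..L}" for x
      using \<epsilon>(2) lift curve_lift close that unfolding tangent_def by blast
    obtain \<phi> \<kappa> where \<phi>: "primitive_on 0 L \<phi> \<kappa>" "\<And>x. x \<in> {0..L} \<Longrightarrow> T x = direction (\<alpha> + \<phi> x)"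
      "\<And>x. x \<in> {0..L} \<Longrightarrow> \<bar>\<phi> x - angle x\<bar> < \<delta>"
      "AE x in lebesgue_on {0<..<L}. T x $ 1 * K x $ 2 - T x $ 2 * K x $ 1 = \<kappa> x"
      using angle_lift_near[OF T(1,2) L angle_primitive \<delta>(1) \<delta>2 near] by blast
    have \<kappa>: "(\<lambda>x. \<bar>\<kappa> x\<bar> powr p) absolutely_integrable_on {0..L}" by (rule curvature_Lp[OF lift p1 \<phi>(4)])
    have en: "bending_energy p L \<eta> = integral {0..L} (\<lambda>s. \<bar>\<kappa> s\<bar> powr p)"
      using arclength_lift_energy[OF lift L \<phi>(4)] lebesgue_integral_Ioo_eq_Icc(2)[OF \<kappa>] by simp
    \<comment> \<open>\<open>cos (\<phi> s)\<close> is the component of \<open>T s\<close> along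
      \<open>direction \<alpha>\<close>, so it integrates to that component of
      \<open>P1 - P0\<close>.\<close>
    have c: "((\<lambda>s. cos (\<phi> s)) has_integral D) {0..L}"
    proof -
      have ti: "T integrable_on {0..L}"
        using T(1) by (intro integrable_continuous_real primitive_on_continuous)
      have "integral {0..L} T = D *\<^sub>R direction \<alpha>"
        using primitive_on_diff[OF T(3), of 0 L] L \<eta>' by (simp add: P1)
      then have "(T has_integral D *\<^sub>R direction \<alpha>) {0..L}" using ti by (metis integrable_integral)
      from has_integral_linear[OF this bounded_linear_vec_nth]
      have "((\<lambda>s. T s $ i) has_integral (D *\<^sub>R direction \<alpha>) $ i) {0..L}" for i
        by (simp only: o_def)
      note this[of 1] this[of 2]
      then have "((\<lambda>s. cos \<alpha> * T s $ 1 + sin \<alpha> * T s $ 2) has_integral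
          cos \<alpha> * (D *\<^sub>R direction \<alpha>) $ 1 + sin \<alpha> * (D *\<^sub>R direction \<alpha>) $ 2) {0..L}"
        by (intro has_integral_add has_integral_mult_right)
      moreover have "cos \<alpha> * (D *\<^sub>R direction \<alpha>) $ 1 + sin \<alpha> * (D *\<^sub>R direction \<alpha>) $ 2 = D"
      proof -
        have "cos \<alpha> * (D * cos \<alpha>) + sin \<alpha> * (D * sin \<alpha>) = D * ((cos \<alpha>)\<^sup>2 + (sin \<alpha>)\<^sup>2)"
          by (simp only: power2_eq_square distrib_left mult_ac)
        then show ?thesis by simp
      qed
      moreover have "cos \<alpha> * T s $ 1 + sin \<alpha> * T s $ 2 = cos (\<phi> s)" if "s \<in> {0..L}" for s
        using \<phi>(2)[OF that] cos_diff[of "\<alpha> + \<phi> s" \<alpha>] by (simp add: mult.commute)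
      ultimately show ?thesis using has_integral_cong[of "{0..L}" "\<lambda>s. cos \<alpha> * T s $ 1 + sin \<alpha> * T s $ 2" "\<lambda>s. cos (\<phi> s)"] by simp
    qed
    have "G \<Theta> \<le> integral {0..L} (lb.density \<phi> \<kappa>)"
    proof (rule lb.total_bound[OF \<phi>(1) \<kappa> s0(1) _ s0(2) _ _ v_pos v_mono \<Psi> \<Psi>c \<Psi>0 \<delta>(3)])
      show "s0 \<le> s0 + l" using l by simp
      show "G 0 = 0" by (simp add: G_def)
      show "v (\<Theta> - x) = v x" for x
      proof -
        have "(\<Theta> - x) / 2 = real n * pi - x / 2" by (simp add: \<Theta>_def field_simps)
        then have "\<bar>sin ((\<Theta> - x) / 2)\<bar> = \<bar>sin (real n * pi - x / 2)\<bar>" by (simp only:)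
        also have "\<dots> = \<bar>sin (x / 2)\<bar>" by (simp add: sin_diff abs_mult)
        finally have "\<bar>sin ((\<Theta> - x) / 2)\<bar> = \<bar>sin (x / 2)\<bar>" .
        then show ?thesis by (simp add: v_def)
      qed
      have "p * B = (p - 2) / 2 * min s0 (L - (s0 + l))" using p by (simp add: B_def)
      then show "p * B \<le> (p - 2) / 2 * s0" "p * B \<le> (p - 2) / 2 * (L - (s0 + l))"
        using p by (auto intro!: mult_left_mono)
      show "\<phi> s < \<delta>" if "s \<in> {0..s0}" for s using \<phi>(3)[of s] angle_outside(1)[of s] that s0 l by auto
      show "\<Theta> - \<delta> < \<phi> s" if "s \<in> {s0 + l..L}" for s
        using \<phi>(3)[of s] angle_outside(2)[of s] that s0 l by (auto simp: \<Theta>_def)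
    qed auto
    then show ?thesis
      using split[OF \<phi>(1) \<kappa> c] split[OF angle_primitive v_powr_integrable cos_angle_integral] dens
      unfolding en curve_energy_eq_integral by linarith
  qed
  then show ?thesis unfolding local_minimizer_def using curve_in_A_pin \<epsilon>(1) by blast
qed

end

theorem theorem1p2:
  fixes p L :: real and P0 P1 :: "real ^ 2"
  assumes "p > 2" and "L > 0" and "norm (P1 - P0) < L"
    and "norm (P1 - P0) > 1 / (p - 1) * L"
  shows "\<exists>F. uncountable F \<and> (\<forall>\<gamma>\<in>F. local_minimizer p P0 P1 L \<gamma>) \<and>
           (SUP \<gamma>\<in>F. ereal (bending_energy p L \<gamma>)) = \<infinity>"
proof -
  define D where "D = norm (P1 - P0)"
  have D: "0 < D" "D < L" "L < (p - 1) * D"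
  proof -
    show "D < L" using assms by (simp add: D_def)
    show "L < (p - 1) * D" using assms by (simp add: D_def field_simps)
    have "0 < 1 / (p - 1) * L" using assms(1,2) by simp
    then show "0 < D" using assms(4) unfolding D_def by linarith
  qed
  obtain \<alpha> where \<alpha>: "P1 = P0 + D *\<^sub>R direction \<alpha>"
  proof -
    have "((P1 - P0) $ 1 / D)\<^sup>2 + ((P1 - P0) $ 2 / D)\<^sup>2 = (((P1 - P0) $ 1)\<^sup>2 + ((P1 - P0) $ 2)\<^sup>2) / D\<^sup>2"
      by (simp add: power_divide add_divide_distrib)
    also have "((P1 - P0) $ 1)\<^sup>2 + ((P1 - P0) $ 2)\<^sup>2 = D\<^sup>2" unfolding D_def norm_vec2 by simp
    also have "D\<^sup>2 / D\<^sup>2 = 1" using D by simp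
    finally obtain t where "(P1 - P0) $ 1 / D = cos t" "(P1 - P0) $ 2 / D = sin t" by (rule sincos_total_2pi)
    then have "P1 = P0 + D *\<^sub>R direction t" using D by (auto simp: vec_eq_iff forall_2 field_simps)
    then show thesis by (rule that)
  qed
  \<comment> \<open>The loop length for which segments and loops together have displacement
    \<open>D\<close>.\<close>
  define l where "l = (L - D) * (p - 1) / (p - 2)"
  have l: "l > 0" using D assms by (simp add: l_def)
  have lD: "l * (p - 2) = (L - D) * (p - 1)" using assms by (simp add: l_def)
  \<comment> \<open>The lower bound on the distance of the endpoints is used here, in the form
    \<open>L < (p - 1) * D\<close>.\<close>
  have lL: "l < L"
  proof -
    have "(L - D) * (p - 1) < L * (p - 2)" using D by (simp add: algebra_simps)
    then show ?thesis using assms by (simp add: l_def divide_less_eq)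
  qed
  obtain \<theta> S where \<theta>: "\<And>n. n \<ge> 1 \<Longrightarrow> loops_angle p l n (\<theta> n) (S n)"
    using loops_angle_exists[OF assms(1) l] by metis
  have fc: "flat_core p L D \<alpha> l s0 n (\<theta> n) (S n) P0 P1" if "n \<ge> 1" "0 < s0" "s0 < L - l" for n s0
    using assms(1,2) l that lD \<alpha> \<theta>[OF that(1)] by unfold_locales auto
  define \<gamma> where "\<gamma> n s0 = flat_core.curve L \<alpha> s0 (\<theta> n) P0" for n s0
  define F where "F = {\<gamma> n s0 | n s0. n \<ge> 1 \<and> 0 < s0 \<and> s0 < L - l}"
  \<comment> \<open>Just after arclength \<open>a\<close> the first curve is already turning while
    the second is still straight. If the curves were equal, their tangents would agree almost
    everywhere, hence everywhere by continuity.\<close>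
  have differ: "\<gamma> 1 a \<noteq> \<gamma> 1 b" if ab: "0 < a" "a < b" "b < L - l" for a b
  proof
    assume eq: "\<gamma> 1 a = \<gamma> 1 b"
    interpret A: flat_core p L D \<alpha> l a 1 "\<theta> 1" "S 1" P0 P1 using fc[of 1 a] ab by simp
    interpret B: flat_core p L D \<alpha> l b 1 "\<theta> 1" "S 1" P0 P1 using fc[of 1 b] ab by simp
    have "has_weak_deriv L A.curve A.tangent" "has_weak_deriv L A.curve B.tangent"
      using arclength_liftD(1)[OF A.curve_lift assms(2)] arclength_liftD(1)[OF B.curve_lift assms(2)] eq
      by (simp_all add: \<gamma>_def)
    from weak_deriv_unique[OF this assms(2)]
    have T: "A.tangent x = B.tangent x" if "x \<in> {0..L}" for x
      by (rule continuous_AE_eq_imp_eq[OF A.tangent_cont B.tangent_cont assms(2) _ that])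
    \<comment> \<open>A point strictly inside the loop of the first curve, before \<open>b\<close>,
      and off the finite exceptional set.\<close>
    have "infinite ({a<..<min b (a + l)} - (\<lambda>x. x + a) ` S 1)"
      using A.S ab l by (intro Diff_infinite_finite) auto
    then obtain s where "s \<in> {a<..<min b (a + l)} - (\<lambda>x. x + a) ` S 1"
      using infinite_imp_nonempty by blast
    then have s: "a < s" "s < b" "s < a + l" "s \<notin> (\<lambda>x. x + a) ` S 1" by auto
    have "s - a \<notin> S 1" using s(4) by (metis diff_add_cancel imageI)
    then have nz: "sin (A.angle s / 2) \<noteq> 0" using A.\<theta>nz[of "s - a"] s unfolding A.angle_def by auto
    have "B.tangent s = direction \<alpha>" using B.angle_outside(1)[of s] s unfolding B.tangent_def by auto
    then have "A.tangent s = direction \<alpha>" using T[of s] s ab l by auto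
    then show False using A.tangent_eq_iff_sin nz by blast
  qed
  \<comment> \<open>Curves with a single loop and varying \<open>s0\<close> already form an
    uncountable family.\<close>
  have "inj_on (\<gamma> 1) {0<..<L - l}"
    by (rule linorder_inj_onI) (use differ in auto)
  moreover have "uncountable {0<..<L - l}" using lL by (intro uncountable_open_interval[THEN iffD2]) simp
  moreover have "\<gamma> 1 s \<in> F" if "0 < s" "s < L - l" for s
    unfolding F_def using that le_refl[of "1::nat"] by blast
  then have "\<gamma> 1 ` {0<..<L - l} \<subseteq> F" by auto
  ultimately have "uncountable F" using countable_image_inj_on countable_subset by metis
  moreover have "local_minimizer p P0 P1 L c" if "c \<in> F" for c
    using that flat_core.curve_local_minimizer[OF fc] by (auto simp: F_def \<gamma>_def)
  moreover have "(SUP c\<in>F. ereal (bending_energy p L c)) = \<infinity>"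
  proof (rule SUP_PInfty)
    fix m :: nat
    define C where "C = 2 * loop_time (2 / p) pi / l"
    have C: "C > 0" using l assms(1) loop_time_pi_pos[of "2 / p"] by (simp add: C_def)
    \<comment> \<open>The 1 in the maximum makes the base \<open>real N * C\<close> exceed 1, so its
      power with exponent \<open>p\<close> is at least the base itself; it also excludes
      \<open>N = 0\<close>.\<close>
    obtain N :: nat where N: "max 1 (2 * real m / (L - D)) < real N * C" using reals_Archimedean3[OF C] by blast
    then have "N \<noteq> 0" by (intro notI) simp
    then have N1: "N \<ge> 1" by simp
    have s: "0 < (L - l) / 2" "(L - l) / 2 < L - l" using lL by auto
    have sp: "loop_speed p l N = real N * C" by (simp add: loop_speed_def C_def)
    have "bending_energy p L (\<gamma> N ((L - l) / 2)) = (real N * C) powr p * ((L - D) / 2)"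
      using flat_core.curve_energy[OF fc[OF N1 s]] flat_core.\<mu>_def[OF fc[OF N1 s]] by (simp add: \<gamma>_def sp)
    moreover have "(real N * C) powr 1 \<le> (real N * C) powr p" using N assms(1) by (intro powr_mono) auto
    then have "2 * real m / (L - D) \<le> (real N * C) powr p" using N by simp
    then have "2 * real m / (L - D) * ((L - D) / 2) \<le> (real N * C) powr p * ((L - D) / 2)"
      using D by (intro mult_right_mono) auto
    then have "real m \<le> (real N * C) powr p * ((L - D) / 2)" using D by simp
    ultimately have "ereal (real m) \<le> ereal (bending_energy p L (\<gamma> N ((L - l) / 2)))" by simp
    moreover have "\<gamma> N ((L - l) / 2) \<in> F" unfolding F_def using N1 s by blast
    ultimately show "\<exists>c\<in>F. ereal (real m) \<le> ereal (bending_energy p L c)" by blast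
  qed
  ultimately show ?thesis by blast
qed

end
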